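(* Let $f$ solve the linear transport equation under diffusive scaling $$\varepsilon\,\partial_t f + v\cdot\nabla_x f = \frac{1}{\varepsilon}\mathcal L(f),\qquad f(t=0,x,v)=f_0(x,v),\qquad \mathcal L(f)(t,x,v)=\sigma(x)\Big[\tfrac12\int_{-1}^1 f(t,x,v')\,dv' - f(t,x,v)\Big],$$ for $t\in[0,T]$, $x\in\Omega$, $v\in V=[-1,1]$, with inflow boundary condition $f=g$ on $[0,T]\times\gamma_-$, and suppose that $f\in C^1([0,T])\cap C^1(\Omega\times V)$. Then there exists a sequence of neural network parameters $\{m_{[j]},w_{[j]},b_{[j]}\}_{j=1}^\infty$ such that the sequence of deep neural network solutions with $m_{[j]}$ nodes, $f_j(t,x,v)=f^{nn}(t,x,v;m_{[j]},w_{[j]},b_{[j]})$, satisfies $$Loss_{Total}(f_j)\to 0\qquad\text{as } j\to\infty.$$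
   Context: Setting. $T>0$ is a final time and $\varepsilon>0$ is the scaling parameter (Knudsen number); $\Omega\subset\mathbb R$ is a bounded one-dimensional spatial domain with boundary $\partial\Omega$ and unit outward normal $n_x$; the velocity domain is $V=[-1,1]$; $\sigma(x)$ is the scattering coefficient; $f_0$ is the initial datum and $g$ the inflow boundary datum. The incoming phase boundary is $\gamma_-=\{(x,v)\in\partial\Omega\times[-1,1]: n_x\cdot v<0\}$. The hypothesis $f\in C^1([0,T])\cap C^1(\Omega\times V)$ refers to $C^1$ regularity of $f$ in the time variable $t\in[0,T]$ and in the phase variables $(x,v)\in\Omega\times V$. Neural networks. $f^{nn}(t,x,v;m,w,b)$ denotes the output of a fully connected network with $L$ layers that takes $(t,x,v)$ as input, where $m=(m_0,m_1,\dots,m_{L-1})$ are the layer widths, $w=\{w^{(k)}_{ji}\}$ the weights, $b=\{b^{(k)}_j\}$ the biases, and $\bar\sigma_l$ the activation functions. Consecutive layers are related by $u^{(l+1)}_j=\sum_{i=1}^{m_l}w^{(l+1)}_{ji}\,\bar\sigma_l(u^{(l)}_i)+b^{(l+1)}_j$ for $l=1,\dots,L-1$, and the last layer gives $f^{nn}$. In the two-layer case, $f^{nn}(t,x,v)=\sum_{i=1}^{m_1}w^{(2)}_{1i}\,\bar\sigma\big((w^{(1)}_{i1},w^{(1)}_{i2},w^{(1)}_{i3})\cdot(t,x,v)+b^{(1)}_i\big)+b^{(2)}_1$. Recalled fact (Universal Approximation Theorem, in the form used by the authors): if $f$ solves the linear transport model above and is sufficiently smooth in all variables, then for $\eta>0$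 there is a two-layer network $f^{nn}$ such that, with $K=[0,T]\times\Omega\times[-1,1]$, $\|f-f^{nn}\|_{L^\infty(K)}<\eta$, $\|\partial_t(f-f^{nn})\|_{L^\infty(K)}<\eta$ and $\|\nabla_x(f-f^{nn})\|_{L^\infty(K)}<\eta$; the result extends to multi-layer networks. Loss functions. For a network function $h$, $$Loss_{GE}(h)=\int_0^T\!\int_\Omega\int_V\Big|\varepsilon\partial_t h+v\,\partial_x h-\tfrac1\varepsilon\mathcal L(h)\Big|^2dv\,dx\,dt,$$ $$Loss_{IC}(h)=\int_\Omega\int_V|h(0,x,v)-f_0(x,v)|^2\,dv\,dx,$$ $$Loss_{BC}(h)=\sum_{x\in\partial\Omega}\int_0^T\!\int_{\{v\in V:\,n_x\cdot v<0\}}|h(t,x,v)-g(t,x,v)|^2\,dv\,dt,$$ and $Loss_{Total}(h)=\lambda_g Loss_{GE}(h)+\lambda_i Loss_{IC}(h)+\lambda_b Loss_{BC}(h)$ with given (appropriately chosen) weights $\lambda_g,\lambda_i,\lambda_b$.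
   Formalization: The scattering coefficient σ is assumed bounded and Borel measurable, the activation functions continuously differentiable and non-polynomial, the loss weights nonnegative, and f continuous up to the boundary of Ω; with arbitrary σ or activations the claim fails. *)

theory Defs
  imports "HOL-Analysis.Analysis" "HOL-Computational_Algebra.Polynomial"
begin

text \<open>Phase-space functions are curried as \<open>h t x v\<close>; the velocity domain is \<open>{-1..1}\<close>.\<close>

text \<open>
  The derivatives in time and velocity are taken within the closed intervals, hence one-sided at
  end points. The spatial domain is open, so the derivative in space is the two-sided one.
\<close>

definition time_deriv :: "real \<Rightarrow> (real \<Rightarrow> real \<Rightarrow> real \<Rightarrow> real) \<Rightarrow> real \<Rightarrow> real \<Rightarrow> real \<Rightarrow> real" where
  "time_deriv T h t x v = vector_derivative (\<lambda>s. h s x v) (at t within {0..T})"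

definition space_deriv :: "(real \<Rightarrow> real \<Rightarrow> real \<Rightarrow> real) \<Rightarrow> real \<Rightarrow> real \<Rightarrow> real \<Rightarrow> real" where
  "space_deriv h t x v = deriv (\<lambda>y. h t y v) x"

definition vel_deriv :: "(real \<Rightarrow> real \<Rightarrow> real \<Rightarrow> real) \<Rightarrow> real \<Rightarrow> real \<Rightarrow> real \<Rightarrow> real" where
  "vel_deriv h t x v = vector_derivative (\<lambda>w. h t x w) (at v within {-1..1})"

text \<open>
  The regularity class \<open>C\<^sup>1([0,T]) \<inter> C\<^sup>1(\<Omega> \<times> V)\<close>: all first-order partial derivatives exist and are
  jointly continuous on \<open>[0,T] \<times> \<Omega> \<times> V\<close>. Nothing is required of the derivatives at the boundary of
  \<open>\<Omega>\<close>, where they may blow up; the function itself is continuous up to that boundary, so that its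
  boundary values are meaningful.
\<close>

definition C1_time_phase :: "real \<Rightarrow> real set \<Rightarrow> (real \<Rightarrow> real \<Rightarrow> real \<Rightarrow> real) \<Rightarrow> bool" where
  "C1_time_phase T \<Omega> f \<longleftrightarrow>
     continuous_on ({0..T} \<times> closure \<Omega> \<times> {-1..1}) (\<lambda>(t, x, v). f t x v) \<and>
     (\<forall>t\<in>{0..T}. \<forall>x\<in>\<Omega>. \<forall>v\<in>{-1..1}.
        (\<lambda>s. f s x v) differentiable (at t within {0..T}) \<and>
        (\<lambda>y. f t y v) differentiable (at x) \<and>
        (\<lambda>w. f t x w) differentiable (at v within {-1..1})) \<and>
     continuous_on ({0..T} \<times> \<Omega> \<times> {-1..1}) (\<lambda>(t, x, v). time_deriv T f t x v) \<and>
     continuous_on ({0..T} \<times> \<Omega> \<times> {-1..1}) (\<lambda>(t, x, v). space_deriv f t x v) \<and>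
     continuous_on ({0..T} \<times> \<Omega> \<times> {-1..1}) (\<lambda>(t, x, v). vel_deriv f t x v)"

definition scattering ::
  "(real \<Rightarrow> real) \<Rightarrow> (real \<Rightarrow> real \<Rightarrow> real \<Rightarrow> real) \<Rightarrow> real \<Rightarrow> real \<Rightarrow> real \<Rightarrow> real" where
  "scattering \<sigma> h t x v = \<sigma> x * (1/2 * (LBINT v':{-1..1}. h t x v') - h t x v)"

definition outward_normal :: "real set \<Rightarrow> real \<Rightarrow> real" where
  "outward_normal \<Omega> x =
     (THE n. \<bar>n\<bar> = 1 \<and> (\<forall>\<^sub>F s in at_right 0. x - s * n \<in> \<Omega> \<and> x + s * n \<notin> \<Omega>))"

lemma outward_normal_interval:
  assumes "a < b"
  shows "outward_normal {a<..<b} a = -1" and "outward_normal {a<..<b} b = 1"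
proof -
  have ev: "\<forall>\<^sub>F s in at_right (0::real). 0 < s \<and> s < b - a"
    unfolding eventually_at_right_field using assms by (intro exI[of _ "b - a"]) auto
  have pm: "n = 1 \<or> n = -1" if "\<bar>n\<bar> = 1" for n :: real
    using that by linarith
  have no: False if "\<forall>\<^sub>F s in at_right (0::real). P s" "\<And>s. s > 0 \<Longrightarrow> \<not> P s" for P
  proof -
    have "\<forall>\<^sub>F s in at_right (0::real). False"
      using that(1) ev by eventually_elim (use that(2) in auto)
    then show False by simp
  qed
  show "outward_normal {a<..<b} a = -1"
    unfolding outward_normal_def
  proof (rule the_equality)
    show "\<bar>-1::real\<bar> = 1 \<and> (\<forall>\<^sub>F s in at_right 0. a - s * -1 \<in> {a<..<b} \<and> a + s * -1 \<notin> {a<..<b})"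
      using ev by (auto elim!: eventually_mono)
  next
    fix n :: real
    assume n: "\<bar>n\<bar> = 1 \<and> (\<forall>\<^sub>F s in at_right 0. a - s * n \<in> {a<..<b} \<and> a + s * n \<notin> {a<..<b})"
    show "n = -1"
    proof (rule ccontr)
      assume "n \<noteq> -1"
      then have "n = 1" using pm n by blast
      then show False using n no[of "\<lambda>s. a - s * n \<in> {a<..<b} \<and> a + s * n \<notin> {a<..<b}"] by auto
    qed
  qed
  show "outward_normal {a<..<b} b = 1"
    unfolding outward_normal_def
  proof (rule the_equality)
    show "\<bar>1::real\<bar> = 1 \<and> (\<forall>\<^sub>F s in at_right 0. b - s * 1 \<in> {a<..<b} \<and> b + s * 1 \<notin> {a<..<b})"
      using ev by (auto elim!: eventually_mono)
  next
    fix n :: real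
    assume n: "\<bar>n\<bar> = 1 \<and> (\<forall>\<^sub>F s in at_right 0. b - s * n \<in> {a<..<b} \<and> b + s * n \<notin> {a<..<b})"
    show "n = 1"
    proof (rule ccontr)
      assume "n \<noteq> 1"
      then have "n = -1" using pm n by blast
      then show False using n no[of "\<lambda>s. b - s * n \<in> {a<..<b} \<and> b + s * n \<notin> {a<..<b}"] by auto
    qed
  qed
qed

definition inflow_boundary :: "real set \<Rightarrow> (real \<times> real) set" where
  "inflow_boundary \<Omega> = {(x, v). x \<in> frontier \<Omega> \<and> v \<in> {-1..1} \<and> outward_normal \<Omega> x * v < 0}"

definition solves_transport ::
  "real \<Rightarrow> real \<Rightarrow> real set \<Rightarrow> (real \<Rightarrow> real) \<Rightarrow> (real \<Rightarrow> real \<Rightarrow> real) \<Rightarrow> (real \<Rightarrow> real \<Rightarrow> real \<Rightarrow> real) \<Rightarrow>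
   (real \<Rightarrow> real \<Rightarrow> real \<Rightarrow> real) \<Rightarrow> bool" where
  "solves_transport \<epsilon> T \<Omega> \<sigma> f0 g f \<longleftrightarrow>
     (\<forall>t\<in>{0..T}. \<forall>x\<in>\<Omega>. \<forall>v\<in>{-1..1}.
        \<epsilon> * time_deriv T f t x v + v * space_deriv f t x v = 1 / \<epsilon> * scattering \<sigma> f t x v) \<and>
     (\<forall>x\<in>\<Omega>. \<forall>v\<in>{-1..1}. f 0 x v = f0 x v) \<and>
     (\<forall>t\<in>{0..T}. \<forall>(x, v)\<in>inflow_boundary \<Omega>. f t x v = g t x v)"

text \<open>
  Losses are \<open>[0,\<infinity>]\<close>-valued, so that a non-integrable residual counts as an infinite loss rather than
  as zero.
\<close>

definition loss_GE ::
  "real \<Rightarrow> real \<Rightarrow> real set \<Rightarrow> (real \<Rightarrow> real) \<Rightarrow> (real \<Rightarrow> real \<Rightarrow> real \<Rightarrow> real) \<Rightarrow> ennreal" where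
  "loss_GE \<epsilon> T \<Omega> \<sigma> h =
     (\<integral>\<^sup>+t\<in>{0..T}. (\<integral>\<^sup>+x\<in>\<Omega>. (\<integral>\<^sup>+v\<in>{-1..1}.
        ennreal (\<bar>\<epsilon> * time_deriv T h t x v + v * space_deriv h t x v
                  - 1 / \<epsilon> * scattering \<sigma> h t x v\<bar>\<^sup>2) \<partial>lborel) \<partial>lborel) \<partial>lborel)"

definition loss_IC ::
  "real set \<Rightarrow> (real \<Rightarrow> real \<Rightarrow> real) \<Rightarrow> (real \<Rightarrow> real \<Rightarrow> real \<Rightarrow> real) \<Rightarrow> ennreal" where
  "loss_IC \<Omega> f0 h =
     (\<integral>\<^sup>+x\<in>\<Omega>. (\<integral>\<^sup>+v\<in>{-1..1}. ennreal (\<bar>h 0 x v - f0 x v\<bar>\<^sup>2) \<partial>lborel) \<partial>lborel)"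

definition loss_BC ::
  "real \<Rightarrow> real set \<Rightarrow> (real \<Rightarrow> real \<Rightarrow> real \<Rightarrow> real) \<Rightarrow> (real \<Rightarrow> real \<Rightarrow> real \<Rightarrow> real) \<Rightarrow> ennreal" where
  "loss_BC T \<Omega> g h =
     (\<Sum>x\<in>frontier \<Omega>. \<integral>\<^sup>+t\<in>{0..T}. (\<integral>\<^sup>+v\<in>{v \<in> {-1..1}. outward_normal \<Omega> x * v < 0}.
        ennreal (\<bar>h t x v - g t x v\<bar>\<^sup>2) \<partial>lborel) \<partial>lborel)"

definition loss_total ::
  "real \<Rightarrow> real \<Rightarrow> real \<Rightarrow> real \<Rightarrow> real \<Rightarrow> real set \<Rightarrow> (real \<Rightarrow> real) \<Rightarrow> (real \<Rightarrow> real \<Rightarrow> real) \<Rightarrow>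
   (real \<Rightarrow> real \<Rightarrow> real \<Rightarrow> real) \<Rightarrow> (real \<Rightarrow> real \<Rightarrow> real \<Rightarrow> real) \<Rightarrow> ennreal" where
  "loss_total lam_g lam_i lam_b \<epsilon> T \<Omega> \<sigma> f0 g h =
     ennreal lam_g * loss_GE \<epsilon> T \<Omega> \<sigma> h + ennreal lam_i * loss_IC \<Omega> f0 h + ennreal lam_b * loss_BC T \<Omega> g h"

text \<open>
  The value \<open>net_layer act m w b y l j\<close> is the pre-activation \<open>u\<^sup>(\<^sup>l\<^sup>)\<close> of neuron \<open>j\<close> (counted from 1) in
  layer \<open>l\<close>, for widths \<open>m 0, m 1, \<dots>\<close>, weights \<open>w l j i\<close>, biases \<open>b l j\<close> and activations \<open>act l\<close>. Layer 0
  is the raw input \<open>y\<close>, to which no activation is applied. Only \<open>m l\<close>, \<open>w (Suc l)\<close>, \<open>b (Suc l)\<close> for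
  \<open>l < L\<close> and \<open>act l\<close> for \<open>0 < l < L\<close> matter for a network with \<open>L\<close> layers.
\<close>

primrec net_layer ::
  "(nat \<Rightarrow> real \<Rightarrow> real) \<Rightarrow> (nat \<Rightarrow> nat) \<Rightarrow> (nat \<Rightarrow> nat \<Rightarrow> nat \<Rightarrow> real) \<Rightarrow> (nat \<Rightarrow> nat \<Rightarrow> real) \<Rightarrow>
   (nat \<Rightarrow> real) \<Rightarrow> nat \<Rightarrow> nat \<Rightarrow> real" where
  "net_layer act m w b y 0 j = y j"
| "net_layer act m w b y (Suc l) j =
     (\<Sum>i=1..m l. w (Suc l) j i *
        (if l = 0 then net_layer act m w b y l i else act l (net_layer act m w b y l i)))
     + b (Suc l) j"

definition network ::
  "nat \<Rightarrow> (nat \<Rightarrow> real \<Rightarrow> real) \<Rightarrow> (nat \<Rightarrow> nat) \<Rightarrow> (nat \<Rightarrow> nat \<Rightarrow> nat \<Rightarrow> real) \<Rightarrow> (nat \<Rightarrow> nat \<Rightarrow> real) \<Rightarrow>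
   real \<Rightarrow> real \<Rightarrow> real \<Rightarrow> real" where
  "network L act m w b t x v =
     net_layer act m w b (\<lambda>i. if i = 1 then t else if i = 2 then x else v) L 1"

text \<open>The input has three components and no hidden layer is empty.\<close>

definition admissible_widths :: "nat \<Rightarrow> (nat \<Rightarrow> nat) \<Rightarrow> bool" where
  "admissible_widths L m \<longleftrightarrow> m 0 = 3 \<and> (\<forall>l\<in>{1..<L}. 1 \<le> m l)"

lemma network_two_layers:
  assumes "m 0 = 3"
  shows "network 2 act m w b t x v =
    (\<Sum>i=1..m 1. w 2 1 i * act 1 (w 1 i 1 * t + w 1 i 2 * x + w 1 i 3 * v + b 1 i)) + b 2 1"
  using assms by (simp add: network_def numeral_eq_Suc)

text \<open>
  The activations for which the universal approximation theorem in \<open>C\<^sup>1\<close> holds: continuously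
  differentiable, as derivatives of the network enter the loss, and not a polynomial, as otherwise
  the two-layer networks span a finite-dimensional space.
\<close>

definition admissible_activation :: "(real \<Rightarrow> real) \<Rightarrow> bool" where
  "admissible_activation s \<longleftrightarrow> s C1_differentiable_on UNIV \<and> \<not> (\<exists>p. \<forall>u. s u = poly p u)"

end

theory Submission
  imports Defs
begin

text \<open>
  A solution may have unbounded derivatives at the boundary of the domain. Dilating it about the
  midpoint of the domain in \<open>x\<close>, and by the same factor in \<open>t\<close>, yields a function that is \<open>C\<^sup>1\<close> up to the
  boundary. Its residual is small inside the domain and bounded elsewhere, because the equation
  controls the combination of the derivatives that enters it. It then suffices to approximate this
  function by networks, uniformly together with its derivatives in \<open>t\<close> and \<open>x\<close>.

  Averaging a nonpolynomial activation \<open>k\<close> times over intervals of length \<open>h\<close> gives a \<open>C\<^sup>k\<close> function in the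
  closure of the ridge functions. Its \<open>k\<close>-th derivative does not vanish for every \<open>h\<close>, as otherwise the
  activation would be a limit of polynomials of degree below \<open>k\<close>. Expanding \<open>\<phi> (w y + b)\<close> at \<open>w = 0\<close> then
  puts all monomials, hence the exponential function, into the closure. Exponential sums in \<open>(t, x, v)\<close>
  form an algebra, so the Stone--Weierstrass theorem applies to them, and integrating their
  approximations of the derivatives gives approximation in \<open>C\<^sup>1\<close>. Further layers can pass their input on
  almost unchanged.
\<close>

section \<open>Uniform closures of linear hulls\<close>

text \<open>Networks have derivatives that are bounded on the phase space, while those of
  \<open>f\<close> may blow up at the end points of the domain, so \<open>f\<close> itself cannot be
  approximated in C1 up to the boundary. Dilating in \<open>x\<close> alone would multiply only the
  space derivative by the factor \<open>\<mu>\<close>, and the resulting combination is not the one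
  in the equation; the common factor in \<open>t\<close> repairs this. It also defines the dilated
  function up to time \<open>T / \<mu> > T\<close>, which gives the difference quotients in
  \<open>t\<close> the room they need. A bounded residual near the boundary is enough because its
  bound \<open>M\<close> does not depend on \<open>\<eta>\<close>, whereas the strips where nothing
  better is known have total length at most \<open>2 * \<eta>\<close>. As \<open>\<sigma>\<close>
  may jump, its values at a point and at the dilated point need not be close; inside the domain the
  comparison is therefore made for the transport term \<open>Q\<close>, which is continuous there.
  Exponentials replace monomials in the density argument because a product of exponentials of linear
  forms is again one, while a product of powers of linear forms is in general not such a
  power.\<close>

inductive_set lin_hull :: "('a \<Rightarrow> 'b::real_vector) set \<Rightarrow> ('a \<Rightarrow> 'b) set" for S where
  zero: "(\<lambda>_. 0) \<in> lin_hull S"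
| step: "h \<in> lin_hull S \<Longrightarrow> g \<in> S \<Longrightarrow> (\<lambda>x. h x + c *\<^sub>R g x) \<in> lin_hull S"

lemma lin_hull_add:
  assumes "g \<in> lin_hull S" "h \<in> lin_hull S"
  shows "(\<lambda>x. g x + h x) \<in> lin_hull S"
  using assms(2)
proof induction
  case (step h k c)
  then show ?case
    using lin_hull.step[of "\<lambda>x. g x + h x" S k c] by (simp add: add.assoc)
qed (use assms in simp)

lemma lin_hull_scale:
  assumes "h \<in> lin_hull S"
  shows "(\<lambda>x. c *\<^sub>R h x) \<in> lin_hull S"
  using assms
proof induction
  case zero
  then show ?case by (simp add: lin_hull.zero)
next
  case (step h k d)
  then show ?case
    using lin_hull.step[of "\<lambda>x. c *\<^sub>R h x" S k "c * d"] by (simp add: algebra_simps)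
qed

lemma lin_hull_base: "g \<in> S \<Longrightarrow> g \<in> lin_hull S"
  using lin_hull.step[OF lin_hull.zero, of g S 1] by simp

lemma lin_hull_continuous:
  fixes S :: "('a::topological_space \<Rightarrow> 'b::real_normed_vector) set"
  assumes "\<And>g. g \<in> S \<Longrightarrow> continuous_on K g" "h \<in> lin_hull S"
  shows "continuous_on K h"
  using assms(2)
proof induction
  case (step h g c)
  then show ?case
    using assms(1)[OF step(2)] by (intro continuous_on_add continuous_on_scaleR continuous_on_const)
qed simp

definition unif_closure ::
  "'a set \<Rightarrow> ('a \<Rightarrow> 'b::real_normed_vector) set \<Rightarrow> ('a \<Rightarrow> 'b) set" where
  "unif_closure K S = {J. \<forall>e>0. \<exists>h\<in>lin_hull S. \<forall>y\<in>K. norm (J y - h y) \<le> e}"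

lemma unif_closureI:
  "(\<And>e. e > 0 \<Longrightarrow> \<exists>h\<in>lin_hull S. \<forall>y\<in>K. norm (J y - h y) \<le> e) \<Longrightarrow> J \<in> unif_closure K S"
  by (simp add: unif_closure_def)

lemma unif_closureD:
  "J \<in> unif_closure K S \<Longrightarrow> e > 0 \<Longrightarrow> \<exists>h\<in>lin_hull S. \<forall>y\<in>K. norm (J y - h y) \<le> e"
  by (simp add: unif_closure_def)

lemma lin_hull_in_unif_closure: "h \<in> lin_hull S \<Longrightarrow> h \<in> unif_closure K S"
  by (rule unif_closureI) (auto intro!: bexI[of _ h])

lemma unif_closure_lim:
  assumes "\<And>e. e > 0 \<Longrightarrow> \<exists>h\<in>unif_closure K S. \<forall>y\<in>K. norm (J y - h y) \<le> e"
  shows "J \<in> unif_closure K S"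
proof (rule unif_closureI)
  fix e :: real assume "e > 0"
  then obtain h where h: "h \<in> unif_closure K S" "\<forall>y\<in>K. norm (J y - h y) \<le> e/2"
    using assms[of "e/2"] by auto
  obtain k where k: "k \<in> lin_hull S" "\<forall>y\<in>K. norm (h y - k y) \<le> e/2"
    using unif_closureD[OF h(1), of "e/2"] \<open>e > 0\<close> by auto
  have "norm (J y - k y) \<le> e" if "y \<in> K" for y
    using norm_diff_triangle_le[of "J y" "h y" "e/2" "k y" "e/2"] h(2) k(2) that by simp
  then show "\<exists>h\<in>lin_hull S. \<forall>y\<in>K. norm (J y - h y) \<le> e"
    using k(1) by blast
qed

lemma unif_closure_mono_set: "K' \<subseteq> K \<Longrightarrow> J \<in> unif_closure K S \<Longrightarrow> J \<in> unif_closure K' S"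
  by (fastforce simp: unif_closure_def)

lemma unif_closure_add:
  assumes "J \<in> unif_closure K S" "J' \<in> unif_closure K S"
  shows "(\<lambda>y. J y + J' y) \<in> unif_closure K S"
proof (rule unif_closureI)
  fix e :: real assume "e > 0"
  obtain h h' where h: "h \<in> lin_hull S" "\<forall>y\<in>K. norm (J y - h y) \<le> e/2"
    and h': "h' \<in> lin_hull S" "\<forall>y\<in>K. norm (J' y - h' y) \<le> e/2"
    using assms[THEN unif_closureD, of "e/2"] \<open>e > 0\<close> by auto
  have "norm (J y + J' y - (h y + h' y)) \<le> e" if "y \<in> K" for y
    using norm_diff_triangle_ineq[of "J y" "J' y" "h y" "h' y"] h(2) h'(2) that by fastforce
  then show "\<exists>h\<in>lin_hull S. \<forall>y\<in>K. norm (J y + J' y - h y) \<le> e"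
    by (intro bexI[OF _ lin_hull_add[OF h(1) h'(1)]]) blast
qed

lemma unif_closure_scale:
  assumes "J \<in> unif_closure K S"
  shows "(\<lambda>y. c *\<^sub>R J y) \<in> unif_closure K S"
proof (rule unif_closureI)
  fix e :: real assume "e > 0"
  then obtain h where h: "h \<in> lin_hull S" "\<forall>y\<in>K. norm (J y - h y) \<le> e / (1 + \<bar>c\<bar>)"
    using unif_closureD[OF assms, of "e / (1 + \<bar>c\<bar>)"] by (auto simp: field_simps)
  have "norm (c *\<^sub>R J y - c *\<^sub>R h y) \<le> e" if "y \<in> K" for y
  proof -
    have "norm (c *\<^sub>R J y - c *\<^sub>R h y) = \<bar>c\<bar> * norm (J y - h y)"
      by (simp flip: scaleR_diff_right)
    also have "\<dots> \<le> \<bar>c\<bar> * (e / (1 + \<bar>c\<bar>))"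
      using h(2) that by (intro mult_left_mono) auto
    also have "\<dots> \<le> e"
      using \<open>e > 0\<close> by (simp add: field_simps)
    finally show ?thesis .
  qed
  then show "\<exists>h\<in>lin_hull S. \<forall>y\<in>K. norm (c *\<^sub>R J y - h y) \<le> e"
    using lin_hull_scale[OF h(1), of c] by (intro bexI[of _ "\<lambda>x. c *\<^sub>R h x"]) auto
qed

text \<open>Substituting \<open>\<rho>\<close> and applying \<open>A z\<close> is a bounded linear
  operation for the sup norms over \<open>K\<close> and \<open>K'\<close>, so its effect on the
  closure is decided by the generators. In the applications \<open>\<rho>\<close> is an affine or
  linear substitution and \<open>A\<close> is the chain rule acting on values and
  derivatives.\<close>

lemma unif_closure_transform:
  fixes A :: "'c \<Rightarrow> 'b::real_normed_vector \<Rightarrow> 'd::real_normed_vector"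
    and J :: "'a \<Rightarrow> 'b"
  assumes J: "J \<in> unif_closure K S"
    and lin: "\<And>z. linear (A z)"
    and bound: "\<And>z u. z \<in> K' \<Longrightarrow> norm (A z u) \<le> C * norm u"
    and dom: "\<And>z. z \<in> K' \<Longrightarrow> \<rho> z \<in> K"
    and gen: "\<And>g. g \<in> S \<Longrightarrow> (\<lambda>z. A z (g (\<rho> z))) \<in> unif_closure K' S'"
  shows "(\<lambda>z. A z (J (\<rho> z))) \<in> unif_closure K' S'"
proof (rule unif_closure_lim)
  have hull: "(\<lambda>z. A z (h (\<rho> z))) \<in> unif_closure K' S'" if "h \<in> lin_hull S" for h
    using that
  proof induction
    case zero
    then show ?case
      by (simp add: linear_0[OF lin] lin_hull_in_unif_closure lin_hull.zero)
  next
    case (step h g c)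
    have "(\<lambda>z. A z (h (\<rho> z)) + c *\<^sub>R A z (g (\<rho> z))) \<in> unif_closure K' S'"
      by (intro unif_closure_add step unif_closure_scale gen)
    then show ?case
      by (simp add: linear_add[OF lin] linear_scale[OF lin])
  qed
  fix e :: real assume "e > 0"
  then obtain h where h: "h \<in> lin_hull S" "\<forall>y\<in>K. norm (J y - h y) \<le> e / (1 + \<bar>C\<bar>)"
    using unif_closureD[OF J, of "e / (1 + \<bar>C\<bar>)"] by (auto simp: field_simps)
  have "norm (A z (J (\<rho> z)) - A z (h (\<rho> z))) \<le> e" if "z \<in> K'" for z
  proof -
    have "norm (A z (J (\<rho> z)) - A z (h (\<rho> z))) \<le> C * norm (J (\<rho> z) - h (\<rho> z))"
      using bound[OF that] by (simp flip: linear_diff[OF lin])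
    also have "\<dots> \<le> \<bar>C\<bar> * (e / (1 + \<bar>C\<bar>))"
      using h(2) dom[OF that] by (intro mult_mono) auto
    also have "\<dots> \<le> e"
      using \<open>e > 0\<close> by (simp add: field_simps)
    finally show ?thesis .
  qed
  then show "\<exists>h\<in>unif_closure K' S'. \<forall>z\<in>K'. norm (A z (J (\<rho> z)) - h z) \<le> e"
    by (intro bexI[OF _ hull[OF h(1)]]) blast
qed

lemma unif_closure_idem:
  assumes "J \<in> unif_closure K S" "S \<subseteq> unif_closure K S'"
  shows "J \<in> unif_closure K S'"
proof (rule unif_closure_lim)
  have hull: "h \<in> unif_closure K S'" if "h \<in> lin_hull S" for h
    using that
  proof induction
    case zero
    show ?case by (rule lin_hull_in_unif_closure[OF lin_hull.zero])
  next
    case (step h g c)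
    have "(\<lambda>x. c *\<^sub>R g x) \<in> unif_closure K S'"
      using step.hyps(2) assms(2) by (intro unif_closure_scale) (rule subsetD)
    then show ?case
      by (rule unif_closure_add[OF step.IH])
  qed
  show "\<exists>h\<in>unif_closure K S'. \<forall>y\<in>K. norm (J y - h y) \<le> e" if e: "e > 0" for e
  proof -
    obtain h where h: "h \<in> lin_hull S" "\<forall>y\<in>K. norm (J y - h y) \<le> e"
      using unif_closureD[OF assms(1) e] by blast
    then show ?thesis
      by (intro bexI[OF _ hull[OF h(1)]])
  qed
qed

lemma unif_closure_sum:
  assumes "finite I" "\<And>i. i \<in> I \<Longrightarrow> J i \<in> unif_closure K S"
  shows "(\<lambda>y. \<Sum>i\<in>I. J i y) \<in> unif_closure K S"
  using assms
proof (induction I rule: finite_induct)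
  case empty
  then show ?case by (simp add: lin_hull_in_unif_closure lin_hull.zero)
next
  case (insert i I)
  then show ?case by (simp add: unif_closure_add)
qed

section \<open>Ridge functions of one variable\<close>

text \<open>
  A \<open>C\<^sup>1\<close> function is carried along with its derivative, as the function into the product space that
  returns both values: uniform closeness of these pairs is closeness in \<open>C\<^sup>1\<close>.
\<close>

definition ridge :: "(real \<Rightarrow> real) \<Rightarrow> (real \<Rightarrow> real) \<Rightarrow> (real \<Rightarrow> real \<times> real) set" where
  "ridge s s' = {\<lambda>y. (s (w * y + b), w * s' (w * y + b)) | w b. True}"

text \<open>This is C1 approximation on every bounded interval. All radii are demanded together
  because an affine substitution changes the interval; for \<open>R < 0\<close> the interval is
  empty and the condition trivial.\<close>

definition ridge_closure :: "(real \<Rightarrow> real) \<Rightarrow> (real \<Rightarrow> real) \<Rightarrow> (real \<Rightarrow> real \<times> real) set" where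
  "ridge_closure s s' = {J. \<forall>R. J \<in> unif_closure {-R..R} (ridge s s')}"

lemma norm_Pair_bound: "norm (a, b) \<le> \<bar>a\<bar> + \<bar>b\<bar>" for a b :: real
  using norm_Pair_le[of a b] by simp

lemma ridge_in_closure: "(\<lambda>y. (s (w * y + b), w * s' (w * y + b))) \<in> ridge_closure s s'"
proof -
  have "(\<lambda>y. (s (w * y + b), w * s' (w * y + b))) \<in> ridge s s'"
    unfolding ridge_def by blast
  then show ?thesis
    unfolding ridge_closure_def using lin_hull_in_unif_closure[OF lin_hull_base] by blast
qed

lemma ridge_closure_add:
  "J \<in> ridge_closure s s' \<Longrightarrow> J' \<in> ridge_closure s s' \<Longrightarrow> (\<lambda>y. J y + J' y) \<in> ridge_closure s s'"
  by (simp add: ridge_closure_def unif_closure_add)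

lemma ridge_closure_scale:
  "J \<in> ridge_closure s s' \<Longrightarrow> (\<lambda>y. c *\<^sub>R J y) \<in> ridge_closure s s'"
  by (simp add: ridge_closure_def unif_closure_scale)

lemma ridge_closure_sum:
  "finite I \<Longrightarrow> (\<And>i. i \<in> I \<Longrightarrow> J i \<in> ridge_closure s s') \<Longrightarrow> (\<lambda>y. \<Sum>i\<in>I. J i y) \<in> ridge_closure s s'"
  by (simp add: ridge_closure_def unif_closure_sum)

lemma ridge_closure_lim:
  assumes "\<And>e R. e > 0 \<Longrightarrow> R > 0 \<Longrightarrow> \<exists>h\<in>ridge_closure s s'. \<forall>y\<in>{-R..R}. norm (J y - h y) \<le> e"
  shows "J \<in> ridge_closure s s'"
  unfolding ridge_closure_def
proof safe
  fix R :: real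
  \<comment> \<open>The assumption speaks of positive radii only, hence the larger interval.\<close>
  have "J \<in> unif_closure {-(\<bar>R\<bar>+1)..\<bar>R\<bar>+1} (ridge s s')"
  proof (rule unif_closure_lim)
    fix e :: real assume "e > 0"
    moreover have "\<bar>R\<bar> + 1 > 0" by simp
    ultimately show "\<exists>h\<in>unif_closure {-(\<bar>R\<bar>+1)..\<bar>R\<bar>+1} (ridge s s').
        \<forall>y\<in>{-(\<bar>R\<bar>+1)..\<bar>R\<bar>+1}. norm (J y - h y) \<le> e"
      using assms unfolding ridge_closure_def by blast
  qed
  then show "J \<in> unif_closure {-R..R} (ridge s s')"
    by (rule unif_closure_mono_set[rotated]) auto
qed

text \<open>A ridge with weight \<open>w'\<close> composed with \<open>w * y + b\<close> is a ridge
  with weight \<open>w' * w\<close>, and the map of \<open>(p, q)\<close> to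
  \<open>(p, w * q)\<close> is the chain rule. Both are compatible with uniform limits.\<close>

lemma ridge_closure_affine:
  assumes "(\<lambda>y. (\<phi> y, \<phi>' y)) \<in> ridge_closure s s'"
  shows "(\<lambda>y. (\<phi> (w * y + b), w * \<phi>' (w * y + b))) \<in> ridge_closure s s'"
  unfolding ridge_closure_def
proof safe
  fix R :: real
  define R' where "R' = \<bar>w\<bar> * \<bar>R\<bar> + \<bar>b\<bar>"
  define A :: "real \<Rightarrow> real \<times> real \<Rightarrow> real \<times> real" where "A = (\<lambda>z (p, q). (p, w * q))"
  have "(\<lambda>z. A z ((\<lambda>y. (\<phi> y, \<phi>' y)) (w * z + b))) \<in> unif_closure {-R..R} (ridge s s')"
  proof (rule unif_closure_transform[where K = "{-R'..R'}" and S = "ridge s s'" and C = "1 + \<bar>w\<bar>"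
      and A = A and J = "\<lambda>y. (\<phi> y, \<phi>' y)" and \<rho> = "\<lambda>z. w * z + b"])
    show "(\<lambda>y. (\<phi> y, \<phi>' y)) \<in> unif_closure {- R'..R'} (ridge s s')"
      using assms by (simp add: ridge_closure_def)
    show "linear (A z)" for z
      by (rule linearI) (auto simp: A_def algebra_simps)
    show "norm (A z u) \<le> (1 + \<bar>w\<bar>) * norm u" for z u
    proof (cases u)
      case (Pair p q)
      have "\<bar>p\<bar> \<le> norm u" "\<bar>q\<bar> \<le> norm u"
        using norm_fst_le[of p q] norm_snd_le[of q p] Pair by auto
      then have "\<bar>p\<bar> + \<bar>w\<bar> * \<bar>q\<bar> \<le> (1 + \<bar>w\<bar>) * norm u"
        by (simp add: distrib_right add_mono mult_left_mono)
      then show ?thesis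
        using norm_Pair_bound[of p "w * q"] by (simp add: A_def Pair abs_mult)
    qed
    show "w * z + b \<in> {- R'..R'}" if "z \<in> {- R..R}" for z
    proof -
      have "\<bar>w * z\<bar> \<le> \<bar>w\<bar> * \<bar>R\<bar>"
        using that by (auto simp: abs_mult intro!: mult_left_mono)
      then show ?thesis by (auto simp: R'_def)
    qed
    show "(\<lambda>z. A z (g (w * z + b))) \<in> unif_closure {- R..R} (ridge s s')" if g: "g \<in> ridge s s'" for g
    proof -
      obtain w' b' where g_eq: "g = (\<lambda>y. (s (w' * y + b'), w' * s' (w' * y + b')))"
        using g by (auto simp: ridge_def)
      have "(\<lambda>z. A z (g (w * z + b))) = (\<lambda>y. (s ((w' * w) * y + (w' * b + b')),
          (w' * w) * s' ((w' * w) * y + (w' * b + b'))))"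
        by (auto simp: A_def g_eq algebra_simps)
      also have "\<dots> \<in> unif_closure {- R..R} (ridge s s')"
        using ridge_in_closure[of s "w' * w" "w' * b + b'" s'] unfolding ridge_closure_def by blast
      finally show ?thesis .
    qed
  qed
  then show "(\<lambda>y. (\<phi> (w * y + b), w * \<phi>' (w * y + b))) \<in> unif_closure {-R..R} (ridge s s')"
    by (simp add: A_def)
qed

section \<open>Difference quotients and averages over intervals\<close>

lemma abs_diff_le_of_deriv:
  fixes \<phi> :: "real \<Rightarrow> real"
  assumes "\<And>z. z \<in> {a..b} \<Longrightarrow> (\<phi> has_real_derivative \<phi>' z) (at z within {a..b})"
    and "\<And>z. z \<in> {a..b} \<Longrightarrow> \<bar>\<phi>' z\<bar> \<le> B" and "x \<in> {a..b}" "y \<in> {a..b}"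
  shows "\<bar>\<phi> x - \<phi> y\<bar> \<le> B * \<bar>x - y\<bar>"
  using field_differentiable_bound[of "{a..b}" \<phi> \<phi>' B x y] assms by auto

text \<open>The mean value inequality for \<open>\<phi> z - c * z\<close>. It serves every
  comparison of an increment with a derivative below, which avoids integrals altogether.\<close>

lemma difference_quotient_close:
  fixes \<phi> :: "real \<Rightarrow> real"
  assumes "0 < h"
    and "\<And>z. z \<in> {y..y+h} \<Longrightarrow> (\<phi> has_real_derivative \<phi>' z) (at z within {y..y+h})"
    and "\<And>z. z \<in> {y..y+h} \<Longrightarrow> \<bar>\<phi>' z - c\<bar> \<le> e"
  shows "\<bar>(\<phi> (y + h) - \<phi> y) / h - c\<bar> \<le> e"
proof -
  have "\<bar>(\<phi> (y + h) - c * (y + h)) - (\<phi> y - c * y)\<bar> \<le> e * \<bar>(y + h) - y\<bar>"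
    using assms
    by (intro abs_diff_le_of_deriv[of y "y + h" "\<lambda>z. \<phi> z - c * z" "\<lambda>z. \<phi>' z - c"])
      (auto intro!: derivative_eq_intros)
  then have "\<bar>\<phi> (y + h) - \<phi> y - c * h\<bar> \<le> e * h"
    using assms(1) by (simp add: algebra_simps)
  moreover have "(\<phi> (y + h) - \<phi> y) / h - c = (\<phi> (y + h) - \<phi> y - c * h) / h"
    using assms(1) by (simp add: field_simps)
  ultimately show ?thesis
    using assms(1) by (simp add: abs_divide divide_le_eq)
qed

text \<open>Any choice will do, since only differences of its values enter.\<close>

definition antideriv :: "(real \<Rightarrow> real) \<Rightarrow> real \<Rightarrow> real" where
  "antideriv \<phi> = (SOME \<Phi>. \<forall>y. (\<Phi> has_real_derivative \<phi> y) (at y))"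

lemma antideriv:
  assumes "continuous_on UNIV \<phi>"
  shows "(antideriv \<phi> has_real_derivative \<phi> y) (at y)"
proof -
  have "isCont \<phi> x" for x
    using assms by (simp add: continuous_on_eq_continuous_at)
  then have "\<exists>\<Phi>. \<forall>y. (\<Phi> has_real_derivative \<phi> y) (at y)"
    using einterval_antiderivative[of "-\<infinity>" "\<infinity>" \<phi>]
    by (auto simp: has_real_derivative_iff_has_vector_derivative)
  then have "\<forall>y. (antideriv \<phi> has_real_derivative \<phi> y) (at y)"
    unfolding antideriv_def by (rule someI_ex)
  then show ?thesis ..
qed

text \<open>The Steklov mean over \<open>{y..y+h}\<close>. Written with an antiderivative, its own
  derivative is visibly the difference quotient of \<open>\<phi>\<close>.\<close>

definition avg :: "real \<Rightarrow> (real \<Rightarrow> real) \<Rightarrow> real \<Rightarrow> real" where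
  "avg h \<phi> y = (antideriv \<phi> (y + h) - antideriv \<phi> y) / h"

lemma avg_deriv:
  assumes "continuous_on UNIV \<phi>"
  shows "(avg h \<phi> has_real_derivative (\<phi> (y + h) - \<phi> y) / h) (at y)"
  unfolding avg_def
  using antideriv[OF assms, of y] DERIV_shift[of "antideriv \<phi>" "\<phi> (y + h)" y h] antideriv[OF assms, of "y + h"]
  by (intro DERIV_cdivide DERIV_diff) auto

lemma avg_continuous:
  assumes "continuous_on UNIV \<phi>"
  shows "continuous_on UNIV (avg h \<phi>)"
  using avg_deriv[OF assms] by (meson DERIV_isCont continuous_at_imp_continuous_on)

lemma avg_close:
  assumes "continuous_on UNIV \<phi>" "0 < h" "\<And>z. z \<in> {y..y+h} \<Longrightarrow> \<bar>\<phi> z - c\<bar> \<le> e"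
  shows "\<bar>avg h \<phi> y - c\<bar> \<le> e"
  unfolding avg_def
  by (rule difference_quotient_close[where \<phi>' = \<phi>])
    (use assms in \<open>auto intro: DERIV_subset[OF antideriv]\<close>)

lemma avg_iter_continuous:
  "continuous_on UNIV \<phi> \<Longrightarrow> continuous_on UNIV ((avg h ^^ k) \<phi>)"
  by (induction k) (auto intro: avg_continuous)

text \<open>Each averaging looks a distance \<open>h\<close> to the right, so \<open>k\<close> of
  them look as far as \<open>k * h\<close>; bounds survive averaging unchanged.\<close>

lemma avg_iter_close:
  assumes "continuous_on UNIV \<phi>" "0 < h" "\<And>z. z \<in> {y..y + real k * h} \<Longrightarrow> \<bar>\<phi> z - c\<bar> \<le> e"
  shows "\<bar>(avg h ^^ k) \<phi> y - c\<bar> \<le> e"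
  using assms(3)
proof (induction k arbitrary: y)
  case 0
  then show ?case by simp
next
  case (Suc k)
  have "\<bar>(avg h ^^ k) \<phi> z - c\<bar> \<le> e" if "z \<in> {y..y+h}" for z
    by (rule Suc.IH) (use that Suc.prems in \<open>auto simp: algebra_simps\<close>)
  then show ?case
    using avg_close[OF avg_iter_continuous[OF assms(1)] assms(2)] by simp
qed

text \<open>The Riemann sums of the averaging integral converge in \<open>C\<^sup>1\<close> on compact sets.\<close>

lemma ridge_closure_avg:
  assumes J: "(\<lambda>y. (\<phi> y, \<phi>' y)) \<in> ridge_closure s s'"
    and \<phi>: "\<And>y. (\<phi> has_real_derivative \<phi>' y) (at y)" and \<phi>': "continuous_on UNIV \<phi>'" and h: "h > 0"
  shows "(\<lambda>y. (avg h \<phi> y, (\<phi> (y + h) - \<phi> y) / h)) \<in> ridge_closure s s'"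
proof -
  let ?\<Phi> = "antideriv \<phi>"
  have cont: "continuous_on UNIV \<phi>"
    using \<phi> by (meson DERIV_isCont continuous_at_imp_continuous_on)
  have "(\<lambda>y. (?\<Phi> (y + h) - ?\<Phi> y, \<phi> (y + h) - \<phi> y)) \<in> ridge_closure s s'"
  proof (rule ridge_closure_lim)
    fix e R :: real assume "e > 0" "R > 0"
    \<comment> \<open>Errors of \<open>\<delta> * e'\<close> per cell add up over total length
      \<open>h\<close> to \<open>e / 2\<close> in each of the two components.\<close>
    define e' where "e' = e / (2 * h)"
    have e': "e' > 0" using \<open>e > 0\<close> h by (simp add: e'_def)
    have "uniformly_continuous_on {-R..R+h} \<phi>" "uniformly_continuous_on {-R..R+h} \<phi>'"
      by (auto intro!: compact_uniformly_continuous continuous_on_subset[OF cont] continuous_on_subset[OF \<phi>'])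
    then obtain d1 d2 where d: "d1 > 0" "d2 > 0"
      and d1: "\<And>x y. x \<in> {-R..R+h} \<Longrightarrow> y \<in> {-R..R+h} \<Longrightarrow> dist x y < d1 \<Longrightarrow> dist (\<phi> x) (\<phi> y) < e'"
      and d2: "\<And>x y. x \<in> {-R..R+h} \<Longrightarrow> y \<in> {-R..R+h} \<Longrightarrow> dist x y < d2 \<Longrightarrow> dist (\<phi>' x) (\<phi>' y) < e'"
      using e' unfolding uniformly_continuous_on_def by metis
    obtain n :: nat where n: "h / min d1 d2 < real n"
      using reals_Archimedean2 by blast
    have "h / d1 \<le> h / min d1 d2" "h / d2 \<le> h / min d1 d2"
      using d h by (auto intro!: divide_left_mono)
    then have nd: "h / d1 < real n" "h / d2 < real n"
      using n by linarith+
    have npos: "real n > 0"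
      using n d h by (smt (verit) divide_pos_pos min_less_iff_conj)
    define \<delta> where "\<delta> = h / n"
    have \<delta>: "\<delta> > 0" "\<delta> < d1" "\<delta> < d2" "real n * \<delta> = h"
      using nd d h npos by (auto simp: \<delta>_def field_simps)
    \<comment> \<open>The left Riemann sum over the first \<open>m\<close> cells, in the shape that
      \<open>ridge_closure_affine\<close> yields for weight 1 and shift
      \<open>i * \<delta>\<close>.\<close>
    define H where "H m y = (\<Sum>i<m. \<delta> *\<^sub>R (\<phi> (1 * y + i * \<delta>), 1 * \<phi>' (1 * y + i * \<delta>)))" for m :: nat and y
    have H: "H m \<in> ridge_closure s s'" for m
      unfolding H_def
      by (intro ridge_closure_sum ridge_closure_scale ridge_closure_affine[OF J]) simp
    \<comment> \<open>Induction on the number of cells: in the next one, both increments differ from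
      \<open>\<delta>\<close> times the values at its left end \<open>z\<close> by at most
      \<open>\<delta> * e'\<close>.\<close>
    have "\<bar>?\<Phi> (y + m * \<delta>) - ?\<Phi> y - fst (H m y)\<bar> \<le> m * \<delta> * e' \<and>
          \<bar>\<phi> (y + m * \<delta>) - \<phi> y - snd (H m y)\<bar> \<le> m * \<delta> * e'" if y: "y \<in> {-R..R}" and "m \<le> n" for y m
      using that(2)
    proof (induction m)
      case 0
      then show ?case by (simp add: H_def)
    next
      case (Suc m)
      define z where "z = y + m * \<delta>"
      have "real (Suc m) * \<delta> \<le> h"
        using Suc.prems \<delta> by (metis mult_right_mono of_nat_le_iff less_imp_le)
      then have le: "m * \<delta> + \<delta> \<le> h" by (simp add: algebra_simps)
      have in_R: "u \<in> {-R..R+h}" if "u \<in> {z..z+\<delta>}" for u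
      proof -
        have "0 \<le> m * \<delta>" using \<delta> by simp
        then show ?thesis using that y le unfolding z_def atLeastAtMost_iff by linarith
      qed
      have "\<bar>\<phi> u - \<phi> z\<bar> \<le> e'" "\<bar>\<phi>' u - \<phi>' z\<bar> \<le> e'" if "u \<in> {z..z+\<delta>}" for u
        using d1[of u z] d2[of u z] in_R[OF that] in_R[of z] that \<delta> by (auto simp: dist_real_def)
      then have "\<bar>(?\<Phi> (z + \<delta>) - ?\<Phi> z) / \<delta> - \<phi> z\<bar> \<le> e'" "\<bar>(\<phi> (z + \<delta>) - \<phi> z) / \<delta> - \<phi>' z\<bar> \<le> e'"
        using \<delta>(1) DERIV_subset[OF antideriv[OF cont]] DERIV_subset[OF \<phi>]
        by (blast intro: difference_quotient_close[where \<phi>' = \<phi>] difference_quotient_close[where \<phi>' = \<phi>'])+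
      then have *: "\<bar>?\<Phi> (z + \<delta>) - ?\<Phi> z - \<delta> * \<phi> z\<bar> \<le> \<delta> * e'" "\<bar>\<phi> (z + \<delta>) - \<phi> z - \<delta> * \<phi>' z\<bar> \<le> \<delta> * e'"
        using \<delta>(1) by (auto simp: abs_le_iff field_simps)
      have "fst (H (Suc m) y) = fst (H m y) + \<delta> * \<phi> z" "snd (H (Suc m) y) = snd (H m y) + \<delta> * \<phi>' z"
        by (auto simp: H_def z_def)
      moreover have "y + real (Suc m) * \<delta> = z + \<delta>" "real (Suc m) * \<delta> * e' = m * \<delta> * e' + \<delta> * e'"
        by (auto simp: z_def algebra_simps)
      ultimately show ?case
        using Suc.IH Suc.prems * unfolding z_def[symmetric] by auto
    qed
    from this[of _ n] have "\<bar>?\<Phi> (y + h) - ?\<Phi> y - fst (H n y)\<bar> \<le> e / 2 \<and> \<bar>\<phi> (y + h) - \<phi> y - snd (H n y)\<bar> \<le> e / 2"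
      if "y \<in> {-R..R}" for y
      using that \<delta>(4) h by (simp add: e'_def)
    then have "norm ((?\<Phi> (y + h) - ?\<Phi> y, \<phi> (y + h) - \<phi> y) - H n y) \<le> e" if "y \<in> {-R..R}" for y
      using that norm_Pair_bound[of "?\<Phi> (y + h) - ?\<Phi> y - fst (H n y)" "\<phi> (y + h) - \<phi> y - snd (H n y)"]
      by (cases "H n y") fastforce
    then show "\<exists>H\<in>ridge_closure s s'. \<forall>y\<in>{-R..R}. norm ((?\<Phi> (y + h) - ?\<Phi> y, \<phi> (y + h) - \<phi> y) - H y) \<le> e"
      by (intro bexI[OF _ H[of n]]) blast
  qed
  from ridge_closure_scale[OF this, of "1 / h"] show ?thesis
    by (simp add: avg_def)
qed

text \<open>\<open>D i\<close> plays the role of derivative number \<open>i\<close> of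
  \<open>D 0\<close>. An explicit family is the form in which \<open>Maclaurin_bi_le\<close> takes
  derivatives.\<close>

definition deriv_chain :: "nat \<Rightarrow> (nat \<Rightarrow> real \<Rightarrow> real) \<Rightarrow> bool" where
  "deriv_chain k D \<longleftrightarrow> (\<forall>i<k. \<forall>y. (D i has_real_derivative D (Suc i) y) (at y)) \<and> continuous_on UNIV (D k)"

lemma avg_iter_deriv_chain:
  assumes "continuous_on UNIV \<phi>"
  shows "\<exists>D. deriv_chain k D \<and> D 0 = (avg h ^^ k) \<phi>"
proof (induction k)
  case 0
  show ?case using assms by (intro exI[of _ "\<lambda>_. \<phi>"]) (simp add: deriv_chain_def)
next
  case (Suc k)
  then obtain D where D: "deriv_chain k D" "D 0 = (avg h ^^ k) \<phi>" by blast
  \<comment> \<open>Averaging moves the chain up by one: derivative \<open>Suc i\<close> of the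
    average is the difference quotient of the old \<open>D i\<close>, so each average gains one
    order of differentiability.\<close>
  define D' where "D' = case_nat (avg h (D 0)) (\<lambda>i y. (D i (y + h) - D i y) / h)"
  have "(D' i has_real_derivative D' (Suc i) y) (at y)" if "i < Suc k" for i y
  proof (cases i)
    case 0
    have "continuous_on UNIV (D 0)"
      using D(2) avg_iter_continuous[OF assms] by simp
    from avg_deriv[OF this, of h y] show ?thesis
      by (simp add: D'_def 0)
  next
    case (Suc j)
    then have "(D j has_real_derivative D (Suc j) y) (at y)" for y
      using D(1) that by (auto simp: deriv_chain_def)
    then show ?thesis
      using DERIV_shift[of "D j" "D (Suc j) (y + h)" y h]
      by (auto simp: D'_def Suc add.commute intro!: DERIV_cdivide DERIV_diff)
  qed
  moreover have "continuous_on UNIV (D' (Suc k))"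
  proof -
    have "continuous_on UNIV (D k)" using D(1) by (simp add: deriv_chain_def)
    then show ?thesis
      unfolding D'_def
      by (auto simp: divide_inverse intro!: continuous_intros continuous_on_compose2[of UNIV "D k"])
  qed
  ultimately have "deriv_chain (Suc k) D'"
    by (simp add: deriv_chain_def)
  moreover have "D' 0 = (avg h ^^ Suc k) \<phi>"
    by (auto simp: D'_def D(2))
  ultimately show ?case by blast
qed

lemma ridge_closure_avg_iter:
  assumes s: "\<And>y. (s has_real_derivative s' y) (at y)" and s': "continuous_on UNIV s'" and h: "h > 0"
  shows "\<exists>\<psi>. (\<lambda>y. ((avg h ^^ k) s y, \<psi> y)) \<in> ridge_closure s s' \<and> continuous_on UNIV \<psi> \<and>
    (\<forall>y. ((avg h ^^ k) s has_real_derivative \<psi> y) (at y))"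
proof (induction k)
  case 0
  show ?case
    using ridge_in_closure[of s 1 0 s'] assms by (intro exI[of _ s']) simp
next
  case (Suc k)
  let ?\<phi> = "(avg h ^^ k) s"
  obtain \<psi> where \<psi>: "(\<lambda>y. (?\<phi> y, \<psi> y)) \<in> ridge_closure s s'" "continuous_on UNIV \<psi>"
    "\<And>y. (?\<phi> has_real_derivative \<psi> y) (at y)"
    using Suc by blast
  have cont: "continuous_on UNIV ?\<phi>"
    using \<psi>(3) by (meson DERIV_isCont continuous_at_imp_continuous_on)
  show ?case
  proof (intro exI conjI allI)
    show "(\<lambda>y. ((avg h ^^ Suc k) s y, (?\<phi> (y + h) - ?\<phi> y) / h)) \<in> ridge_closure s s'"
      using ridge_closure_avg[OF \<psi>(1) \<psi>(3) \<psi>(2) h] by simp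
    show "continuous_on UNIV (\<lambda>y. (?\<phi> (y + h) - ?\<phi> y) / h)"
      by (auto simp: divide_inverse intro!: continuous_intros continuous_on_compose2[OF cont] cont)
    show "((avg h ^^ Suc k) s has_real_derivative (?\<phi> (y + h) - ?\<phi> y) / h) (at y)" for y
      using avg_deriv[OF cont] by simp
  qed
qed

text \<open>Induction by divided differences: the quotient of
  \<open>poly (P n) y - poly (P n) a\<close> by \<open>y - a\<close> has lower degree and still
  converges for \<open>y\<close> other than \<open>a\<close>. Infinity of the set is what persists
  when one point is discarded in each step.\<close>

lemma poly_limit_bounded_degree:
  fixes P :: "nat \<Rightarrow> real poly"
  assumes "infinite A" "\<And>n. degree (P n) < k" "\<And>y. y \<in> A \<Longrightarrow> (\<lambda>n. poly (P n) y) \<longlonglongrightarrow> s y"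
  shows "\<exists>p. \<forall>y\<in>A. s y = poly p y"
  using assms
proof (induction k arbitrary: A P s)
  case 0
  then show ?case by simp
next
  case (Suc k)
  obtain a where a: "a \<in> A" using Suc.prems(1) by fastforce
  have split: "poly (P n) y = poly (P n) a + (y - a) * poly (synthetic_div (P n) a) y" for n y
    using arg_cong[OF synthetic_div_correct'[of a "P n"], of "\<lambda>p. poly p y"] by (simp add: algebra_simps)
  show ?case
  \<comment> \<open>Degree bound 1 is treated apart: dividing a constant gives the zero polynomial,
    whose degree 0 is not below 0.\<close>
  proof (cases k)
    case 0
    have "s y = s a" if "y \<in> A" for y
    proof -
      have "poly (P n) y = poly (P n) a" for n
        using Suc.prems(2)[of n] 0 degree_eq_zeroE[of "P n"] by fastforce
      then have "(\<lambda>n. poly (P n) a) \<longlonglongrightarrow> s y"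
        using Suc.prems(3)[OF that] by simp
      then show ?thesis
        using Suc.prems(3)[OF a] by (rule LIMSEQ_unique)
    qed
    then show ?thesis by (intro exI[of _ "[:s a:]"]) simp
  next
    case (Suc k')
    have "\<exists>p. \<forall>y\<in>A - {a}. (s y - s a) / (y - a) = poly p y"
    proof (rule Suc.IH[of _ "\<lambda>n. synthetic_div (P n) a"])
      show "infinite (A - {a})" using Suc.prems(1) by simp
      show "degree (synthetic_div (P n) a) < k" for n
        using Suc.prems(2)[of n] \<open>k = Suc k'\<close> by (simp add: degree_synthetic_div)
      fix y assume y: "y \<in> A - {a}"
      then have "(\<lambda>n. (poly (P n) y - poly (P n) a) / (y - a)) \<longlonglongrightarrow> (s y - s a) / (y - a)"
        using Suc.prems(3) a by (intro tendsto_intros) auto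
      moreover have "(poly (P n) y - poly (P n) a) / (y - a) = poly (synthetic_div (P n) a) y" for n
        using split[of n y] y by (simp add: field_simps)
      ultimately show "(\<lambda>n. poly (synthetic_div (P n) a) y) \<longlonglongrightarrow> (s y - s a) / (y - a)" by simp
    qed
    then obtain p where p: "\<And>y. y \<in> A - {a} \<Longrightarrow> (s y - s a) / (y - a) = poly p y" by blast
    have "s y = poly ([:s a:] + [:-a, 1:] * p) y" if "y \<in> A" for y
      using p[of y] that by (cases "y = a") (auto simp: field_simps)
    then show ?thesis
      by (intro exI[of _ "[:s a:] + [:-a, 1:] * p"]) simp
  qed
qed

lemma avg_iter_tendsto:
  assumes "continuous_on UNIV \<phi>"
  shows "(\<lambda>n. (avg (1 / Suc n) ^^ k) \<phi> y) \<longlonglongrightarrow> \<phi> y"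
proof (rule LIMSEQ_I)
  fix r :: real assume "r > 0"
  have "isCont \<phi> y" using assms by (simp add: continuous_on_eq_continuous_at)
  then obtain d where d: "d > 0" "\<And>z. \<bar>z - y\<bar> < d \<Longrightarrow> \<bar>\<phi> z - \<phi> y\<bar> < r / 2"
    using \<open>r > 0\<close> unfolding continuous_at_eps_delta dist_real_def by (metis half_gt_zero)
  obtain N :: nat where N: "real k / d < real N" using reals_Archimedean2 by blast
  have "norm ((avg (1 / Suc n) ^^ k) \<phi> y - \<phi> y) < r" if "n \<ge> N" for n
  proof -
    have "real k / d < Suc n" using N that by linarith
    then have "real k * (1 / Suc n) < d" using d(1) by (simp add: field_simps)
    then have "\<bar>\<phi> z - \<phi> y\<bar> \<le> r / 2" if "z \<in> {y..y + real k * (1 / Suc n)}" for z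
      using d(2)[of z] that by fastforce
    then have "\<bar>(avg (1 / Suc n) ^^ k) \<phi> y - \<phi> y\<bar> \<le> r / 2"
      by (intro avg_iter_close assms) auto
    then show ?thesis using \<open>r > 0\<close> by simp
  qed
  then show "\<exists>N. \<forall>n\<ge>N. norm ((avg (1 / Suc n) ^^ k) \<phi> y - \<phi> y) < r" by blast
qed

lemma nonpolynomial_avg_deriv_nonzero:
  assumes cont: "continuous_on UNIV s" and nonpoly: "\<not> (\<exists>p. \<forall>u. s u = poly p u)"
  shows "\<exists>h>0. \<exists>D b. deriv_chain k D \<and> D 0 = (avg h ^^ k) s \<and> D k b \<noteq> 0"
proof (rule ccontr)
  assume neg: "\<not> ?thesis"
  \<comment> \<open>The bound is \<open>Suc k\<close> rather than \<open>k\<close> to cover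
    \<open>k = 0\<close>, where the polynomial is zero and has degree 0.\<close>
  have "\<exists>p. degree p < Suc k \<and> (\<forall>y. (avg (1 / Suc n) ^^ k) s y = poly p y)" for n
  proof -
    obtain D where D: "deriv_chain k D" "D 0 = (avg (1 / Suc n) ^^ k) s"
      using avg_iter_deriv_chain[OF cont] by blast
    have zero: "D k b = 0" for b
      using neg D by (metis of_nat_0_less_iff zero_less_Suc zero_less_divide_1_iff)
    define p where "p = (\<Sum>m<k. monom (D m 0 / fact m) m)"
    have "degree p \<le> k"
      unfolding p_def by (intro degree_sum_le) (auto intro: order_trans[OF degree_monom_le])
    moreover have "D 0 y = poly p y" for y
    proof -
      \<comment> \<open>As \<open>D k\<close> vanishes everywhere, so does the remainder, and the
        Taylor polynomial is exact.\<close>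
      have "\<exists>t. \<bar>t\<bar> \<le> \<bar>y\<bar> \<and> D 0 y = (\<Sum>m<k. D m 0 / fact m * y ^ m) + D k t / fact k * y ^ k"
        using D(1) by (intro Maclaurin_bi_le) (auto simp: deriv_chain_def)
      then show ?thesis by (auto simp: zero p_def poly_sum poly_monom)
    qed
    ultimately show ?thesis using D(2) by (intro exI[of _ p]) auto
  qed
  then obtain P where P: "\<And>n. degree (P n) < Suc k" "\<And>n y. (avg (1 / Suc n) ^^ k) s y = poly (P n) y"
    by metis
  have "(\<lambda>n. poly (P n) y) \<longlonglongrightarrow> s y" for y
    using avg_iter_tendsto[OF cont, of k y] by (simp only: P(2))
  then show False
    using poly_limit_bounded_degree[of UNIV P "Suc k" s] P(1) nonpoly by (auto simp: infinite_UNIV_char_0)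
qed

text \<open>Subtracting the lower monomials, available by strong induction, from the expansion at
  \<open>b\<close> leaves \<open>D k \<xi> / fact k * (w * y) ^ k\<close>. Division by
  \<open>D k b * w ^ k / fact k\<close> turns this into \<open>y ^ k\<close> times a quotient close
  to 1 for small \<open>w\<close>. The derivative component behaves alike, with one order
  less.\<close>

lemma ridge_closure_monomial:
  assumes s: "\<And>y. (s has_real_derivative s' y) (at y)" and s': "continuous_on UNIV s'"
    and nonpoly: "\<not> (\<exists>p. \<forall>u. s u = poly p u)"
  shows "(\<lambda>y. (y ^ k, real k * y ^ (k - 1))) \<in> ridge_closure s s'"
proof (induction k rule: less_induct)
  case (less k)
  show ?case
  proof (cases k)
    case 0
    \<comment> \<open>A ridge with weight 0 is constant, and \<open>s\<close> is not the zero
      polynomial.\<close>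
    obtain b where b: "s b \<noteq> 0" using nonpoly by (metis poly_0)
    have "(\<lambda>y. (1 / s b) *\<^sub>R (s (0 * y + b), 0 * s' (0 * y + b))) \<in> ridge_closure s s'"
      by (rule ridge_closure_scale[OF ridge_in_closure])
    then show ?thesis using b by (simp add: 0)
  next
    case (Suc k')
    have cont: "continuous_on UNIV s"
      using s by (meson DERIV_isCont continuous_at_imp_continuous_on)
    obtain h D b where h: "h > 0" and D: "deriv_chain k D" "D 0 = (avg h ^^ k) s" and nz: "D k b \<noteq> 0"
      using nonpolynomial_avg_deriv_nonzero[OF cont nonpoly, of k] by blast
    have D_deriv: "(D i has_real_derivative D (Suc i) y) (at y)" if "i < k" for i y
      using D(1) that by (simp add: deriv_chain_def)
    obtain \<psi> where \<psi>: "(\<lambda>y. (D 0 y, \<psi> y)) \<in> ridge_closure s s'" "\<And>y. (D 0 has_real_derivative \<psi> y) (at y)"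
      using ridge_closure_avg_iter[OF s s' h, of k] D(2) by auto
    \<comment> \<open>The closure lemma and the derivative chain each bring a derivative of
      \<open>D 0\<close>; uniqueness identifies them.\<close>
    have "\<psi> = D 1"
      using DERIV_unique[OF \<psi>(2)] D_deriv[of 0] Suc by auto
    with \<psi> have J: "(\<lambda>y. (D 0 y, D 1 y)) \<in> ridge_closure s s'" by simp
    \<comment> \<open>Used for \<open>i = 0\<close> and \<open>i = 1\<close>: values and derivatives
      are expanded separately, and both remainders involve the top derivative
      \<open>D k\<close>.\<close>
    have taylor: "\<exists>\<xi>. \<bar>\<xi> - b\<bar> \<le> \<bar>z\<bar> \<and>
        D i (z + b) = (\<Sum>m<k-i. D (i + m) b / fact m * z ^ m) + D k \<xi> / fact (k - i) * z ^ (k - i)"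
      if "i \<le> k" for z i
    proof -
      have der: "((\<lambda>z. D (i + m) (z + b)) has_real_derivative D (i + Suc m) (t + b)) (at t)" if "m < k - i" for m t
        using D_deriv[of "i + m" "t + b"] that DERIV_shift[of "D (i + m)" "D (i + Suc m) (t + b)" t b] by auto
      have "\<exists>t. \<bar>t\<bar> \<le> \<bar>z\<bar> \<and> D i (z + b) =
          (\<Sum>m<k-i. D (i + m) (0 + b) / fact m * z ^ m) + D (i + (k - i)) (t + b) / fact (k - i) * z ^ (k - i)"
        by (rule Maclaurin_bi_le[where diff = "\<lambda>m z. D (i + m) (z + b)" and f = "\<lambda>z. D i (z + b)"])
          (use der in auto)
      moreover have "i + (k - i) = k" using that by simp
      ultimately obtain t where "\<bar>t\<bar> \<le> \<bar>z\<bar>" "D i (z + b) =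
          (\<Sum>m<k-i. D (i + m) b / fact m * z ^ m) + D k (t + b) / fact (k - i) * z ^ (k - i)"
        by (simp only: add_0) blast
      then show ?thesis by (intro exI[of _ "t + b"]) simp
    qed
    show ?thesis
    proof (rule ridge_closure_lim)
      fix e R :: real assume "e > 0" "R > 0"
      \<comment> \<open>A relative error \<open>e'\<close> costs \<open>e' * R ^ k\<close> in the
        value and \<open>e' * (k * R ^ k')\<close> in the derivative, together
        \<open>e' * (M - 1)\<close>.\<close>
      define M where "M = R ^ k + k * R ^ k' + 1"
      have M: "M > 0" using \<open>R > 0\<close> by (simp add: M_def add_nonneg_pos)
      define e' where "e' = e / M"
      have "isCont (D k) b"
        using D(1) by (simp add: deriv_chain_def continuous_on_eq_continuous_at)
      moreover have "e' * \<bar>D k b\<bar> > 0"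
        using \<open>e > 0\<close> M nz by (simp add: e'_def)
      ultimately obtain \<delta> where \<delta>: "\<delta> > 0" "\<And>z. \<bar>z - b\<bar> < \<delta> \<Longrightarrow> \<bar>D k z - D k b\<bar> < e' * \<bar>D k b\<bar>"
        unfolding continuous_at_eps_delta dist_real_def by metis
      have quot: "\<bar>D k z / D k b - 1\<bar> \<le> e'" if "\<bar>z - b\<bar> < \<delta>" for z
      proof -
        have "D k z / D k b - 1 = (D k z - D k b) / D k b"
          using nz by (simp add: field_simps)
        then show ?thesis
          using \<delta>(2)[OF that] nz by (simp add: abs_divide divide_le_eq)
      qed
      \<comment> \<open>Keeps \<open>w * y\<close> below \<open>\<delta>\<close> in absolute value
        for all \<open>y\<close> in the interval, hence the intermediate points within
        \<open>\<delta>\<close> of \<open>b\<close>.\<close>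
      define w where "w = \<delta> / (2 * R)"
      have w: "w > 0" using \<delta> \<open>R > 0\<close> by (simp add: w_def)
      define H where "H y = (fact k / (D k b * w ^ k)) *\<^sub>R ((D 0 (w * y + b), w * D 1 (w * y + b))
          + (-1) *\<^sub>R (\<Sum>m<k. (D m b / fact m * w ^ m) *\<^sub>R (y ^ m, real m * y ^ (m - 1))))" for y
      have "H \<in> ridge_closure s s'"
        unfolding H_def
        by (intro ridge_closure_scale ridge_closure_add ridge_closure_affine[OF J] ridge_closure_sum less.IH) auto
      moreover have "norm ((y ^ k, real k * y ^ (k - 1)) - H y) \<le> e" if y: "y \<in> {-R..R}" for y
      proof -
        have "\<bar>w * y\<bar> \<le> w * R"
          using y w by (auto simp: abs_mult intro!: mult_left_mono)
        also have "\<dots> < \<delta>"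
          using \<delta>(1) \<open>R > 0\<close> by (simp add: w_def)
        finally have wy: "\<bar>w * y\<bar> < \<delta>" .
        obtain \<xi> where \<xi>: "\<bar>\<xi> - b\<bar> \<le> \<bar>w * y\<bar>"
          "D 0 (w * y + b) = (\<Sum>m<k. D m b / fact m * (w * y) ^ m) + D k \<xi> / fact k * (w * y) ^ k"
          using taylor[of 0 "w * y"] by auto
        obtain \<zeta> where \<zeta>: "\<bar>\<zeta> - b\<bar> \<le> \<bar>w * y\<bar>"
          "D 1 (w * y + b) = (\<Sum>m<k'. D (Suc m) b / fact m * (w * y) ^ m) + D k \<zeta> / fact k' * (w * y) ^ k'"
          using taylor[of 1 "w * y"] Suc by auto
        have fst_H: "fst (H y) = D k \<xi> / D k b * y ^ k"
        proof -
          have "fst (H y) = fact k / (D k b * w ^ k) * (D 0 (w * y + b) - (\<Sum>m<k. D m b / fact m * (w * y) ^ m))"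
            by (simp add: H_def fst_sum power_mult_distrib mult.assoc)
          also have "\<dots> = fact k / (D k b * w ^ k) * (D k \<xi> / fact k * (w * y) ^ k)"
            by (simp add: \<xi>(2))
          also have "\<dots> = D k \<xi> / D k b * y ^ k"
            using w by (simp add: power_mult_distrib)
          finally show ?thesis .
        qed
        have snd_H: "snd (H y) = D k \<zeta> / D k b * (k * y ^ k')"
        proof -
          \<comment> \<open>The term \<open>m = 0\<close> is killed by the factor
            \<open>real m\<close>; after the index shift, \<open>Suc m\<close> cancels against
            \<open>fact (Suc m)\<close>, which produces the Taylor sum of
            \<open>D 1\<close>.\<close>
          have "(\<Sum>m<k. D m b / fact m * w ^ m * (real m * y ^ (m - 1))) =
              (\<Sum>m<k'. D (Suc m) b / fact (Suc m) * w ^ Suc m * (real (Suc m) * y ^ m))"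
            unfolding Suc by (subst sum.lessThan_Suc_shift) simp
          also have "\<dots> = w * (\<Sum>m<k'. D (Suc m) b / fact m * (w * y) ^ m)"
            unfolding sum_distrib_left
            by (intro sum.cong refl) (simp add: power_mult_distrib field_simps del: of_nat_Suc)
          finally have sum_eq: "(\<Sum>m<k. D m b / fact m * w ^ m * (real m * y ^ (m - 1))) =
              w * (\<Sum>m<k'. D (Suc m) b / fact m * (w * y) ^ m)" .
          have "snd (H y) = fact k / (D k b * w ^ k) *
              (w * D 1 (w * y + b) - (\<Sum>m<k. D m b / fact m * w ^ m * (real m * y ^ (m - 1))))"
            by (simp add: H_def snd_sum)
          also have "\<dots> = fact k / (D k b * w ^ k) * (w * (D k \<zeta> / fact k' * (w * y) ^ k'))"
            unfolding sum_eq \<zeta>(2) by (simp add: algebra_simps)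
          also have "\<dots> = D k \<zeta> / D k b * (k * y ^ k')"
            using w nz unfolding Suc by (simp add: power_mult_distrib field_simps)
          finally show ?thesis .
        qed
        have ypow: "\<bar>y\<bar> ^ n \<le> R ^ n" for n
          using y by (intro power_mono) auto
        have "\<bar>y ^ k - fst (H y)\<bar> = \<bar>D k \<xi> / D k b - 1\<bar> * \<bar>y\<bar> ^ k"
          unfolding fst_H power_abs[symmetric] abs_mult[symmetric] by (simp add: algebra_simps abs_minus_commute)
        also have "\<dots> \<le> e' * R ^ k"
          using quot[of \<xi>] \<xi>(1) wy ypow by (intro mult_mono) (auto intro: order_trans[OF abs_ge_zero])
        finally have 1: "\<bar>y ^ k - fst (H y)\<bar> \<le> e' * R ^ k" .
        have "\<bar>k * y ^ k' - snd (H y)\<bar> = \<bar>D k \<zeta> / D k b - 1\<bar> * (k * \<bar>y\<bar> ^ k')"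
        proof -
          have "k * y ^ k' - snd (H y) = (1 - D k \<zeta> / D k b) * (k * y ^ k')"
            unfolding snd_H by (simp add: algebra_simps)
          then show ?thesis by (simp add: abs_mult power_abs abs_minus_commute)
        qed
        also have "\<dots> \<le> e' * (k * R ^ k')"
          using quot[of \<zeta>] \<zeta>(1) wy ypow
          by (intro mult_mono) (auto intro: order_trans[OF abs_ge_zero] mult_left_mono)
        finally have 2: "\<bar>k * y ^ k' - snd (H y)\<bar> \<le> e' * (k * R ^ k')" .
        have "norm ((y ^ k, real k * y ^ (k - 1)) - H y) \<le> \<bar>y ^ k - fst (H y)\<bar> + \<bar>k * y ^ k' - snd (H y)\<bar>"
          using norm_Pair_bound[of "y ^ k - fst (H y)" "k * y ^ k' - snd (H y)"] Suc by (cases "H y") simp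
        also have "\<dots> \<le> e' * (M - 1)"
          using 1 2 by (simp add: M_def algebra_simps)
        also have "\<dots> \<le> e"
          using M \<open>e > 0\<close> by (simp add: e'_def field_simps)
        finally show ?thesis .
      qed
      ultimately show "\<exists>H\<in>ridge_closure s s'. \<forall>y\<in>{-R..R}. norm ((y ^ k, real k * y ^ (k - 1)) - H y) \<le> e"
        by (intro bexI[of _ H] ballI)
    qed
  qed
qed

lemma ridge_closure_exp:
  assumes s: "\<And>y. (s has_real_derivative s' y) (at y)" and s': "continuous_on UNIV s'"
    and nonpoly: "\<not> (\<exists>p. \<forall>u. s u = poly p u)"
  shows "(\<lambda>y. (exp y, exp y)) \<in> ridge_closure s s'"
proof (rule ridge_closure_lim)
  fix e R :: real assume "e > 0" "R > 0"
  \<comment> \<open>Differentiating the partial sum with \<open>Suc n\<close> terms gives the one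
    with \<open>n\<close> terms, so two consecutive remainders have to be small together.\<close>
  define H where "H n y = (\<Sum>m<Suc n. (1 / fact m) *\<^sub>R (y ^ m, real m * y ^ (m - 1)))" for n :: nat and y :: real
  have H: "H n \<in> ridge_closure s s'" for n
    unfolding H_def
    by (intro ridge_closure_sum ridge_closure_scale ridge_closure_monomial assms) auto
  have lim: "(\<lambda>n. exp R * (R ^ n / fact n)) \<longlonglongrightarrow> 0"
    using tendsto_mult_left[OF summable_LIMSEQ_zero[OF summable_exp[of R]], of "exp R"]
    by (simp add: field_simps)
  moreover have "(\<lambda>n. exp R * (R ^ Suc n / fact (Suc n))) \<longlonglongrightarrow> 0"
    using LIMSEQ_Suc[OF lim] .
  ultimately have "(\<lambda>n. exp R * (R ^ Suc n / fact (Suc n)) + exp R * (R ^ n / fact n)) \<longlonglongrightarrow> 0"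
    using tendsto_add by fastforce
  then obtain n where n: "\<bar>exp R * (R ^ Suc n / fact (Suc n)) + exp R * (R ^ n / fact n)\<bar> < e"
    using LIMSEQ_D[OF _ \<open>e > 0\<close>] by fastforce
  have rem: "\<bar>exp y - (\<Sum>m<n. y ^ m / fact m)\<bar> \<le> exp R * (R ^ n / fact n)" if y: "y \<in> {-R..R}" for y n
  proof -
    obtain t where t: "\<bar>t\<bar> \<le> \<bar>y\<bar>" "exp y = (\<Sum>m<n. y ^ m / fact m) + exp t / fact n * y ^ n"
      using Maclaurin_exp_le[of y n] by blast
    then have "\<bar>exp y - (\<Sum>m<n. y ^ m / fact m)\<bar> = exp t * (\<bar>y\<bar> ^ n / fact n)"
      by (simp add: abs_mult power_abs)
    also have "\<dots> \<le> exp R * (R ^ n / fact n)"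
      using t(1) y by (intro mult_mono divide_right_mono power_mono) auto
    finally show ?thesis .
  qed
  have "norm ((exp y, exp y) - H n y) \<le> e" if y: "y \<in> {-R..R}" for y
  proof -
    have "fst (H n y) = (\<Sum>m<Suc n. y ^ m / fact m)"
      unfolding H_def fst_sum by simp
    moreover have "snd (H n y) = (\<Sum>m<n. y ^ m / fact m)"
    proof -
      have "snd (H n y) = (\<Sum>m<Suc n. real m * y ^ (m - 1) / fact m)"
        unfolding H_def snd_sum by simp
      also have "\<dots> = (\<Sum>m<n. real (Suc m) * y ^ m / fact (Suc m))"
        by (subst sum.lessThan_Suc_shift) simp
      also have "\<dots> = (\<Sum>m<n. y ^ m / fact m)"
        by (intro sum.cong refl) (simp add: field_simps del: of_nat_Suc)
      finally show ?thesis .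
    qed
    ultimately have "norm ((exp y, exp y) - H n y)
        \<le> \<bar>exp y - (\<Sum>m<Suc n. y ^ m / fact m)\<bar> + \<bar>exp y - (\<Sum>m<n. y ^ m / fact m)\<bar>"
      using norm_Pair_bound[of "exp y - fst (H n y)" "exp y - snd (H n y)"]
      by (cases "H n y") (simp del: sum.lessThan_Suc)
    then show ?thesis
      using rem[OF y, of "Suc n"] rem[OF y, of n] n by linarith
  qed
  then show "\<exists>H\<in>ridge_closure s s'. \<forall>y\<in>{-R..R}. norm ((exp y, exp y) - H y) \<le> e"
    by (intro bexI[OF _ H[of n]] ballI)
qed

section \<open>Approximation by exponential sums in space-time-velocity\<close>

text \<open>
  A function of \<open>(t, x, v)\<close> is carried along with its derivatives in \<open>t\<close> and \<open>x\<close>; the derivative in \<open>v\<close>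
  does not enter the loss.
\<close>

definition ridge3 ::
  "(real \<Rightarrow> real) \<Rightarrow> (real \<Rightarrow> real) \<Rightarrow> (real \<times> real \<times> real \<Rightarrow> real \<times> real \<times> real) set" where
  "ridge3 s s' = {\<lambda>(t, x, v). (s (\<alpha> * t + \<beta> * x + \<gamma> * v + b),
     \<alpha> * s' (\<alpha> * t + \<beta> * x + \<gamma> * v + b), \<beta> * s' (\<alpha> * t + \<beta> * x + \<gamma> * v + b)) | \<alpha> \<beta> \<gamma> b. True}"

definition exp3 :: "real \<Rightarrow> real \<Rightarrow> real \<Rightarrow> real \<times> real \<times> real \<Rightarrow> real" where
  "exp3 \<alpha> \<beta> \<gamma> = (\<lambda>(t, x, v). exp (\<alpha> * t + \<beta> * x + \<gamma> * v))"

definition exp_jet :: "real \<Rightarrow> real \<Rightarrow> real \<Rightarrow> real \<times> real \<times> real \<Rightarrow> real \<times> real \<times> real" where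
  "exp_jet \<alpha> \<beta> \<gamma> = (\<lambda>y. (exp3 \<alpha> \<beta> \<gamma> y, \<alpha> * exp3 \<alpha> \<beta> \<gamma> y, \<beta> * exp3 \<alpha> \<beta> \<gamma> y))"

definition exp_jets :: "(real \<times> real \<times> real \<Rightarrow> real \<times> real \<times> real) set" where
  "exp_jets = {exp_jet \<alpha> \<beta> \<gamma> | \<alpha> \<beta> \<gamma>. True}"

lemma norm_triple_bound: "norm (a, b, c) \<le> \<bar>a\<bar> + \<bar>b\<bar> + \<bar>c\<bar>" for a b c :: real
  using norm_Pair_le[of a "(b, c)"] norm_Pair_le[of b c] by simp

text \<open>The linear form \<open>\<rho>\<close> is bounded on the compact set, so the one-variable
  approximation of \<open>exp\<close> can be composed with it. A ridge of weight \<open>w\<close>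
  becomes a ridge in three variables with weights \<open>w * \<alpha>\<close>,
  \<open>w * \<beta>\<close>, \<open>w * \<gamma>\<close>.\<close>

lemma exp_jets_in_ridge3_closure:
  assumes s: "\<And>y. (s has_real_derivative s' y) (at y)" and s': "continuous_on UNIV s'"
    and nonpoly: "\<not> (\<exists>p. \<forall>u. s u = poly p u)" and K: "compact K"
  shows "exp_jets \<subseteq> unif_closure K (ridge3 s s')"
proof
  fix J assume "J \<in> exp_jets"
  then obtain \<alpha> \<beta> \<gamma> where J: "J = exp_jet \<alpha> \<beta> \<gamma>" by (auto simp: exp_jets_def)
  define \<rho> :: "real \<times> real \<times> real \<Rightarrow> real" where "\<rho> = (\<lambda>(t, x, v). \<alpha> * t + \<beta> * x + \<gamma> * v)"
  define A :: "real \<times> real \<times> real \<Rightarrow> real \<times> real \<Rightarrow> real \<times> real \<times> real" where "A = (\<lambda>z (p, q). (p, \<alpha> * q, \<beta> * q))"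
  have "continuous_on K \<rho>"
    unfolding \<rho>_def split_def by (intro continuous_intros)
  then have "bounded (\<rho> ` K)"
    using K by (intro compact_imp_bounded compact_continuous_image)
  then obtain R where R: "\<And>z. z \<in> K \<Longrightarrow> \<bar>\<rho> z\<bar> \<le> R"
    unfolding bounded_iff by auto
  have "(\<lambda>z. A z ((\<lambda>y. (exp y, exp y)) (\<rho> z))) \<in> unif_closure K (ridge3 s s')"
  proof (rule unif_closure_transform[where K = "{-R..R}" and S = "ridge s s'" and C = "1 + \<bar>\<alpha>\<bar> + \<bar>\<beta>\<bar>"
        and A = A and J = "\<lambda>y. (exp y, exp y)" and \<rho> = \<rho>])
    show "(\<lambda>y. (exp y, exp y)) \<in> unif_closure {-R..R} (ridge s s')"
      using ridge_closure_exp[OF s s' nonpoly] by (simp add: ridge_closure_def)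
    show "linear (A z)" for z
      by (rule linearI) (auto simp: A_def algebra_simps)
    show "norm (A z u) \<le> (1 + \<bar>\<alpha>\<bar> + \<bar>\<beta>\<bar>) * norm u" for z u
    proof (cases u)
      case (Pair p q)
      have "\<bar>p\<bar> \<le> norm u" "\<bar>q\<bar> \<le> norm u"
        using norm_fst_le[of p q] norm_snd_le[of q p] Pair by auto
      then have "\<bar>p\<bar> + \<bar>\<alpha>\<bar> * \<bar>q\<bar> + \<bar>\<beta>\<bar> * \<bar>q\<bar> \<le> (1 + \<bar>\<alpha>\<bar> + \<bar>\<beta>\<bar>) * norm u"
        by (simp add: distrib_right add_mono mult_left_mono)
      then show ?thesis
        using norm_triple_bound[of p "\<alpha> * q" "\<beta> * q"] by (simp add: A_def Pair abs_mult)
    qed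
    show "\<rho> z \<in> {-R..R}" if "z \<in> K" for z
      using R[OF that] by auto
    show "(\<lambda>z. A z (g (\<rho> z))) \<in> unif_closure K (ridge3 s s')" if g: "g \<in> ridge s s'" for g
    proof -
      obtain w b where g_eq: "g = (\<lambda>y. (s (w * y + b), w * s' (w * y + b)))"
        using g by (auto simp: ridge_def)
      have "(\<lambda>z. A z (g (\<rho> z))) = (\<lambda>(t, x, v). (s ((w * \<alpha>) * t + (w * \<beta>) * x + (w * \<gamma>) * v + b),
          (w * \<alpha>) * s' ((w * \<alpha>) * t + (w * \<beta>) * x + (w * \<gamma>) * v + b),
          (w * \<beta>) * s' ((w * \<alpha>) * t + (w * \<beta>) * x + (w * \<gamma>) * v + b)))"
        by (auto simp: A_def g_eq \<rho>_def algebra_simps)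
      also have "\<dots> \<in> ridge3 s s'"
        unfolding ridge3_def by blast
      finally show ?thesis
        by (rule lin_hull_in_unif_closure[OF lin_hull_base])
    qed
  qed
  also have "(\<lambda>z. A z ((\<lambda>y. (exp y, exp y)) (\<rho> z))) = J"
    by (auto simp: A_def \<rho>_def J exp_jet_def exp3_def)
  finally show "J \<in> unif_closure K (ridge3 s s')" .
qed

text \<open>Exponents 0 are included so that the hull contains the constants and is an algebra to
  which Stone--Weierstrass applies; the sign condition makes one more factor
  \<open>exp3 1 1 0\<close> lead into \<open>exps_pos\<close>.\<close>

definition exps_nonneg :: "(real \<times> real \<times> real \<Rightarrow> real) set" where
  "exps_nonneg = {exp3 \<alpha> \<beta> \<gamma> | \<alpha> \<beta> \<gamma>. \<alpha> \<ge> 0 \<and> \<beta> \<ge> 0}"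

text \<open>
  With both exponents nonzero, the antiderivatives in \<open>t\<close> and in \<open>x\<close> are again exponential sums.
\<close>

definition exps_pos :: "(real \<times> real \<times> real \<Rightarrow> real) set" where
  "exps_pos = {exp3 \<alpha> \<beta> \<gamma> | \<alpha> \<beta> \<gamma>. \<alpha> > 0 \<and> \<beta> > 0}"

lemma exp3_mult: "exp3 \<alpha> \<beta> \<gamma> y * exp3 \<alpha>' \<beta>' \<gamma>' y = exp3 (\<alpha> + \<alpha>') (\<beta> + \<beta>') (\<gamma> + \<gamma>') y"
  by (auto simp: exp3_def split_def simp flip: exp_add) (simp add: algebra_simps)

lemma exp3_continuous: "continuous_on K (exp3 \<alpha> \<beta> \<gamma>)"
  unfolding exp3_def split_def by (intro continuous_intros)

lemma lin_hull_mult: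
  fixes S S' S'' :: "('a \<Rightarrow> real) set"
  assumes "g \<in> lin_hull S" "h \<in> lin_hull S'"
    and "\<And>g h. g \<in> S \<Longrightarrow> h \<in> S' \<Longrightarrow> (\<lambda>x. g x * h x) \<in> S''"
  shows "(\<lambda>x. g x * h x) \<in> lin_hull S''"
  using assms(1)
proof induction
  case zero
  show ?case by (simp add: lin_hull.zero)
next
  case (step k g c)
  have "(\<lambda>x. g x * h x) \<in> lin_hull S''"
    using assms(2)
  proof induction
    case zero
    show ?case by (simp add: lin_hull.zero)
  next
    case (step l h d)
    then show ?case
      using lin_hull.step[OF step.IH assms(3)[OF \<open>g \<in> S\<close> step.hyps(2)], of d] by (simp add: algebra_simps)
  qed
  from lin_hull_add[OF step.IH lin_hull_scale[OF this, of c]] show ?case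
    by (simp add: algebra_simps)
qed

text \<open>The generators in \<open>exps_pos\<close> do not include the constant 1, so
  Stone--Weierstrass is applied to \<open>q\<close> times \<open>exp3 (-1) (-1) 0\<close> in the
  larger algebra. Multiplying back by \<open>exp3 1 1 0\<close>, bounded by \<open>C\<close> on
  \<open>K\<close>, restores \<open>q\<close> and explains the tolerance
  \<open>e / C\<close>.\<close>

lemma exps_pos_dense:
  assumes K: "compact K" and q: "continuous_on K q"
  shows "q \<in> unif_closure K exps_pos"
proof (rule unif_closureI)
  fix e :: real assume "e > 0"
  interpret function_ring_on "lin_hull exps_nonneg" K
  proof
    show "compact K" by fact
    show "continuous_on K f" if "f \<in> lin_hull exps_nonneg" for f
      by (rule lin_hull_continuous[OF _ that]) (auto simp: exps_nonneg_def exp3_continuous)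
    show "(\<lambda>x. f x + g x) \<in> lin_hull exps_nonneg" if "f \<in> lin_hull exps_nonneg" "g \<in> lin_hull exps_nonneg" for f g
      using that by (rule lin_hull_add)
    show "(\<lambda>x. f x * g x) \<in> lin_hull exps_nonneg" if "f \<in> lin_hull exps_nonneg" "g \<in> lin_hull exps_nonneg" for f g
    proof (rule lin_hull_mult[OF that])
      fix g h assume "g \<in> exps_nonneg" "h \<in> exps_nonneg"
      then obtain \<alpha> \<beta> \<gamma> \<alpha>' \<beta>' \<gamma>' where "g = exp3 \<alpha> \<beta> \<gamma>" "h = exp3 \<alpha>' \<beta>' \<gamma>'" "\<alpha> \<ge> 0" "\<beta> \<ge> 0" "\<alpha>' \<ge> 0" "\<beta>' \<ge> 0"
        by (auto simp: exps_nonneg_def)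
      moreover from this have "(\<lambda>x. g x * h x) = exp3 (\<alpha> + \<alpha>') (\<beta> + \<beta>') (\<gamma> + \<gamma>')"
        by (simp add: exp3_mult)
      ultimately show "(\<lambda>x. g x * h x) \<in> exps_nonneg"
        unfolding exps_nonneg_def using add_nonneg_nonneg by blast
    qed
    show "(\<lambda>_. c) \<in> lin_hull exps_nonneg" for c
    proof -
      have "exp3 0 0 0 \<in> exps_nonneg" unfolding exps_nonneg_def by force
      from lin_hull_scale[OF lin_hull_base[OF this], of c] show ?thesis
        by (simp add: exp3_def split_def)
    qed
    show "\<exists>f\<in>lin_hull exps_nonneg. f y \<noteq> f z" if "y \<noteq> z" for y z
    proof -
      have "exp3 1 0 0 \<in> exps_nonneg" "exp3 0 1 0 \<in> exps_nonneg" "exp3 0 0 1 \<in> exps_nonneg"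
        unfolding exps_nonneg_def by force+
      note * = this[THEN lin_hull_base]
      have "exp3 1 0 0 y \<noteq> exp3 1 0 0 z \<or> exp3 0 1 0 y \<noteq> exp3 0 1 0 z \<or> exp3 0 0 1 y \<noteq> exp3 0 0 1 z"
        using that by (auto simp: exp3_def split_def prod_eq_iff)
      with * show ?thesis by blast
    qed
  qed
  have "bounded (exp3 1 1 0 ` K)"
    using K by (intro compact_imp_bounded compact_continuous_image exp3_continuous)
  then obtain C where C: "\<And>y. y \<in> K \<Longrightarrow> \<bar>exp3 1 1 0 y\<bar> \<le> C" and Cpos: "C > 0"
    unfolding bounded_pos by auto
  have "continuous_on K (\<lambda>y. q y * exp3 (-1) (-1) 0 y)"
    by (intro continuous_intros q exp3_continuous)
  from Stone_Weierstrass_basic[OF this, of "e / C"] obtain h where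
    h: "h \<in> lin_hull exps_nonneg" "\<And>y. y \<in> K \<Longrightarrow> \<bar>q y * exp3 (-1) (-1) 0 y - h y\<bar> < e / C"
    using \<open>e > 0\<close> Cpos by auto
  have "(\<lambda>y. h y * exp3 1 1 0 y) \<in> lin_hull exps_pos"
  proof (rule lin_hull_mult[OF h(1), of _ "{exp3 1 1 0}"])
    show "exp3 1 1 0 \<in> lin_hull {exp3 1 1 0}" by (simp add: lin_hull_base)
    fix g k assume "g \<in> exps_nonneg" "k \<in> {exp3 1 1 0}"
    then obtain \<alpha> \<beta> \<gamma> where "g = exp3 \<alpha> \<beta> \<gamma>" "\<alpha> \<ge> 0" "\<beta> \<ge> 0" "k = exp3 1 1 0"
      by (auto simp: exps_nonneg_def)
    moreover from this have "(\<lambda>x. g x * k x) = exp3 (\<alpha> + 1) (\<beta> + 1) (\<gamma> + 0)"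
      by (simp add: exp3_mult)
    ultimately show "(\<lambda>x. g x * k x) \<in> exps_pos"
      unfolding exps_pos_def by (metis (mono_tags, lifting) add_nonneg_pos mem_Collect_eq zero_less_one)
  qed
  moreover have "norm (q y - h y * exp3 1 1 0 y) \<le> e" if y: "y \<in> K" for y
  proof -
    have one: "exp3 (-1) (-1) 0 y * exp3 1 1 0 y = 1"
      unfolding exp3_mult by (simp add: exp3_def split_def)
    have "q y - h y * exp3 1 1 0 y = (q y * exp3 (-1) (-1) 0 y - h y) * exp3 1 1 0 y"
      using one by (simp add: left_diff_distrib mult.assoc)
    then have "norm (q y - h y * exp3 1 1 0 y) \<le> (e / C) * C"
      using h(2)[OF y] C[OF y] \<open>e > 0\<close> Cpos by (simp add: abs_mult del: times_divide_eq_left) (intro mult_mono, auto)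
    then show ?thesis using Cpos by simp
  qed
  ultimately show "\<exists>h\<in>lin_hull exps_pos. \<forall>y\<in>K. norm (q y - h y) \<le> e"
    by (intro bexI[of _ "\<lambda>y. h y * exp3 1 1 0 y"] ballI)
qed

section \<open>Jets of exponential sums and their explicit primitives\<close>

definition jet_valid :: "(real \<times> real \<times> real \<Rightarrow> real \<times> real \<times> real) \<Rightarrow> bool" where
  "jet_valid J \<longleftrightarrow> (\<forall>t x v.
     ((\<lambda>s. fst (J (s, x, v))) has_real_derivative fst (snd (J (t, x, v)))) (at t) \<and>
     ((\<lambda>y. fst (J (t, y, v))) has_real_derivative snd (snd (J (t, x, v)))) (at x))"

lemma jet_valid_exp_jet: "jet_valid (exp_jet \<alpha> \<beta> \<gamma>)"
  unfolding jet_valid_def exp_jet_def exp3_def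
  by (auto intro!: derivative_eq_intros)

lemma jet_valid_lin_hull:
  assumes "J \<in> lin_hull exp_jets"
  shows "jet_valid J"
  using assms
proof induction
  case zero
  show ?case by (simp add: jet_valid_def)
next
  case (step J g c)
  then have "jet_valid g" by (auto simp: exp_jets_def jet_valid_exp_jet)
  with step.IH show ?case
    unfolding jet_valid_def by (auto intro!: DERIV_add DERIV_cmult)
qed

text \<open>Superposition: if a relation between a function and a jet is linear, solving it for each
  generator solves it on the hull. Each primitive below then reduces to a single
  exponential.\<close>

lemma lin_hull_lift:
  fixes S :: "('a \<Rightarrow> real) set" and S' :: "('b \<Rightarrow> 'c::real_vector) set"
  assumes "p \<in> lin_hull S" and "Q (\<lambda>_. 0) (\<lambda>_. 0)"
    and "\<And>p J g J' c. Q p J \<Longrightarrow> Q g J' \<Longrightarrow> Q (\<lambda>x. p x + c * g x) (\<lambda>x. J x + c *\<^sub>R J' x)"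
    and "\<And>g. g \<in> S \<Longrightarrow> \<exists>J\<in>lin_hull S'. Q g J"
  shows "\<exists>J\<in>lin_hull S'. Q p J"
  using assms(1)
proof induction
  case zero
  show ?case using assms(2) lin_hull.zero by (intro bexI)
next
  case (step p g c)
  obtain J where J: "J \<in> lin_hull S'" "Q p J" using step.IH by blast
  obtain J' where J': "J' \<in> lin_hull S'" "Q g J'" using assms(4)[OF step.hyps(2)] by blast
  have "(\<lambda>x. J x + c *\<^sub>R J' x) \<in> lin_hull S'"
    by (rule lin_hull_add[OF J(1) lin_hull_scale[OF J'(1)]])
  with assms(3)[OF J(2) J'(2)] show ?case by (intro bexI) simp
qed

lemma exp_jet_hull: "exp_jet \<alpha> \<beta> \<gamma> \<in> lin_hull exp_jets"
  by (rule lin_hull_base) (auto simp: exp_jets_def)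

lemma exp_jet_hull2:
  "(\<lambda>y. c *\<^sub>R exp_jet \<alpha> \<beta> \<gamma> y + d *\<^sub>R exp_jet \<alpha>' \<beta>' \<gamma>' y) \<in> lin_hull exp_jets"
  by (rule lin_hull_add[OF lin_hull_scale[OF exp_jet_hull] lin_hull_scale[OF exp_jet_hull]])

text \<open>The integration constant at the corner \<open>(0, a)\<close>, which still depends on
  \<open>v\<close>; exponents \<open>0 0 \<gamma>\<close> make both derivatives vanish.\<close>

lemma primitive_const:
  assumes "p \<in> lin_hull exps_pos"
  shows "\<exists>J\<in>lin_hull exp_jets. \<forall>t x v. J (t, x, v) = (p (0, a, v), 0, 0)"
proof (rule lin_hull_lift[OF assms])
  fix g assume "g \<in> exps_pos"
  then obtain \<alpha> \<beta> \<gamma> where g: "g = exp3 \<alpha> \<beta> \<gamma>" by (auto simp: exps_pos_def)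
  show "\<exists>J\<in>lin_hull exp_jets. \<forall>t x v. J (t, x, v) = (g (0, a, v), 0, 0)"
    by (rule bexI[OF _ lin_hull_scale[OF exp_jet_hull[of 0 0 \<gamma>], of "exp (\<beta> * a)"]])
      (auto simp: g exp_jet_def exp3_def exp_add)
qed (auto simp: zero_prod_def)

text \<open>For one exponential this is
  \<open>(exp (\<beta> * x) - exp (\<beta> * a)) / \<beta>\<close> times
  \<open>exp (\<gamma> * v)\<close>, constant in \<open>t\<close>.\<close>

lemma primitive_x:
  assumes "p \<in> lin_hull exps_pos"
  shows "\<exists>J\<in>lin_hull exp_jets. \<forall>t x v. snd (J (t, x, v)) = (0, p (0, x, v)) \<and> fst (J (t, a, v)) = 0"
proof (rule lin_hull_lift[OF assms])
  fix g assume "g \<in> exps_pos"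
  then obtain \<alpha> \<beta> \<gamma> where g: "g = exp3 \<alpha> \<beta> \<gamma>" "\<beta> > 0" by (auto simp: exps_pos_def)
  show "\<exists>J\<in>lin_hull exp_jets. \<forall>t x v. snd (J (t, x, v)) = (0, g (0, x, v)) \<and> fst (J (t, a, v)) = 0"
    by (rule bexI[OF _ exp_jet_hull2[of "1 / \<beta>" 0 \<beta> \<gamma> "- exp (\<beta> * a) / \<beta>" 0 0 \<gamma>]])
      (use g in \<open>auto simp: exp_jet_def exp3_def exp_add\<close>)
qed (auto simp: zero_prod_def)

text \<open>For one exponential this is \<open>(exp (\<alpha> * t) - 1) / \<alpha>\<close> times
  \<open>exp (\<gamma> * v)\<close>, weighted by \<open>exp (\<beta> * a)\<close> because
  \<open>x\<close> is frozen at \<open>a\<close>.\<close>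

lemma primitive_t:
  assumes "p \<in> lin_hull exps_pos"
  shows "\<exists>J\<in>lin_hull exp_jets. \<forall>t x v. snd (J (t, x, v)) = (p (t, a, v), 0) \<and> fst (J (0, x, v)) = 0"
proof (rule lin_hull_lift[OF assms])
  fix g assume "g \<in> exps_pos"
  then obtain \<alpha> \<beta> \<gamma> where g: "g = exp3 \<alpha> \<beta> \<gamma>" "\<alpha> > 0" by (auto simp: exps_pos_def)
  show "\<exists>J\<in>lin_hull exp_jets. \<forall>t x v. snd (J (t, x, v)) = (g (t, a, v), 0) \<and> fst (J (0, x, v)) = 0"
    by (rule bexI[OF _ exp_jet_hull2[of "exp (\<beta> * a) / \<alpha>" \<alpha> 0 \<gamma> "- exp (\<beta> * a) / \<alpha>" 0 0 \<gamma>]])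
      (use g in \<open>auto simp: exp_jet_def exp3_def exp_add\<close>)
qed (auto simp: zero_prod_def)

text \<open>The second antiderivative of \<open>p\<close>, once in \<open>t\<close> from \<open>0\<close> and once in \<open>x\<close> from \<open>a\<close>.\<close>

lemma primitive_tx:
  assumes "p \<in> lin_hull exps_pos"
  shows "\<exists>J\<in>lin_hull exp_jets. \<forall>t x v.
    ((\<lambda>y. fst (snd (J (t, y, v)))) has_real_derivative p (t, x, v)) (at x) \<and>
    ((\<lambda>s. snd (snd (J (s, x, v)))) has_real_derivative p (t, x, v)) (at t) \<and>
    fst (snd (J (t, a, v))) = 0 \<and> snd (snd (J (0, x, v))) = 0 \<and> fst (J (0, a, v)) = 0"
proof (rule lin_hull_lift[OF assms], goal_cases)
  case 1
  show ?case by simp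
next
  case (2 p J g J' c)
  then show ?case
    by (auto intro!: DERIV_add DERIV_cmult)
next
  case (3 g)
  then obtain \<alpha> \<beta> \<gamma> where g: "g = exp3 \<alpha> \<beta> \<gamma>" "\<alpha> > 0" "\<beta> > 0" by (auto simp: exps_pos_def)
  \<comment> \<open>The four jets expand \<open>(exp (\<alpha> * t) - 1) * (exp (\<beta> * x) - exp
    (\<beta> * a)) / (\<alpha> * \<beta>)\<close>, times \<open>exp (\<gamma> * v)\<close>.\<close>
  let ?c = "1 / (\<alpha> * \<beta>)" and ?d = "exp (\<beta> * a) / (\<alpha> * \<beta>)"
  show ?case
    by (rule bexI[OF _ lin_hull_add[OF exp_jet_hull2[of ?c \<alpha> \<beta> \<gamma> "- ?d" \<alpha> 0 \<gamma>] exp_jet_hull2[of "- ?c" 0 \<beta> \<gamma> ?d 0 0 \<gamma>]]])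
      (use g in \<open>auto simp: exp_jet_def exp3_def exp_add intro!: derivative_eq_intros\<close>)
qed

lemma difference_quotient_deriv:
  fixes \<Phi> :: "real \<Rightarrow> real"
  assumes \<Phi>: "\<And>z. z \<in> {0..T'} \<Longrightarrow> (\<Phi> has_real_derivative \<phi> z) (at z within {0..T'})"
    and "0 < h" "T + h \<le> T'" "t \<in> {0..T}"
  shows "((\<lambda>t. (\<Phi> (t + h) - \<Phi> t) / h) has_real_derivative (\<phi> (t + h) - \<phi> t) / h) (at t within {0..T})"
proof -
  have sub: "{0..T} \<subseteq> {0..T'}" "(\<lambda>t. t + h) ` {0..T} \<subseteq> {0..T'}"
    using assms by auto
  have "(\<Phi> has_real_derivative \<phi> (t + h)) (at (t + h) within (\<lambda>t. t + h) ` {0..T})"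
    by (rule DERIV_subset[OF \<Phi> sub(2)]) (use assms in auto)
  moreover have "((\<lambda>t. t + h) has_real_derivative 1) (at t within {0..T})"
    by (auto intro!: derivative_eq_intros)
  ultimately have "(\<Phi> \<circ> (\<lambda>t. t + h) has_real_derivative \<phi> (t + h) * 1) (at t within {0..T})"
    by (rule DERIV_image_chain)
  moreover have "(\<Phi> has_real_derivative \<phi> t) (at t within {0..T})"
    by (rule DERIV_subset[OF \<Phi> sub(1)]) (use assms in auto)
  ultimately show ?thesis
    by (intro DERIV_cdivide DERIV_diff) (simp_all add: o_def)
qed

text \<open>
  The mixed derivative need not exist, so the difference quotient in \<open>t\<close> of the derivative in \<open>x\<close>
  takes its place: an exponential sum close to it is integrated in both variables, and the mean value
  theorem keeps track of the errors.
\<close>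

theorem exp_jets_dense:
  fixes F Ft Fx :: "real \<Rightarrow> real \<Rightarrow> real \<Rightarrow> real"
  assumes T: "0 < T" "T < T'" and ab: "a < b"
    and F_cont: "continuous_on ({0..T'} \<times> {a..b} \<times> {-1..1}) (\<lambda>(t, x, v). F t x v)"
    and Ft_cont: "continuous_on ({0..T'} \<times> {a..b} \<times> {-1..1}) (\<lambda>(t, x, v). Ft t x v)"
    and Fx_cont: "continuous_on ({0..T'} \<times> {a..b} \<times> {-1..1}) (\<lambda>(t, x, v). Fx t x v)"
    and Ft: "\<And>t x v. t \<in> {0..T'} \<Longrightarrow> x \<in> {a..b} \<Longrightarrow> v \<in> {-1..1} \<Longrightarrow>
      ((\<lambda>s. F s x v) has_real_derivative Ft t x v) (at t within {0..T'})"
    and Fx: "\<And>t x v. t \<in> {0..T'} \<Longrightarrow> x \<in> {a..b} \<Longrightarrow> v \<in> {-1..1} \<Longrightarrow>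
      ((\<lambda>y. F t y v) has_real_derivative Fx t x v) (at x within {a..b})"
  shows "(\<lambda>(t, x, v). (F t x v, Ft t x v, Fx t x v)) \<in> unif_closure ({0..T} \<times> {a..b} \<times> {-1..1}) exp_jets"
proof (rule unif_closureI)
  fix e :: real assume "e > 0"
  let ?K' = "{0..T'} \<times> {a..b} \<times> {-1..1::real}" and ?K = "{0..T} \<times> {a..b} \<times> {-1..1::real}"
  define l where "l = b - a"
  \<comment> \<open>The sum of the factors in \<open>err_t\<close>, \<open>err_x\<close> and
    \<open>err\<close>.\<close>
  define C where "C = (3 + l) + (3 + T) + 1 + l * (3 + T) + T * (3 + l)"
  have l: "l > 0" using ab by (simp add: l_def)
  have C: "C > 0" using l T by (simp add: C_def add_pos_pos)
  define e1 where "e1 = e / C"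
  have e1: "e1 > 0" "C * e1 = e" using \<open>e > 0\<close> C by (auto simp: e1_def)
  have compact: "compact ?K'" "compact ?K" by (intro compact_Times compact_Icc)+
  obtain d1 where d1: "d1 > 0" "\<And>y z. y \<in> ?K' \<Longrightarrow> z \<in> ?K' \<Longrightarrow> dist z y < d1 \<Longrightarrow>
      dist ((\<lambda>(t, x, v). Ft t x v) z) ((\<lambda>(t, x, v). Ft t x v) y) < e1"
    using compact_uniformly_continuous[OF Ft_cont compact(1)] e1(1) unfolding uniformly_continuous_on_def by metis
  obtain d2 where d2: "d2 > 0" "\<And>y z. y \<in> ?K' \<Longrightarrow> z \<in> ?K' \<Longrightarrow> dist z y < d2 \<Longrightarrow>
      dist ((\<lambda>(t, x, v). Fx t x v) z) ((\<lambda>(t, x, v). Fx t x v) y) < e1"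
    using compact_uniformly_continuous[OF Fx_cont compact(1)] e1(1) unfolding uniformly_continuous_on_def by metis
  \<comment> \<open>Over a time step \<open>h\<close> both derivatives oscillate by at most
    \<open>e1\<close>, and \<open>t + h\<close> stays within \<open>T'\<close>.\<close>
  define h where "h = min (min d1 d2 / 2) (T' - T)"
  have h: "h > 0" "h < d1" "h < d2" "T + h \<le> T'"
    using d1(1) d2(1) T by (auto simp: h_def)
  have dist_t: "dist (z, x, v) (t, x, v) = \<bar>z - t\<bar>" for z t x v :: real
    by (simp add: dist_Pair_Pair dist_real_def)
  have osc_t: "\<bar>Ft z x v - Ft t x v\<bar> \<le> e1" and osc_x: "\<bar>Fx z x v - Fx t x v\<bar> \<le> e1"
    if "t \<in> {0..T}" "z \<in> {t..t+h}" "x \<in> {a..b}" "v \<in> {-1..1}" for t z x v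
    using d1(2)[of "(t, x, v)" "(z, x, v)"] d2(2)[of "(t, x, v)" "(z, x, v)"] that h
    by (auto simp: dist_t dist_real_def)
  have subK: "?K \<subseteq> ?K'" using T by auto
  \<comment> \<open>\<open>q\<close> is at once the \<open>x\<close>-derivative of the quotient
    \<open>A\<close> of \<open>F\<close> in \<open>err_t\<close> and the \<open>t\<close>-derivative
    of the time average \<open>B\<close> of \<open>Fx\<close> in \<open>err_x\<close>. A true mixed
    derivative would be needed in exactly these two roles.\<close>
  define q where "q = (\<lambda>(t, x, v). (Fx (t + h) x v - Fx t x v) / h)"
  have "continuous_on ?K (\<lambda>z. (\<lambda>(t, x, v). Fx t x v) ((\<lambda>(t, x, v). (t + h, x, v)) z))"
    by (rule continuous_on_compose2[OF Fx_cont]) (use h T in \<open>auto simp: split_def intro!: continuous_intros\<close>)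
  then have "continuous_on ?K (\<lambda>z. ((\<lambda>(t, x, v). Fx t x v) ((\<lambda>(t, x, v). (t + h, x, v)) z)
      - (\<lambda>(t, x, v). Fx t x v) z) / h)"
    by (intro continuous_intros continuous_on_subset[OF Fx_cont subK]) (use h in auto)
  then have q_cont: "continuous_on ?K q"
    by (simp add: q_def split_def)
  obtain p0 where p0: "p0 \<in> lin_hull exps_pos" "\<And>t x v. (t, x, v) \<in> ?K \<Longrightarrow> \<bar>F t x v - p0 (t, x, v)\<bar> \<le> e1"
    using unif_closureD[OF exps_pos_dense[OF compact(2) continuous_on_subset[OF F_cont subK]] e1(1)] by fastforce
  obtain p1 where p1: "p1 \<in> lin_hull exps_pos" "\<And>t x v. (t, x, v) \<in> ?K \<Longrightarrow> \<bar>Fx t x v - p1 (t, x, v)\<bar> \<le> e1"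
    using unif_closureD[OF exps_pos_dense[OF compact(2) continuous_on_subset[OF Fx_cont subK]] e1(1)] by fastforce
  obtain p2 where p2: "p2 \<in> lin_hull exps_pos" "\<And>t x v. (t, x, v) \<in> ?K \<Longrightarrow> \<bar>Ft t x v - p2 (t, x, v)\<bar> \<le> e1"
    using unif_closureD[OF exps_pos_dense[OF compact(2) continuous_on_subset[OF Ft_cont subK]] e1(1)] by fastforce
  obtain p3 where p3: "p3 \<in> lin_hull exps_pos" "\<And>z. z \<in> ?K \<Longrightarrow> \<bar>q z - p3 z\<bar> \<le> e1"
    using unif_closureD[OF exps_pos_dense[OF compact(2) q_cont] e1(1)] by fastforce
  obtain J0 where J0: "J0 \<in> lin_hull exp_jets" "\<And>t x v. J0 (t, x, v) = (p0 (0, a, v), 0, 0)"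
    using primitive_const[OF p0(1), of a] by blast
  obtain J1 where J1: "J1 \<in> lin_hull exp_jets" "\<And>t x v. snd (J1 (t, x, v)) = (0, p1 (0, x, v))" "\<And>t v. fst (J1 (t, a, v)) = 0"
    using primitive_x[OF p1(1), of a] by blast
  obtain J2 where J2: "J2 \<in> lin_hull exp_jets" "\<And>t x v. snd (J2 (t, x, v)) = (p2 (t, a, v), 0)" "\<And>x v. fst (J2 (0, x, v)) = 0"
    using primitive_t[OF p2(1), of a] by blast
  obtain J3 where J3: "J3 \<in> lin_hull exp_jets"
    "\<And>t x v. ((\<lambda>y. fst (snd (J3 (t, y, v)))) has_real_derivative p3 (t, x, v)) (at x)"
    "\<And>t x v. ((\<lambda>s. snd (snd (J3 (s, x, v)))) has_real_derivative p3 (t, x, v)) (at t)"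
    "\<And>t v. fst (snd (J3 (t, a, v))) = 0" "\<And>x v. snd (snd (J3 (0, x, v))) = 0" "\<And>v. fst (J3 (0, a, v)) = 0"
    using primitive_tx[OF p3(1), of a] by blast
  \<comment> \<open>Modelled on the reconstruction of \<open>F t x v\<close> from its value at
    \<open>(0, a)\<close>, the integral of \<open>Fx\<close> along \<open>t = 0\<close>, the
    integral of \<open>Ft\<close> along \<open>x = a\<close>, and the double integral of the mixed
    derivative.\<close>
  define H where "H y = J0 y + J1 y + (J2 y + J3 y)" for y
  have H: "H \<in> lin_hull exp_jets"
    unfolding H_def by (rule lin_hull_add[OF lin_hull_add[OF J0(1) J1(1)] lin_hull_add[OF J2(1) J3(1)]])
  have valid: "jet_valid H" by (rule jet_valid_lin_hull[OF H])
  \<comment> \<open>Three errors \<open>e1\<close> come from \<open>p2\<close> at \<open>a\<close>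
    and from replacing \<open>Ft\<close> by \<open>A\<close> at \<open>x\<close> and at
    \<open>a\<close>; \<open>l * e1\<close> comes from integrating \<open>p3 - q\<close> in
    \<open>x\<close>.\<close>
  have err_t: "\<bar>Ft t x v - fst (snd (H (t, x, v)))\<bar> \<le> (3 + l) * e1" if K: "t \<in> {0..T}" "x \<in> {a..b}" "v \<in> {-1..1}" for t x v
  proof -
    define A where "A y = (F (t + h) y v - F t y v) / h" for y
    define P where "P y = fst (snd (J3 (t, y, v)))" for y
    have "\<bar>(P x - A x) - (P a - A a)\<bar> \<le> e1 * \<bar>x - a\<bar>"
    proof (rule abs_diff_le_of_deriv[of a b _ "\<lambda>y. p3 (t, y, v) - q (t, y, v)"])
      fix y assume y: "y \<in> {a..b}"
      have "(A has_real_derivative q (t, y, v)) (at y within {a..b})"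
        unfolding A_def q_def split
        by (intro DERIV_cdivide DERIV_diff Fx) (use y K h in auto)
      moreover have "(P has_real_derivative p3 (t, y, v)) (at y within {a..b})"
        unfolding P_def by (rule DERIV_subset[OF J3(2)]) simp
      ultimately show "((\<lambda>y. P y - A y) has_real_derivative p3 (t, y, v) - q (t, y, v)) (at y within {a..b})"
        by (intro DERIV_diff)
      show "\<bar>p3 (t, y, v) - q (t, y, v)\<bar> \<le> e1"
        using p3(2)[of "(t, y, v)"] K y by (auto simp: abs_minus_commute)
    qed (use K ab in auto)
    also have "\<dots> \<le> e1 * l"
      using K e1 by (intro mult_left_mono) (auto simp: l_def)
    finally have P: "\<bar>P x - (A x - A a)\<bar> \<le> e1 * l"
      using J3(4) by (simp add: P_def algebra_simps)
    have A: "\<bar>A y - Ft t y v\<bar> \<le> e1" if "y \<in> {a..b}" for y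
      unfolding A_def
    proof (rule difference_quotient_close[where \<phi>' = "\<lambda>z. Ft z y v", OF h(1)])
      show "((\<lambda>s. F s y v) has_real_derivative Ft z y v) (at z within {t..t + h})" if "z \<in> {t..t + h}" for z
        by (rule DERIV_subset[OF Ft]) (use that K \<open>y \<in> {a..b}\<close> h in auto)
      show "\<bar>Ft z y v - Ft t y v\<bar> \<le> e1" if "z \<in> {t..t + h}" for z
        by (rule osc_t) (use that K \<open>y \<in> {a..b}\<close> in auto)
    qed
    have "\<bar>Ft t a v - p2 (t, a, v)\<bar> \<le> e1"
      using p2(2)[of t a v] K ab by auto
    moreover have "fst (snd (H (t, x, v))) = p2 (t, a, v) + P x"
      by (simp add: H_def J0(2) J1(2) J2(2) P_def)
    moreover have "(3 + l) * e1 = 3 * e1 + e1 * l" by (simp add: algebra_simps)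
    ultimately show ?thesis
      using P A[of x] A[of a] K ab by auto
  qed
  have err_x: "\<bar>Fx t x v - snd (snd (H (t, x, v)))\<bar> \<le> (3 + T) * e1" if K: "t \<in> {0..T}" "x \<in> {a..b}" "v \<in> {-1..1}" for t x v
  proof -
    have "continuous_on {0..T'} (\<lambda>s. (\<lambda>(t, x, v). Fx t x v) (s, x, v))"
      by (rule continuous_on_compose2[OF Fx_cont]) (use K in \<open>auto intro!: continuous_intros\<close>)
    then obtain \<Phi> where \<Phi>: "\<And>z. z \<in> {0..T'} \<Longrightarrow> (\<Phi> has_real_derivative Fx z x v) (at z within {0..T'})"
      using antiderivative_continuous[of 0 T' "\<lambda>s. Fx s x v"]
      by (auto simp: has_real_derivative_iff_has_vector_derivative)
    \<comment> \<open>The average of \<open>Fx\<close> over \<open>{s..s + h}\<close>; the four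
      errors in \<open>err_x\<close> mirror those in \<open>err_t\<close>, with \<open>T\<close> in
      place of \<open>l\<close>.\<close>
    define B where "B s = (\<Phi> (s + h) - \<Phi> s) / h" for s
    define P where "P s = snd (snd (J3 (s, x, v)))" for s
    have "\<bar>(P t - B t) - (P 0 - B 0)\<bar> \<le> e1 * \<bar>t - 0\<bar>"
    proof (rule abs_diff_le_of_deriv[of 0 T _ "\<lambda>s. p3 (s, x, v) - q (s, x, v)"])
      fix s assume s: "s \<in> {0..T}"
      have "(B has_real_derivative q (s, x, v)) (at s within {0..T})"
        unfolding B_def q_def split by (rule difference_quotient_deriv[OF \<Phi> h(1,4) s])
      moreover have "(P has_real_derivative p3 (s, x, v)) (at s within {0..T})"
        unfolding P_def by (rule DERIV_subset[OF J3(3)]) simp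
      ultimately show "((\<lambda>s. P s - B s) has_real_derivative p3 (s, x, v) - q (s, x, v)) (at s within {0..T})"
        by (intro DERIV_diff)
      show "\<bar>p3 (s, x, v) - q (s, x, v)\<bar> \<le> e1"
        using p3(2)[of "(s, x, v)"] K s by (auto simp: abs_minus_commute)
    qed (use K in auto)
    also have "\<dots> \<le> e1 * T"
      using K e1 by (intro mult_left_mono) auto
    finally have P: "\<bar>P t - (B t - B 0)\<bar> \<le> e1 * T"
      using J3(5) by (simp add: P_def algebra_simps)
    have B: "\<bar>B s - Fx s x v\<bar> \<le> e1" if "s \<in> {0..T}" for s
      unfolding B_def
    proof (rule difference_quotient_close[where \<phi>' = "\<lambda>z. Fx z x v", OF h(1)])
      show "(\<Phi> has_real_derivative Fx z x v) (at z within {s..s + h})" if "z \<in> {s..s + h}" for z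
        by (rule DERIV_subset[OF \<Phi>]) (use that \<open>s \<in> {0..T}\<close> h in auto)
      show "\<bar>Fx z x v - Fx s x v\<bar> \<le> e1" if "z \<in> {s..s + h}" for z
        by (rule osc_x) (use that K \<open>s \<in> {0..T}\<close> in auto)
    qed
    have "\<bar>Fx 0 x v - p1 (0, x, v)\<bar> \<le> e1"
      using p1(2)[of 0 x v] K by auto
    moreover have "snd (snd (H (t, x, v))) = p1 (0, x, v) + P t"
      by (simp add: H_def J0(2) J1(2) J2(2) P_def)
    moreover have "(3 + T) * e1 = 3 * e1 + e1 * T" by (simp add: algebra_simps)
    ultimately show ?thesis
      using P B[of t] B[of 0] K T by auto
  qed
  \<comment> \<open>The derivative errors are integrated from the corner, first in \<open>x\<close>
    at time 0, then in \<open>t\<close>.\<close>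
  have err: "\<bar>F t x v - fst (H (t, x, v))\<bar> \<le> (1 + l * (3 + T) + T * (3 + l)) * e1"
    if K: "t \<in> {0..T}" "x \<in> {a..b}" "v \<in> {-1..1}" for t x v
  proof -
    have "fst (H (0, a, v)) = p0 (0, a, v)"
      by (simp add: H_def J0(2) J1(3) J2(3) J3(6))
    then have 0: "\<bar>F 0 a v - fst (H (0, a, v))\<bar> \<le> e1"
      using p0(2)[of 0 a v] K ab by auto
    have "\<bar>(F 0 x v - fst (H (0, x, v))) - (F 0 a v - fst (H (0, a, v)))\<bar> \<le> ((3 + T) * e1) * \<bar>x - a\<bar>"
    proof (rule abs_diff_le_of_deriv[of a b _ "\<lambda>y. Fx 0 y v - snd (snd (H (0, y, v)))"])
      fix y assume y: "y \<in> {a..b}"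
      have "((\<lambda>y. fst (H (0, y, v))) has_real_derivative snd (snd (H (0, y, v)))) (at y within {a..b})"
        by (rule DERIV_subset[of _ _ _ UNIV]) (use valid in \<open>auto simp: jet_valid_def\<close>)
      then show "((\<lambda>y. F 0 y v - fst (H (0, y, v))) has_real_derivative Fx 0 y v - snd (snd (H (0, y, v)))) (at y within {a..b})"
        by (intro DERIV_diff Fx) (use y K T in auto)
      show "\<bar>Fx 0 y v - snd (snd (H (0, y, v)))\<bar> \<le> (3 + T) * e1"
        by (rule err_x) (use y K T in auto)
    qed (use K ab in auto)
    also have "\<dots> \<le> ((3 + T) * e1) * l"
      using K e1 T by (intro mult_left_mono) (auto simp: l_def)
    finally have 1: "\<bar>F 0 x v - fst (H (0, x, v))\<bar> \<le> e1 + ((3 + T) * e1) * l" using 0 by linarith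
    have "\<bar>(F t x v - fst (H (t, x, v))) - (F 0 x v - fst (H (0, x, v)))\<bar> \<le> ((3 + l) * e1) * \<bar>t - 0\<bar>"
    proof (rule abs_diff_le_of_deriv[of 0 T _ "\<lambda>s. Ft s x v - fst (snd (H (s, x, v)))"])
      fix s assume s: "s \<in> {0..T}"
      have "((\<lambda>s. fst (H (s, x, v))) has_real_derivative fst (snd (H (s, x, v)))) (at s within {0..T})"
        by (rule DERIV_subset[of _ _ _ UNIV]) (use valid in \<open>auto simp: jet_valid_def\<close>)
      moreover have "((\<lambda>s. F s x v) has_real_derivative Ft s x v) (at s within {0..T})"
        by (rule DERIV_subset[OF Ft]) (use s K T in auto)
      ultimately show "((\<lambda>s. F s x v - fst (H (s, x, v))) has_real_derivative Ft s x v - fst (snd (H (s, x, v)))) (at s within {0..T})"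
        by (intro DERIV_diff)
      show "\<bar>Ft s x v - fst (snd (H (s, x, v)))\<bar> \<le> (3 + l) * e1"
        by (rule err_t) (use s K in auto)
    qed (use K in auto)
    also have "\<dots> \<le> ((3 + l) * e1) * T"
      using K e1 l by (intro mult_left_mono) auto
    finally have "\<bar>F t x v - fst (H (t, x, v))\<bar> \<le> e1 + ((3 + T) * e1) * l + ((3 + l) * e1) * T"
      using 1 by linarith
    then show ?thesis by (simp add: algebra_simps)
  qed
  have "norm ((\<lambda>(t, x, v). (F t x v, Ft t x v, Fx t x v)) y - H y) \<le> e" if "y \<in> ?K" for y
  proof -
    obtain t x v where y: "y = (t, x, v)" by (cases y)
    then have K: "t \<in> {0..T}" "x \<in> {a..b}" "v \<in> {-1..1}" using that by auto
    have "norm ((\<lambda>(t, x, v). (F t x v, Ft t x v, Fx t x v)) y - H y)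
        \<le> \<bar>F t x v - fst (H (t, x, v))\<bar> + \<bar>Ft t x v - fst (snd (H (t, x, v)))\<bar> + \<bar>Fx t x v - snd (snd (H (t, x, v)))\<bar>"
      using norm_triple_bound[of "F t x v - fst (H (t, x, v))" "Ft t x v - fst (snd (H (t, x, v)))" "Fx t x v - snd (snd (H (t, x, v)))"]
      by (cases "H (t, x, v)") (simp add: y)
    also have "\<dots> \<le> C * e1"
      using err[OF K] err_t[OF K] err_x[OF K] by (simp add: C_def algebra_simps)
    finally show ?thesis by (simp add: e1(2))
  qed
  with H show "\<exists>H\<in>lin_hull exp_jets. \<forall>y\<in>?K. norm ((\<lambda>(t, x, v). (F t x v, Ft t x v, Fx t x v)) y - H y) \<le> e"
    by (intro bexI[of _ H] ballI)
qed

section \<open>Approximation by networks\<close>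

definition networks :: "nat \<Rightarrow> (nat \<Rightarrow> real \<Rightarrow> real) \<Rightarrow> (real \<Rightarrow> real \<Rightarrow> real \<Rightarrow> real) set" where
  "networks L act = {network L act m w b | m w b. admissible_widths L m}"

text \<open>Continuity is recorded for bounds on compact sets when a layer is added, and for the
  velocity integral in the scattering term.\<close>

definition net_jets ::
  "nat \<Rightarrow> (nat \<Rightarrow> real \<Rightarrow> real) \<Rightarrow> (real \<times> real \<times> real \<Rightarrow> real \<times> real \<times> real) set" where
  "net_jets L act =
     {J. jet_valid J \<and> continuous_on UNIV J \<and> (\<lambda>t x v. fst (J (t, x, v))) \<in> networks L act}"

text \<open>Since hidden layers must not be empty, one neuron with output weight 0 serves as the
  start of the induction.\<close>

lemma zero_in_networks_two: "(\<lambda>t x v. 0) \<in> networks 2 act"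
proof -
  have "(\<lambda>t x v. 0) = network 2 act (\<lambda>l. if l = 0 then 3 else 1) (\<lambda>_ _ _. 0) (\<lambda>_ _. 0)"
    by (intro ext, subst network_two_layers) auto
  then show ?thesis
    unfolding networks_def admissible_widths_def by fastforce
qed

lemma networks_two_add_neuron:
  assumes "h \<in> networks 2 act"
  shows "(\<lambda>t x v. h t x v + c * act 1 (\<alpha> * t + \<beta> * x + \<gamma> * v + b)) \<in> networks 2 act"
proof -
  obtain m w b' where m: "admissible_widths 2 m" and h: "h = network 2 act m w b'"
    using assms by (auto simp: networks_def)
  define n where "n = Suc (m 1)"
  define m' where "m' = m(1 := n)"
  define w' where "w' = (\<lambda>l j i. if l = 1 \<and> j = n then (if i = 1 then \<alpha> else if i = 2 then \<beta> else \<gamma>)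
    else if l = 2 \<and> i = n then c else w l j i)"
  define b'' where "b'' = (\<lambda>l j. if l = 1 \<and> j = n then b else b' l j)"
  have m0: "m 0 = 3" "m' 0 = 3" using m by (auto simp: admissible_widths_def m'_def)
  have "(\<lambda>t x v. h t x v + c * act 1 (\<alpha> * t + \<beta> * x + \<gamma> * v + b)) = network 2 act m' w' b''"
  proof (intro ext)
    fix t x v
    have "network 2 act m' w' b'' t x v =
      (\<Sum>i=1..m 1. w' 2 1 i * act 1 (w' 1 i 1 * t + w' 1 i 2 * x + w' 1 i 3 * v + b'' 1 i)) +
      w' 2 1 n * act 1 (w' 1 n 1 * t + w' 1 n 2 * x + w' 1 n 3 * v + b'' 1 n) + b'' 2 1"
      unfolding network_two_layers[where m = m', OF m0(2)] by (simp add: m'_def n_def)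
    also have "(\<Sum>i=1..m 1. w' 2 1 i * act 1 (w' 1 i 1 * t + w' 1 i 2 * x + w' 1 i 3 * v + b'' 1 i)) =
      (\<Sum>i=1..m 1. w 2 1 i * act 1 (w 1 i 1 * t + w 1 i 2 * x + w 1 i 3 * v + b' 1 i))"
      by (intro sum.cong) (auto simp: w'_def b''_def n_def)
    finally show "h t x v + c * act 1 (\<alpha> * t + \<beta> * x + \<gamma> * v + b) = network 2 act m' w' b'' t x v"
      by (simp add: h network_two_layers[where m = m, OF m0(1)] w'_def b''_def)
  qed
  moreover have "admissible_widths 2 m'"
    using m by (auto simp: admissible_widths_def m'_def n_def)
  ultimately show ?thesis unfolding networks_def by blast
qed

text \<open>The hull grows by one scaled generator at a time, which is the same as adding one hidden
  neuron; the scalar becomes its output weight.\<close>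

lemma ridge3_hull_in_net_jets:
  assumes s: "\<And>y. (act 1 has_real_derivative s' y) (at y)" and s': "continuous_on UNIV s'"
    and J: "J \<in> lin_hull (ridge3 (act 1) s')"
  shows "J \<in> net_jets 2 act"
  using J
proof induction
  case zero
  show ?case
    by (auto simp: net_jets_def jet_valid_def zero_in_networks_two)
next
  case (step J g c)
  obtain \<alpha> \<beta> \<gamma> b where g: "g = (\<lambda>(t, x, v). (act 1 (\<alpha> * t + \<beta> * x + \<gamma> * v + b),
     \<alpha> * s' (\<alpha> * t + \<beta> * x + \<gamma> * v + b), \<beta> * s' (\<alpha> * t + \<beta> * x + \<gamma> * v + b)))"
    using step.hyps(2) by (auto simp: ridge3_def)
  have s_cont: "continuous_on UNIV (act 1)"
    using s by (meson DERIV_isCont continuous_at_imp_continuous_on)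
  have "continuous_on UNIV g"
    unfolding g split_def
    by (intro continuous_intros continuous_on_compose2[OF s'] continuous_on_compose2[OF s_cont]) auto
  moreover have "jet_valid g"
    unfolding jet_valid_def
  proof (intro allI conjI)
    fix t x v
    have "((\<lambda>s. act 1 (\<alpha> * s + \<beta> * x + \<gamma> * v + b)) has_real_derivative
        s' (\<alpha> * t + \<beta> * x + \<gamma> * v + b) * \<alpha>) (at t)"
      by (rule DERIV_chain2[OF s]) (auto intro!: derivative_eq_intros)
    then show "((\<lambda>s. fst (g (s, x, v))) has_real_derivative fst (snd (g (t, x, v)))) (at t)"
      by (simp add: g mult.commute)
    have "((\<lambda>y. act 1 (\<alpha> * t + \<beta> * y + \<gamma> * v + b)) has_real_derivative
        s' (\<alpha> * t + \<beta> * x + \<gamma> * v + b) * \<beta>) (at x)"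
      by (rule DERIV_chain2[OF s]) (auto intro!: derivative_eq_intros)
    then show "((\<lambda>y. fst (g (t, y, v))) has_real_derivative snd (snd (g (t, x, v)))) (at x)"
      by (simp add: g mult.commute)
  qed
  moreover have "(\<lambda>t x v. fst (J (t, x, v)) + c * act 1 (\<alpha> * t + \<beta> * x + \<gamma> * v + b)) \<in> networks 2 act"
    using step.IH by (intro networks_two_add_neuron) (simp add: net_jets_def)
  ultimately show ?case
    using step.IH unfolding net_jets_def jet_valid_def
    by (auto intro!: continuous_intros DERIV_add DERIV_cmult) (simp add: g)
qed

section \<open>Passing from two layers to deeper networks\<close>

lemma net_layer_cong:
  assumes "\<And>k. k < l \<Longrightarrow> m k = m' k \<and> w (Suc k) = w' (Suc k) \<and> b (Suc k) = b' (Suc k)"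
  shows "net_layer act m w b y l j = net_layer act m' w' b' y l j"
  using assms
proof (induction l arbitrary: j)
  case 0
  show ?case by simp
next
  case (Suc l)
  then have "net_layer act m w b y l i = net_layer act m' w' b' y l i" for i by simp
  with Suc.prems[of l] show ?case by (simp cong: if_cong)
qed

lemma networks_add_layer:
  assumes "h \<in> networks l act" "l \<ge> 1"
  shows "(\<lambda>t x v. p * act l (q * h t x v + r) + d) \<in> networks (Suc l) act"
proof -
  obtain m w b where m: "admissible_widths l m" and h: "h = network l act m w b"
    using assms by (auto simp: networks_def)
  obtain k where k: "l = Suc k" using assms(2) by (cases l) auto
  \<comment> \<open>The former output becomes the only neuron of hidden layer \<open>l\<close>,
    whose weights and bias absorb the map by \<open>q\<close> and \<open>r\<close>; \<open>p\<close>
    and \<open>d\<close> form the new output layer.\<close>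
  define m' where "m' = m(l := 1)"
  define w' where "w' = w(l := (\<lambda>j i. q * w l j i), Suc l := (\<lambda>_ _. p))"
  define b' where "b' = b(l := (\<lambda>j. q * b l j + r), Suc l := (\<lambda>_. d))"
  have "net_layer act m' w' b' y k i = net_layer act m w b y k i" for y i
    by (rule net_layer_cong) (auto simp: m'_def w'_def b'_def k)
  then have layer: "net_layer act m' w' b' y l 1 = q * net_layer act m w b y l 1 + r" for y
    by (simp add: k m'_def w'_def b'_def sum_distrib_left mult.assoc distrib_left cong: if_cong)
  have "net_layer act m' w' b' y (Suc l) 1 = p * act l (net_layer act m' w' b' y l 1) + d" for y
    using assms(2) by (simp add: m'_def w'_def b'_def)
  then have "network (Suc l) act m' w' b' = (\<lambda>t x v. p * act l (q * h t x v + r) + d)"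
    by (simp add: network_def h layer fun_eq_iff del: net_layer.simps One_nat_def)
  moreover have "admissible_widths (Suc l) m'"
    using m assms(2) by (auto simp: admissible_widths_def m'_def)
  ultimately show ?thesis unfolding networks_def by (metis (mono_tags, lifting) mem_Collect_eq)
qed

lemma net_jets_add_layer:
  assumes J: "J \<in> net_jets l act" and l: "l \<ge> 1"
    and s: "\<And>y. (act l has_real_derivative s' y) (at y)" and s': "continuous_on UNIV s'"
  shows "(\<lambda>y. (p * act l (q * fst (J y) + r) + d, p * q * s' (q * fst (J y) + r) * fst (snd (J y)),
      p * q * s' (q * fst (J y) + r) * snd (snd (J y)))) \<in> net_jets (Suc l) act" (is "?J \<in> _")
proof -
  have s_cont: "continuous_on UNIV (act l)"
    using s by (meson DERIV_isCont continuous_at_imp_continuous_on)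
  have J_cont: "continuous_on UNIV J" and J_valid: "jet_valid J"
    using J by (auto simp: net_jets_def)
  have "continuous_on UNIV ?J"
    by (intro continuous_intros continuous_on_compose2[OF s'] continuous_on_compose2[OF s_cont] J_cont) auto
  moreover have "jet_valid ?J"
    unfolding jet_valid_def
  proof (intro allI conjI)
    fix t x v
    have "((\<lambda>s. q * fst (J (s, x, v)) + r) has_real_derivative q * fst (snd (J (t, x, v))) + 0) (at t)"
      using J_valid unfolding jet_valid_def by (intro DERIV_add DERIV_cmult DERIV_const) auto
    from DERIV_add[OF DERIV_cmult[OF DERIV_chain2[OF s this], of p] DERIV_const[of d]]
    show "((\<lambda>s. fst (?J (s, x, v))) has_real_derivative fst (snd (?J (t, x, v)))) (at t)"
      by (simp add: algebra_simps)
    have "((\<lambda>y. q * fst (J (t, y, v)) + r) has_real_derivative q * snd (snd (J (t, x, v))) + 0) (at x)"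
      using J_valid unfolding jet_valid_def by (intro DERIV_add DERIV_cmult DERIV_const) auto
    from DERIV_add[OF DERIV_cmult[OF DERIV_chain2[OF s this], of p] DERIV_const[of d]]
    show "((\<lambda>y. fst (?J (t, y, v))) has_real_derivative snd (snd (?J (t, x, v)))) (at x)"
      by (simp add: algebra_simps)
  qed
  moreover have "(\<lambda>t x v. fst (?J (t, x, v))) \<in> networks (Suc l) act"
    using networks_add_layer[of "\<lambda>t x v. fst (J (t, x, v))" l act p q r d] J l by (simp add: net_jets_def)
  ultimately show ?thesis by (simp add: net_jets_def)
qed

lemma admissible_activationD:
  assumes "admissible_activation s"
  obtains s' where "\<And>y. (s has_real_derivative s' y) (at y)" "continuous_on UNIV s'"
  using assms unfolding admissible_activation_def C1_differentiable_on_def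
  by (auto simp: has_real_derivative_iff_has_vector_derivative)

text \<open>
  A single neuron, used near a point where its activation has nonzero slope, passes the output of the
  layers below on almost unchanged.
\<close>

lemma net_jets_pass_through:
  assumes J: "J \<in> net_jets l act" and l: "l \<ge> 1" and act: "admissible_activation (act l)"
    and K: "compact K" and "e > 0"
  shows "\<exists>H\<in>net_jets (Suc l) act. \<forall>y\<in>K. norm (J y - H y) \<le> e"
proof -
  obtain s' where s: "\<And>y. (act l has_real_derivative s' y) (at y)" and s': "continuous_on UNIV s'"
    using admissible_activationD[OF act] by blast
  \<comment> \<open>With zero slope everywhere the activation would be constant, hence a
    polynomial.\<close>
  obtain b where b: "s' b \<noteq> 0"
  proof (rule ccontr)
    assume "\<not> thesis"
    with that have "\<And>y. (act l has_real_derivative 0) (at y)" using s by metis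
    then have "act l y = act l 0" for y using DERIV_isconst_all by blast
    then have "\<forall>u. act l u = poly [:act l 0:] u" by simp
    with act show False unfolding admissible_activation_def by blast
  qed
  have "bounded (J ` K)"
    using J K by (intro compact_imp_bounded compact_continuous_image)
      (auto simp: net_jets_def intro: continuous_on_subset)
  then obtain B where B: "B > 0" "\<And>y. y \<in> K \<Longrightarrow> norm (J y) \<le> B"
    unfolding bounded_pos by auto
  define e' where "e' = e / (3 * B)"
  have e': "e' > 0" using \<open>e > 0\<close> B by (simp add: e'_def)
  have "isCont s' b" using s' by (simp add: continuous_on_eq_continuous_at)
  moreover have "e' * \<bar>s' b\<bar> > 0" using e' b by simp
  ultimately obtain \<eta> where \<eta>: "\<eta> > 0" "\<And>z. \<bar>z - b\<bar> < \<eta> \<Longrightarrow> \<bar>s' z - s' b\<bar> < e' * \<bar>s' b\<bar>"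
    unfolding continuous_at_eps_delta dist_real_def by metis
  \<comment> \<open>Shrinks the output of the lower layers, bounded by \<open>B\<close>, into the
    range around \<open>b\<close> where the slope is nearly \<open>s' b\<close>; \<open>p\<close>
    undoes both the shrinking and the slope.\<close>
  define \<delta> where "\<delta> = \<eta> / (2 * B)"
  have \<delta>: "\<delta> > 0" using \<eta> B by (simp add: \<delta>_def)
  define p where "p = 1 / (\<delta> * s' b)"
  define H where "H y = (p * act l (\<delta> * fst (J y) + b) + - p * act l b, p * \<delta> * s' (\<delta> * fst (J y) + b) * fst (snd (J y)),
      p * \<delta> * s' (\<delta> * fst (J y) + b) * snd (snd (J y)))" for y
  have "H \<in> net_jets (Suc l) act"
    unfolding H_def by (rule net_jets_add_layer[OF J l s s'])
  moreover have "norm (J y - H y) \<le> e" if "y \<in> K" for y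
  proof -
    define u where "u = \<delta> * fst (J y)"
    have comp: "\<bar>fst (J y)\<bar> \<le> B" "\<bar>fst (snd (J y))\<bar> \<le> B" "\<bar>snd (snd (J y))\<bar> \<le> B"
      using B(2)[OF that] norm_fst_le[of "fst (J y)" "snd (J y)"] norm_snd_le[of "snd (J y)" "fst (J y)"]
        norm_fst_le[of "fst (snd (J y))" "snd (snd (J y))"] norm_snd_le[of "snd (snd (J y))" "fst (snd (J y))"]
      by auto
    have "\<bar>u\<bar> \<le> \<delta> * B"
      using comp(1) \<delta> by (simp add: u_def abs_mult)
    also have "\<dots> < \<eta>" using \<eta>(1) B(1) by (simp add: \<delta>_def)
    finally have u: "\<bar>u\<bar> < \<eta>" .
    have slope: "\<bar>p * \<delta> * s' z - 1\<bar> \<le> e'" if "\<bar>z - b\<bar> < \<eta>" for z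
    proof -
      have "p * \<delta> * s' z - 1 = (s' z - s' b) / s' b"
        using \<delta> b by (simp add: p_def field_simps)
      then show ?thesis using \<eta>(2)[OF that] b by (simp add: abs_divide divide_le_eq)
    qed
    \<comment> \<open>The deviation from the tangent is proportional to
      \<open>\<bar>u\<bar>\<close>, so its factor \<open>\<delta>\<close> cancels against the one in
      \<open>p\<close>.\<close>
    have "\<bar>(act l (b + u) - s' b * (b + u)) - (act l b - s' b * b)\<bar> \<le> (e' * \<bar>s' b\<bar>) * \<bar>(b + u) - b\<bar>"
    proof (rule abs_diff_le_of_deriv[of "b - \<bar>u\<bar>" "b + \<bar>u\<bar>" _ "\<lambda>z. s' z - s' b"])
      show "((\<lambda>z. act l z - s' b * z) has_real_derivative s' z - s' b) (at z within {b - \<bar>u\<bar>..b + \<bar>u\<bar>})" for z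
        by (rule DERIV_subset[of _ _ _ UNIV]) (auto intro!: derivative_eq_intros s)
      show "\<bar>s' z - s' b\<bar> \<le> e' * \<bar>s' b\<bar>" if "z \<in> {b - \<bar>u\<bar>..b + \<bar>u\<bar>}" for z
      proof -
        have "\<bar>z - b\<bar> < \<eta>" using that u unfolding atLeastAtMost_iff by linarith
        then show ?thesis by (intro less_imp_le \<eta>(2))
      qed
    qed auto
    then have lin: "\<bar>act l (b + u) - act l b - s' b * u\<bar> \<le> e' * \<bar>s' b\<bar> * \<bar>u\<bar>"
      by (simp add: algebra_simps)
    have "fst (J y) - fst (H y) = - p * (act l (b + u) - act l b - s' b * u)"
      using \<delta> b by (simp add: H_def p_def u_def field_simps)
    then have "\<bar>fst (J y) - fst (H y)\<bar> \<le> \<bar>p\<bar> * (e' * \<bar>s' b\<bar> * \<bar>u\<bar>)"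
      using lin by (simp add: abs_mult mult_left_mono)
    also have "\<dots> = e' * \<bar>fst (J y)\<bar>"
      using \<delta> b by (simp add: p_def u_def abs_mult)
    also have "\<dots> \<le> e' * B" using comp e' by simp
    finally have 1: "\<bar>fst (J y) - fst (H y)\<bar> \<le> e' * B" .
    have prod: "\<bar>c - p * \<delta> * s' (\<delta> * fst (J y) + b) * c\<bar> \<le> e' * B" if "\<bar>c\<bar> \<le> B" for c
    proof -
      have "\<bar>c - p * \<delta> * s' (\<delta> * fst (J y) + b) * c\<bar> = \<bar>p * \<delta> * s' (u + b) - 1\<bar> * \<bar>c\<bar>"
        unfolding abs_mult[symmetric] u_def by (simp add: algebra_simps abs_minus_commute)
      also have "\<dots> \<le> e' * B" using slope[of "u + b"] u that e' by (intro mult_mono) auto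
      finally show ?thesis .
    qed
    have "norm (J y - H y) \<le> \<bar>fst (J y) - fst (H y)\<bar> + \<bar>fst (snd (J y)) - fst (snd (H y))\<bar>
        + \<bar>snd (snd (J y)) - snd (snd (H y))\<bar>"
      using norm_triple_bound[of "fst (J y) - fst (H y)" "fst (snd (J y)) - fst (snd (H y))" "snd (snd (J y)) - snd (snd (H y))"]
      by (cases "J y"; cases "H y") simp
    also have "\<dots> \<le> e' * B + e' * B + e' * B"
      using 1 prod[OF comp(2)] prod[OF comp(3)] by (intro add_mono) (auto simp: H_def)
    also have "\<dots> = e" using B by (simp add: e'_def)
    finally show ?thesis .
  qed
  ultimately show ?thesis by (intro bexI[of _ H] ballI)
qed

text \<open>Two layers suffice for approximation by the density of ridge functions; each further
  layer is one pass-through neuron, granted half of the tolerance at its stage.\<close>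

theorem network_C1_approximation:
  fixes F Ft Fx :: "real \<Rightarrow> real \<Rightarrow> real \<Rightarrow> real"
  assumes "0 < T" "T < T'" "a < b"
    and "continuous_on ({0..T'} \<times> {a..b} \<times> {-1..1}) (\<lambda>(t, x, v). F t x v)"
    and "continuous_on ({0..T'} \<times> {a..b} \<times> {-1..1}) (\<lambda>(t, x, v). Ft t x v)"
    and "continuous_on ({0..T'} \<times> {a..b} \<times> {-1..1}) (\<lambda>(t, x, v). Fx t x v)"
    and "\<And>t x v. t \<in> {0..T'} \<Longrightarrow> x \<in> {a..b} \<Longrightarrow> v \<in> {-1..1} \<Longrightarrow>
      ((\<lambda>s. F s x v) has_real_derivative Ft t x v) (at t within {0..T'})"
    and "\<And>t x v. t \<in> {0..T'} \<Longrightarrow> x \<in> {a..b} \<Longrightarrow> v \<in> {-1..1} \<Longrightarrow>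
      ((\<lambda>y. F t y v) has_real_derivative Fx t x v) (at x within {a..b})"
    and L: "2 \<le> L" and act: "\<forall>l\<in>{1..<L}. admissible_activation (act l)" and e: "e > 0"
  shows "\<exists>H\<in>net_jets L act. \<forall>t\<in>{0..T}. \<forall>x\<in>{a..b}. \<forall>v\<in>{-1..1}.
    \<bar>F t x v - fst (H (t, x, v))\<bar> \<le> e \<and> \<bar>Ft t x v - fst (snd (H (t, x, v)))\<bar> \<le> e \<and>
    \<bar>Fx t x v - snd (snd (H (t, x, v)))\<bar> \<le> e"
proof -
  define K where "K = {0..T} \<times> {a..b} \<times> {-1..1::real}"
  define J where "J = (\<lambda>(t, x, v). (F t x v, Ft t x v, Fx t x v))"
  have K: "compact K" unfolding K_def by (intro compact_Times compact_Icc)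
  have act1: "admissible_activation (act 1)" using act L by auto
  then obtain s' where s: "\<And>y. (act 1 has_real_derivative s' y) (at y)" and s': "continuous_on UNIV s'"
    using admissible_activationD by blast
  have "exp_jets \<subseteq> unif_closure K (ridge3 (act 1) s')"
    using act1 by (intro exp_jets_in_ridge3_closure s s' K) (simp add: admissible_activation_def)
  then have J: "J \<in> unif_closure K (ridge3 (act 1) s')"
    unfolding J_def K_def by (intro unif_closure_idem[OF exp_jets_dense[OF assms(1-8)]])
  have "\<exists>H\<in>net_jets l act. \<forall>y\<in>K. norm (J y - H y) \<le> e" if "2 \<le> l" "l \<le> L" "e > 0" for l and e :: real
    using that
  proof (induction l arbitrary: e rule: dec_induct)
    case base
    obtain H where "H \<in> lin_hull (ridge3 (act 1) s')" "\<forall>y\<in>K. norm (J y - H y) \<le> e"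
      using unif_closureD[OF J base(2)] by blast
    then show ?case using ridge3_hull_in_net_jets[of act s', OF s s'] by blast
  next
    case (step l)
    obtain H where H: "H \<in> net_jets l act" "\<forall>y\<in>K. norm (J y - H y) \<le> e / 2"
      using step.IH[of "e / 2"] step.prems by auto
    have "admissible_activation (act l)" using act step by auto
    then obtain G where G: "G \<in> net_jets (Suc l) act" "\<forall>y\<in>K. norm (H y - G y) \<le> e / 2"
      using net_jets_pass_through[OF H(1) _ _ K, of "e / 2"] step by auto
    have "norm (J y - G y) \<le> e" if "y \<in> K" for y
      using norm_diff_triangle_le[of "J y" "H y" "e/2" "G y" "e/2"] H(2) G(2) that by simp
    with G(1) show ?case by blast
  qed
  from this[OF L order_refl e] obtain H where H: "H \<in> net_jets L act" "\<And>y. y \<in> K \<Longrightarrow> norm (J y - H y) \<le> e"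
    by blast
  show ?thesis
  proof (intro bexI[OF _ H(1)] ballI)
    fix t x v assume "t \<in> {0..T}" "x \<in> {a..b}" "v \<in> {-1..1::real}"
    then have "norm (J (t, x, v) - H (t, x, v)) \<le> e" by (intro H(2)) (simp add: K_def)
    moreover obtain h ht hx where h: "H (t, x, v) = (h, ht, hx)" by (cases "H (t, x, v)")
    ultimately have "norm (F t x v - h, Ft t x v - ht, Fx t x v - hx) \<le> e" by (simp add: J_def)
    then show "\<bar>F t x v - fst (H (t, x, v))\<bar> \<le> e \<and> \<bar>Ft t x v - fst (snd (H (t, x, v)))\<bar> \<le> e \<and>
        \<bar>Fx t x v - snd (snd (H (t, x, v)))\<bar> \<le> e"
      using norm_fst_le[of "F t x v - h" "(Ft t x v - ht, Fx t x v - hx)"]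
        norm_snd_le[of "(Ft t x v - ht, Fx t x v - hx)" "F t x v - h"]
        norm_fst_le[of "Ft t x v - ht" "Fx t x v - hx"] norm_snd_le[of "Fx t x v - hx" "Ft t x v - ht"]
      by (simp add: h)
  qed
qed

section \<open>The residual of the dilated solution\<close>

definition fluctuation :: "(real \<Rightarrow> real) \<Rightarrow> real \<Rightarrow> real" where
  "fluctuation p v = 1/2 * (LBINT v':{-1..1}. p v') - p v"

lemma scattering_fluctuation: "scattering \<sigma> h t x v = \<sigma> x * fluctuation (h t x) v"
  by (simp add: scattering_def fluctuation_def)

text \<open>One \<open>e\<close> comes from the velocity average, as the factor \<open>1/2\<close>
  offsets the length 2 of the interval, and one from the value at \<open>v\<close>.\<close>

lemma fluctuation_diff_le:
  assumes p: "continuous_on {-1..1} p" and q: "continuous_on {-1..1} q"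
    and pq: "\<And>v. v \<in> {-1..1} \<Longrightarrow> \<bar>p v - q v\<bar> \<le> e" and v: "v \<in> {-1..1}"
  shows "\<bar>fluctuation p v - fluctuation q v\<bar> \<le> 2 * e"
proof -
  have "set_integrable lborel {-1..1} p" "set_integrable lborel {-1..1} q"
    using p q by (auto intro: borel_integrable_atLeastAtMost')
  then have "(LBINT v':{-1..1}. p v') - (LBINT v':{-1..1}. q v') = integral {-1..1} (\<lambda>v. p v - q v)"
    using set_integral_diff(2)[of lborel "{-1..1}" p q] set_borel_integral_eq_integral(2)[OF set_integral_diff(1)] by metis
  moreover have "norm (integral {-1..1} (\<lambda>v. p v - q v)) \<le> e * (1 - (-1))"
    by (rule integral_bound) (use pq in \<open>auto intro!: continuous_intros p q\<close>)
  ultimately have "\<bar>(LBINT v':{-1..1}. p v') - (LBINT v':{-1..1}. q v')\<bar> \<le> 2 * e" by simp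
  then show ?thesis
    using pq[OF v] unfolding fluctuation_def by linarith
qed

lemma fluctuation_le:
  assumes p: "continuous_on {-1..1} p" and "\<And>v. v \<in> {-1..1} \<Longrightarrow> \<bar>p v\<bar> \<le> B" and "v \<in> {-1..1}"
  shows "\<bar>fluctuation p v\<bar> \<le> 2 * B"
  using fluctuation_diff_le[OF p continuous_on_const[of _ 0], of B v] assms by (simp add: fluctuation_def)

definition residual ::
  "real \<Rightarrow> real \<Rightarrow> (real \<Rightarrow> real) \<Rightarrow> (real \<Rightarrow> real \<Rightarrow> real \<Rightarrow> real) \<Rightarrow> real \<Rightarrow> real \<Rightarrow> real \<Rightarrow> real" where
  "residual \<epsilon> T \<sigma> h t x v =
     \<epsilon> * time_deriv T h t x v + v * space_deriv h t x v - 1 / \<epsilon> * scattering \<sigma> h t x v"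

text \<open>Positivity of \<open>T\<close> makes the derivative within \<open>{0..T}\<close> unique,
  so it agrees with the two-sided one even at the end points.\<close>

lemma jet_valid_derivs:
  assumes "jet_valid H" "0 < T" "t \<in> {0..T}"
  shows "time_deriv T (\<lambda>t x v. fst (H (t, x, v))) t x v = fst (snd (H (t, x, v)))"
    and "space_deriv (\<lambda>t x v. fst (H (t, x, v))) t x v = snd (snd (H (t, x, v)))"
  using assms unfolding jet_valid_def time_deriv_def space_deriv_def
  by (auto intro!: DERIV_imp_deriv vector_derivative_at_within_ivl
      simp flip: has_real_derivative_iff_has_vector_derivative)

text \<open>
  Dilating the solution about the midpoint of the domain in \<open>x\<close>, and by the same factor in \<open>t\<close>, makes
  it \<open>C\<^sup>1\<close> up to the boundary. As both first-order terms get multiplied by the same factor, the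
  equation still expresses them through the bounded scattering term, however large they are
  individually; so the residual stays bounded, and tends to zero uniformly inside the domain.
\<close>

lemma network_residual_small:
  fixes f :: "real \<Rightarrow> real \<Rightarrow> real \<Rightarrow> real"
  assumes T: "0 < T" and \<epsilon>: "0 < \<epsilon>" and ab: "a < b"
    and \<sigma>: "\<And>x. x \<in> {a<..<b} \<Longrightarrow> \<bar>\<sigma> x\<bar> \<le> S" and L: "2 \<le> L"
    and act: "\<forall>l\<in>{1..<L}. admissible_activation (act l)"
    and f: "C1_time_phase T {a<..<b} f" and sol: "solves_transport \<epsilon> T {a<..<b} \<sigma> f0 g f"
  shows "\<exists>M\<ge>0. \<forall>\<eta>>0. \<exists>h\<in>networks L act.
    (\<forall>t\<in>{0..T}. \<forall>x\<in>{a..b}. \<forall>v\<in>{-1..1}. \<bar>h t x v - f t x v\<bar> \<le> \<eta>) \<and>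
    (\<forall>t\<in>{0..T}. \<forall>x\<in>{a<..<b}. \<forall>v\<in>{-1..1}. \<bar>residual \<epsilon> T \<sigma> h t x v\<bar> \<le> M) \<and>
    (\<forall>t\<in>{0..T}. \<forall>x\<in>{a+\<eta>..b-\<eta>}. \<forall>v\<in>{-1..1}. \<bar>residual \<epsilon> T \<sigma> h t x v\<bar> \<le> \<eta>)"
proof -
  let ?K = "{0..T} \<times> {a..b} \<times> {-1..1::real}"
  have clos: "closure {a<..<b} = {a..b}" using ab by simp
  define Q where "Q t x v = \<epsilon> * time_deriv T f t x v + v * space_deriv f t x v" for t x v
  have f_cont: "continuous_on ?K (\<lambda>(t, x, v). f t x v)"
    and ft_cont: "continuous_on ({0..T} \<times> {a<..<b} \<times> {-1..1}) (\<lambda>(t, x, v). time_deriv T f t x v)"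
    and fx_cont: "continuous_on ({0..T} \<times> {a<..<b} \<times> {-1..1}) (\<lambda>(t, x, v). space_deriv f t x v)"
    using f unfolding C1_time_phase_def clos by auto
  have f_diff: "(\<lambda>s. f s x v) differentiable (at t within {0..T})" "(\<lambda>y. f t y v) differentiable (at x)"
    if "t \<in> {0..T}" "x \<in> {a<..<b}" "v \<in> {-1..1}" for t x v
    using f that unfolding C1_time_phase_def by auto
  have ft: "((\<lambda>s. f s x v) has_real_derivative time_deriv T f t x v) (at t within {0..T})"
    if "t \<in> {0..T}" "x \<in> {a<..<b}" "v \<in> {-1..1}" for t x v
    using f_diff(1)[OF that]
    by (simp add: time_deriv_def has_real_derivative_iff_has_vector_derivative vector_derivative_works)
  have fx: "((\<lambda>y. f t y v) has_real_derivative space_deriv f t x v) (at x)"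
    if "t \<in> {0..T}" "x \<in> {a<..<b}" "v \<in> {-1..1}" for t x v
    using f_diff(2)[OF that] by (simp add: space_deriv_def DERIV_deriv_iff_real_differentiable)
  have f_cont_v: "continuous_on {-1..1} (f t x)" if "t \<in> {0..T}" "x \<in> {a..b}" for t x
  proof -
    have "continuous_on {-1..1} (\<lambda>v. (\<lambda>(t, x, v). f t x v) (t, x, v))"
      by (rule continuous_on_compose2[OF f_cont]) (use that in \<open>auto intro!: continuous_intros\<close>)
    then show ?thesis by simp
  qed
  have Q_eq: "Q t x v = \<sigma> x / \<epsilon> * fluctuation (f t x) v" if "t \<in> {0..T}" "x \<in> {a<..<b}" "v \<in> {-1..1}" for t x v
    using sol that by (auto simp: solves_transport_def Q_def scattering_fluctuation)
  have compact: "compact ?K" by (intro compact_Times compact_Icc)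
  then have "bounded ((\<lambda>(t, x, v). f t x v) ` ?K)"
    by (intro compact_imp_bounded compact_continuous_image f_cont)
  then obtain B where B: "B > 0" "\<And>t x v. t \<in> {0..T} \<Longrightarrow> x \<in> {a..b} \<Longrightarrow> v \<in> {-1..1} \<Longrightarrow> \<bar>f t x v\<bar> \<le> B"
    unfolding bounded_pos by fastforce
  have S: "S \<ge> 0" using \<sigma>[of "(a + b) / 2"] ab by auto
  define q where "q = S / \<epsilon>"
  have q: "q \<ge> 0" using S \<epsilon> by (simp add: q_def)
  have \<sigma>q: "\<bar>\<sigma> x / \<epsilon>\<bar> \<le> q" if "x \<in> {a<..<b}" for x
    using \<sigma>[OF that] \<epsilon> by (simp add: q_def abs_divide divide_right_mono)
  define Mq where "Mq = q * (2 * B)"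
  have Mq: "Mq \<ge> 0" using q B by (simp add: Mq_def)
  \<comment> \<open>Two space points occur because the residual of the dilated function combines
    \<open>\<sigma>\<close> at \<open>x\<close> with the profile of \<open>f\<close> at
    \<open>X x\<close>.\<close>
  have scat_le: "\<bar>\<sigma> x / \<epsilon> * fluctuation (f t y) v\<bar> \<le> Mq"
    if "t \<in> {0..T}" "x \<in> {a<..<b}" "y \<in> {a..b}" "v \<in> {-1..1}" for t x y v
    unfolding abs_mult Mq_def
    using \<sigma>q[OF that(2)] fluctuation_le[OF f_cont_v, of t y B v] that B q by (intro mult_mono) auto
  \<comment> \<open>The sensitivity of the residual to C1 errors: \<open>\<epsilon>\<close> for the
    time derivative, 1 for the factor \<open>v\<close>, and \<open>2 * q\<close> for
    scattering.\<close>
  define C where "C = \<epsilon> + 1 + 2 * q"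
  have C: "C > 0" using \<epsilon> q by (simp add: C_def)
  \<comment> \<open>One \<open>Mq\<close> each for transport and scattering, and \<open>C\<close>
    for a network error of at most 1. It is fixed before \<open>\<eta>\<close>.\<close>
  define M where "M = 2 * Mq + C"
  have "\<exists>h\<in>networks L act.
    (\<forall>t\<in>{0..T}. \<forall>x\<in>{a..b}. \<forall>v\<in>{-1..1}. \<bar>h t x v - f t x v\<bar> \<le> \<eta>) \<and>
    (\<forall>t\<in>{0..T}. \<forall>x\<in>{a<..<b}. \<forall>v\<in>{-1..1}. \<bar>residual \<epsilon> T \<sigma> h t x v\<bar> \<le> M) \<and>
    (\<forall>t\<in>{0..T}. \<forall>x\<in>{a+\<eta>..b-\<eta>}. \<forall>v\<in>{-1..1}. \<bar>residual \<epsilon> T \<sigma> h t x v\<bar> \<le> \<eta>)"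
    if \<eta>: "\<eta> > 0" for \<eta>
  proof -
    \<comment> \<open>Bounds the change of \<open>f\<close> under the dilation, which the scattering
      term multiplies by \<open>2 * q\<close>.\<close>
    define \<omega> where "\<omega> = \<eta> / (4 * (1 + 2 * q))"
    have \<omega>: "\<omega> > 0" "\<omega> \<le> \<eta> / 4" "2 * q * \<omega> \<le> \<eta> / 4"
    proof -
      have "\<eta> / 4 = \<omega> + 2 * q * \<omega>"
        using q by (simp add: \<omega>_def field_simps add_nonneg_eq_0_iff)
      moreover show "\<omega> > 0" using \<eta> q by (simp add: \<omega>_def)
      ultimately show "\<omega> \<le> \<eta> / 4" "2 * q * \<omega> \<le> \<eta> / 4" using q by auto
    qed
    define e where "e = min 1 (\<eta> / (4 * (1 + C)))"
    have e: "e > 0" "e \<le> 1" "e \<le> \<eta> / 4" "C * e \<le> \<eta> / 4"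
    proof -
      show "e > 0" "e \<le> 1" using \<eta> C by (auto simp: e_def)
      have "(1 + C) * e \<le> (1 + C) * (\<eta> / (4 * (1 + C)))"
        using C by (intro mult_left_mono) (auto simp: e_def)
      also have "\<dots> = \<eta> / 4" using C by (simp add: field_simps)
      finally have "e + C * e \<le> \<eta> / 4" by (simp add: algebra_simps)
      moreover have "C * e > 0" using C \<open>e > 0\<close> by simp
      ultimately show "e \<le> \<eta> / 4" "C * e \<le> \<eta> / 4" using \<open>e > 0\<close> by linarith+
    qed
    obtain d1 where d1: "d1 > 0" "\<And>y z. y \<in> ?K \<Longrightarrow> z \<in> ?K \<Longrightarrow> dist z y < d1 \<Longrightarrow>
        dist ((\<lambda>(t, x, v). f t x v) z) ((\<lambda>(t, x, v). f t x v) y) < \<omega>"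
      using compact_uniformly_continuous[OF f_cont compact] \<omega>(1) unfolding uniformly_continuous_on_def by metis
    \<comment> \<open>The derivatives are continuous on the open domain only, so uniform continuity
      of \<open>Q\<close> is taken from this compact inner slab.\<close>
    let ?I = "{0..T} \<times> {a+\<eta>..b-\<eta>} \<times> {-1..1::real}"
    have "?I \<subseteq> {0..T} \<times> {a<..<b} \<times> {-1..1}" using \<eta> by auto
    then have "continuous_on ?I (\<lambda>z. \<epsilon> * (\<lambda>(t, x, v). time_deriv T f t x v) z + snd (snd z) * (\<lambda>(t, x, v). space_deriv f t x v) z)"
      by (intro continuous_intros continuous_on_subset[OF ft_cont] continuous_on_subset[OF fx_cont])
    then have "continuous_on ?I (\<lambda>(t, x, v). Q t x v)"
      by (simp add: Q_def split_def)
    then have "uniformly_continuous_on ?I (\<lambda>(t, x, v). Q t x v)"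
      by (intro compact_uniformly_continuous compact_Times compact_Icc)
    moreover have "\<eta> / 8 > 0" using \<eta> by simp
    ultimately obtain d2 where d2: "d2 > 0" "\<And>y z. y \<in> ?I \<Longrightarrow> z \<in> ?I \<Longrightarrow> dist z y < d2 \<Longrightarrow>
        dist ((\<lambda>(t, x, v). Q t x v) z) ((\<lambda>(t, x, v). Q t x v) y) < \<eta> / 8"
      unfolding uniformly_continuous_on_def by metis
    define w where "w = T + (b - a)"
    have w: "w > 0" using T ab by (simp add: w_def)
    \<comment> \<open>The three bounds keep \<open>\<mu>\<close> positive, the displacement
      \<open>\<kappa> * w\<close> within both moduli of continuity, and the loss
      \<open>\<kappa> * Q\<close> of the transport term below \<open>\<eta> / 8\<close>.\<close>
    define \<kappa> where "\<kappa> = min (1/2) (min (min d1 d2 / (2 * w)) (\<eta> / (8 * (1 + Mq))))"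
    have \<kappa>: "\<kappa> > 0" "\<kappa> \<le> 1/2" "\<kappa> * w < d1" "\<kappa> * w < d2" "\<kappa> * Mq \<le> \<eta> / 8"
    proof -
      show \<kappa>0: "\<kappa> > 0" using d1(1) d2(1) w Mq \<eta> by (auto simp: \<kappa>_def)
      show "\<kappa> \<le> 1/2" unfolding \<kappa>_def by (rule min.cobounded1)
      have "\<kappa> * w \<le> (min d1 d2 / (2 * w)) * w"
        using w by (intro mult_right_mono) (auto simp: \<kappa>_def)
      then have "\<kappa> * w \<le> min d1 d2 / 2" using w by simp
      then show "\<kappa> * w < d1" "\<kappa> * w < d2" using d1(1) d2(1) by linarith+
      have "\<kappa> * (1 + Mq) \<le> (\<eta> / (8 * (1 + Mq))) * (1 + Mq)"
        using Mq by (intro mult_right_mono) (auto simp: \<kappa>_def)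
      also have "\<dots> = \<eta> / 8" using Mq by (simp add: field_simps)
      finally show "\<kappa> * Mq \<le> \<eta> / 8" using \<kappa>0 by (simp add: algebra_simps)
    qed
    define \<mu> where "\<mu> = 1 - \<kappa>"
    have \<mu>: "0 < \<mu>" "\<mu> < 1" using \<kappa> by (auto simp: \<mu>_def)
    define c where "c = (a + b) / 2"
    define X where "X x = c + \<mu> * (x - c)" for x
    have X_conv: "X x = \<mu> * x + (1 - \<mu>) * c" for x by (simp add: X_def algebra_simps)
    have X_in: "X x \<in> {a<..<b}" if "x \<in> {a..b}" for x
    proof -
      have "\<mu> * a + (1 - \<mu>) * a < \<mu> * x + (1 - \<mu>) * c" "\<mu> * x + (1 - \<mu>) * c < \<mu> * b + (1 - \<mu>) * b"
        using that \<mu> ab by (intro add_le_less_mono mult_left_mono mult_strict_left_mono; simp add: c_def)+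
      then show ?thesis by (simp add: X_conv algebra_simps)
    qed
    have X_in': "X x \<in> {a+\<eta>..b-\<eta>}" if "x \<in> {a+\<eta>..b-\<eta>}" for x
    proof -
      \<comment> \<open>A nonempty inner interval contains the midpoint, so contraction towards it
        preserves the interval.\<close>
      have "c \<in> {a+\<eta>..b-\<eta>}" using that by (auto simp: c_def field_simps)
      then have "\<mu> * (a+\<eta>) + (1 - \<mu>) * (a+\<eta>) \<le> \<mu> * x + (1 - \<mu>) * c"
        "\<mu> * x + (1 - \<mu>) * c \<le> \<mu> * (b-\<eta>) + (1 - \<mu>) * (b-\<eta>)"
        using that \<mu> by (intro add_mono mult_left_mono; simp)+
      then show ?thesis by (simp add: X_conv algebra_simps)
    qed
    have \<mu>t: "\<mu> * t \<in> {0..T}" if "t \<in> {0..T / \<mu>}" for t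
      using that \<mu> by (auto simp: field_simps)
    have T': "T < T / \<mu>" using T \<mu> by (simp add: field_simps)
    have shift: "dist (\<mu> * t, X x, v) (t, x, v) \<le> \<kappa> * w" if "t \<in> {0..T}" "x \<in> {a..b}" for t x v :: real
    proof -
      have "\<bar>x - c\<bar> \<le> b - a"
        using that ab unfolding c_def atLeastAtMost_iff by argo
      then have "\<bar>\<kappa> * t\<bar> \<le> \<kappa> * T" "\<bar>\<kappa> * (x - c)\<bar> \<le> \<kappa> * (b - a)"
        unfolding abs_mult using that \<kappa>(1) ab by (auto intro!: mult_mono)
      moreover have "\<mu> * t - t = - (\<kappa> * t)" "X x - x = - (\<kappa> * (x - c))"
        by (auto simp: X_def \<mu>_def algebra_simps)
      ultimately have "\<bar>\<mu> * t - t\<bar> + \<bar>X x - x\<bar> + \<bar>v - v\<bar> \<le> \<kappa> * w"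
        by (simp add: w_def algebra_simps)
      then show ?thesis
        using norm_triple_bound[of "\<mu> * t - t" "X x - x" "v - v"] by (simp add: dist_norm)
    qed
    define F where "F t x v = f (\<mu> * t) (X x) v" for t x v
    define Ft where "Ft t x v = \<mu> * time_deriv T f (\<mu> * t) (X x) v" for t x v
    define Fx where "Fx t x v = \<mu> * space_deriv f (\<mu> * t) (X x) v" for t x v
    let ?K' = "{0..T / \<mu>} \<times> {a..b} \<times> {-1..1::real}"
    have comp: "continuous_on ?K' (\<lambda>(t, x, v). \<phi> (\<mu> * t) (X x) v)"
      if "continuous_on ({0..T} \<times> {a<..<b} \<times> {-1..1}) (\<lambda>(t, x, v). \<phi> t x v)" for \<phi> :: "real \<Rightarrow> real \<Rightarrow> real \<Rightarrow> real"
    proof -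
      have "continuous_on ?K' (\<lambda>z. (\<lambda>(t, x, v). \<phi> t x v) ((\<lambda>(t, x, v). (\<mu> * t, X x, v)) z))"
      proof (rule continuous_on_compose2[OF that])
        show "continuous_on ?K' (\<lambda>(t, x, v). (\<mu> * t, X x, v))"
          unfolding X_def split_def by (intro continuous_intros)
        show "(\<lambda>(t, x, v). (\<mu> * t, X x, v)) ` ?K' \<subseteq> {0..T} \<times> {a<..<b} \<times> {-1..1}"
          using \<mu>t X_in by auto
      qed
      then show ?thesis by (simp add: split_def)
    qed
    have "continuous_on ?K' (\<lambda>(t, x, v). F t x v)"
      unfolding F_def by (rule comp, rule continuous_on_subset[OF f_cont]) auto
    moreover have "continuous_on ?K' (\<lambda>(t, x, v). Ft t x v)" "continuous_on ?K' (\<lambda>(t, x, v). Fx t x v)"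
      using continuous_on_mult_left[OF comp[OF ft_cont], of \<mu>] continuous_on_mult_left[OF comp[OF fx_cont], of \<mu>]
      by (simp_all add: Ft_def Fx_def split_def)
    moreover have "((\<lambda>s. F s x v) has_real_derivative Ft t x v) (at t within {0..T / \<mu>})"
      if "t \<in> {0..T / \<mu>}" "x \<in> {a..b}" "v \<in> {-1..1}" for t x v
    proof -
      have "((\<lambda>s. f s (X x) v) has_real_derivative time_deriv T f (\<mu> * t) (X x) v) (at (\<mu> * t) within (\<lambda>s. \<mu> * s) ` {0..T / \<mu>})"
        by (rule DERIV_subset[OF ft]) (use that \<mu>t X_in in auto)
      moreover have "((\<lambda>s. \<mu> * s) has_real_derivative \<mu>) (at t within {0..T / \<mu>})"
        by (auto intro!: derivative_eq_intros)
      ultimately have "((\<lambda>s. f s (X x) v) \<circ> (\<lambda>s. \<mu> * s) has_real_derivative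
          time_deriv T f (\<mu> * t) (X x) v * \<mu>) (at t within {0..T / \<mu>})"
        by (rule DERIV_image_chain)
      then show ?thesis by (simp add: o_def F_def Ft_def mult.commute)
    qed
    moreover have "((\<lambda>y. F t y v) has_real_derivative Fx t x v) (at x within {a..b})"
      if "t \<in> {0..T / \<mu>}" "x \<in> {a..b}" "v \<in> {-1..1}" for t x v
    proof -
      have "((\<lambda>y. X y) has_real_derivative \<mu>) (at x within {a..b})"
        unfolding X_def by (auto intro!: derivative_eq_intros)
      from DERIV_chain2[OF fx this, of "\<mu> * t" v] show ?thesis
        using that \<mu>t[OF that(1)] X_in by (simp add: F_def Fx_def mult.commute)
    qed
    ultimately obtain H where H: "H \<in> net_jets L act"
      "\<And>t x v. t \<in> {0..T} \<Longrightarrow> x \<in> {a..b} \<Longrightarrow> v \<in> {-1..1} \<Longrightarrow>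
        \<bar>F t x v - fst (H (t, x, v))\<bar> \<le> e \<and> \<bar>Ft t x v - fst (snd (H (t, x, v)))\<bar> \<le> e \<and>
        \<bar>Fx t x v - snd (snd (H (t, x, v)))\<bar> \<le> e"
      using network_C1_approximation[OF T T' ab, of F Ft Fx L act e] L act e(1) by blast
    define h where "h = (\<lambda>t x v. fst (H (t, x, v)))"
    have h_net: "h \<in> networks L act" and H_valid: "jet_valid H" and H_cont: "continuous_on UNIV H"
      using H(1) by (auto simp: net_jets_def h_def)
    have f_near: "\<bar>F t x v - f t x v\<bar> \<le> \<omega>" if K: "t \<in> {0..T}" "x \<in> {a..b}" "v \<in> {-1..1}" for t x v
      using d1(2)[of "(t, x, v)" "(\<mu> * t, X x, v)"] shift[OF K(1,2), of v] \<kappa>(3) K X_in[OF K(2)] \<mu>t[of t] T'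
      by (auto simp: F_def dist_real_def)
    have near: "\<bar>h t x v - f t x v\<bar> \<le> \<eta>" if K: "t \<in> {0..T}" "x \<in> {a..b}" "v \<in> {-1..1}" for t x v
      using f_near[OF K] H(2)[OF K] e(3) \<omega>(2) \<eta> by (auto simp: h_def)
    have F_cont_v: "continuous_on {-1..1} (F t x)" if "t \<in> {0..T}" "x \<in> {a..b}" for t x
      unfolding F_def using f_cont_v[of "\<mu> * t" "X x"] \<mu>t[of t] X_in[of x] T' that by auto
    have h_cont_v: "continuous_on {-1..1} (h t x)" for t x
      unfolding h_def by (intro continuous_intros continuous_on_compose2[OF H_cont]) auto
    \<comment> \<open>The residual of the dilated function \<open>F\<close>, with \<open>Ft\<close>
      and \<open>Fx\<close> as its derivatives.\<close>
    define R where "R t x v = \<mu> * Q (\<mu> * t) (X x) v - \<sigma> x / \<epsilon> * fluctuation (F t x) v" for t x v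
    have res_near: "\<bar>residual \<epsilon> T \<sigma> h t x v - R t x v\<bar> \<le> C * e"
      if K: "t \<in> {0..T}" "x \<in> {a<..<b}" "v \<in> {-1..1}" for t x v
    proof -
      have K': "x \<in> {a..b}" using K by auto
      note near = H(2)[OF K(1) K' K(3)]
      have "\<bar>fluctuation (h t x) v - fluctuation (F t x) v\<bar> \<le> 2 * e"
        using H(2)[OF K(1) K'] F_cont_v[OF K(1) K'] h_cont_v K(3)
        by (intro fluctuation_diff_le) (auto simp: h_def abs_minus_commute)
      then have "\<bar>\<sigma> x / \<epsilon> * (fluctuation (h t x) v - fluctuation (F t x) v)\<bar> \<le> q * (2 * e)"
        unfolding abs_mult using \<sigma>q[OF K(2)] q by (intro mult_mono) auto
      moreover have "\<bar>\<epsilon> * (fst (snd (H (t, x, v))) - Ft t x v)\<bar> \<le> \<epsilon> * e"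
        using near \<epsilon> by (simp add: abs_mult abs_minus_commute)
      moreover have "\<bar>v * (snd (snd (H (t, x, v))) - Fx t x v)\<bar> \<le> 1 * e"
        unfolding abs_mult using near K(3) by (intro mult_mono) (auto simp: abs_minus_commute)
      moreover have "residual \<epsilon> T \<sigma> h t x v - R t x v = \<epsilon> * (fst (snd (H (t, x, v))) - Ft t x v)
          + v * (snd (snd (H (t, x, v))) - Fx t x v) - \<sigma> x / \<epsilon> * (fluctuation (h t x) v - fluctuation (F t x) v)"
        unfolding residual_def h_def jet_valid_derivs[OF H_valid T K(1)] scattering_fluctuation R_def Q_def Ft_def Fx_def
        by (simp add: algebra_simps)
      moreover have "C * e = \<epsilon> * e + 1 * e + q * (2 * e)" by (simp add: C_def algebra_simps)
      ultimately show ?thesis by linarith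
    qed
    have Q_le: "\<bar>Q (\<mu> * t) (X x) v\<bar> \<le> Mq" and scat: "\<bar>\<sigma> x / \<epsilon> * fluctuation (F t x) v\<bar> \<le> Mq"
      if K: "t \<in> {0..T}" "x \<in> {a<..<b}" "v \<in> {-1..1}" for t x v
    proof -
      have K': "x \<in> {a..b}" "\<mu> * t \<in> {0..T}" using K \<mu>t[of t] T' by auto
      show "\<bar>Q (\<mu> * t) (X x) v\<bar> \<le> Mq"
        unfolding Q_eq[OF K'(2) X_in[OF K'(1)] K(3)]
        by (rule scat_le) (use K K' X_in[OF K'(1)] in auto)
      have "F t x = f (\<mu> * t) (X x)" by (rule ext) (simp add: F_def)
      then show "\<bar>\<sigma> x / \<epsilon> * fluctuation (F t x) v\<bar> \<le> Mq"
        using scat_le[of "\<mu> * t" x "X x" v] K K' X_in[OF K'(1)] by auto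
    qed
    have bounded: "\<bar>residual \<epsilon> T \<sigma> h t x v\<bar> \<le> M" if K: "t \<in> {0..T}" "x \<in> {a<..<b}" "v \<in> {-1..1}" for t x v
    proof -
      have "\<bar>\<mu> * Q (\<mu> * t) (X x) v\<bar> \<le> 1 * Mq"
        unfolding abs_mult using \<mu> Q_le[OF K] by (intro mult_mono) auto
      moreover have "C * e \<le> C" using C e by simp
      ultimately show ?thesis
        using res_near[OF K] scat[OF K] unfolding M_def R_def by linarith
    qed
    have small: "\<bar>residual \<epsilon> T \<sigma> h t x v\<bar> \<le> \<eta>" if K: "t \<in> {0..T}" "x \<in> {a+\<eta>..b-\<eta>}" "v \<in> {-1..1}" for t x v
    proof -
      have K': "x \<in> {a<..<b}" "x \<in> {a..b}" "\<mu> * t \<in> {0..T}" using K \<eta> \<mu>t[of t] T' by auto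
      have "\<bar>Q (\<mu> * t) (X x) v - Q t x v\<bar> \<le> \<eta> / 8"
        using d2(2)[of "(t, x, v)" "(\<mu> * t, X x, v)"] shift[OF K(1) K'(2), of v] \<kappa>(4) K K' X_in'[OF K(2)]
        by (auto simp: dist_real_def)
      moreover have "\<bar>\<kappa> * Q (\<mu> * t) (X x) v\<bar> \<le> \<eta> / 8"
      proof -
        have "\<bar>\<kappa> * Q (\<mu> * t) (X x) v\<bar> \<le> \<kappa> * Mq"
          using Q_le[OF K(1) K'(1) K(3)] \<kappa>(1) by (simp add: abs_mult)
        then show ?thesis using \<kappa>(5) by linarith
      qed
      moreover have "\<bar>\<sigma> x / \<epsilon> * (fluctuation (f t x) v - fluctuation (F t x) v)\<bar> \<le> \<eta> / 4"
      proof -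
        have "\<bar>fluctuation (f t x) v - fluctuation (F t x) v\<bar> \<le> 2 * \<omega>"
          using f_near[OF K(1) K'(2)] F_cont_v[OF K(1) K'(2)] f_cont_v[OF K(1) K'(2)] K(3)
          by (intro fluctuation_diff_le) (auto simp: abs_minus_commute)
        then have "\<bar>\<sigma> x / \<epsilon> * (fluctuation (f t x) v - fluctuation (F t x) v)\<bar> \<le> q * (2 * \<omega>)"
          unfolding abs_mult using \<sigma>q[OF K'(1)] q by (intro mult_mono) auto
        then show ?thesis using \<omega>(3) by (simp add: mult_ac)
      qed
      \<comment> \<open>The equation at the undilated point \<open>(t, x)\<close> replaces
        \<open>\<sigma> x / \<epsilon>\<close> times the fluctuation of \<open>f\<close> by
        \<open>Q t x v\<close>, so only one value of \<open>\<sigma>\<close> occurs. The three parts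
        take \<open>\<eta> / 8\<close>, \<open>\<eta> / 8\<close> and
        \<open>\<eta> / 4\<close>.\<close>
      moreover have "R t x v = (Q (\<mu> * t) (X x) v - Q t x v) - \<kappa> * Q (\<mu> * t) (X x) v
          + \<sigma> x / \<epsilon> * (fluctuation (f t x) v - fluctuation (F t x) v)"
        unfolding R_def using Q_eq[OF K(1) K'(1) K(3)] by (simp add: \<mu>_def algebra_simps)
      ultimately have "\<bar>R t x v\<bar> \<le> \<eta> / 2" by linarith
      then show ?thesis using res_near[OF K(1) K'(1) K(3)] e(4) \<eta> by linarith
    qed
    show ?thesis
      using near bounded small by (intro bexI[OF _ h_net] conjI ballI)
  qed
  moreover have "M \<ge> 0" using Mq C by (simp add: M_def)
  ultimately show ?thesis by blast
qed

section \<open>The loss\<close>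

lemma set_nn_integral_le:
  fixes G :: "real \<Rightarrow> ennreal"
  assumes "\<And>t. t \<in> A \<Longrightarrow> G t \<le> C" "A \<subseteq> {p..q}" "p \<le> q"
  shows "(\<integral>\<^sup>+t\<in>A. G t \<partial>lborel) \<le> C * ennreal (q - p)"
proof -
  have "(\<integral>\<^sup>+t\<in>A. G t \<partial>lborel) \<le> (\<integral>\<^sup>+t. C * indicator {p..q} t \<partial>lborel)"
    by (intro nn_integral_mono) (use assms(1,2) in \<open>auto simp: indicator_def\<close>)
  also have "\<dots> = C * ennreal (q - p)"
    using assms(3) by (subst nn_integral_cmult_indicator) auto
  finally show ?thesis .
qed

lemma ennreal_square_le: "\<bar>y\<bar> \<le> r \<Longrightarrow> ennreal (\<bar>y\<bar>\<^sup>2) \<le> ennreal (r\<^sup>2)" for y r :: real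
  by (intro ennreal_leI power_mono) auto

lemma frontier_open_interval: "a < b \<Longrightarrow> frontier {a<..<b} = {a, b}" for a b :: real
  by (auto simp: frontier_def)

text \<open>Velocity integration contributes a factor 2; the small bound is integrated over the
  whole interval, the crude one over two boundary strips of total length at most
  \<open>2 * \<eta>\<close>.\<close>

lemma loss_GE_le:
  assumes T: "0 < T" and \<eta>: "0 < \<eta>" and ab: "a < b" and M: "0 \<le> M"
    and bound: "\<And>t x v. t \<in> {0..T} \<Longrightarrow> x \<in> {a<..<b} \<Longrightarrow> v \<in> {-1..1} \<Longrightarrow> \<bar>residual \<epsilon> T \<sigma> h t x v\<bar> \<le> M"
    and small: "\<And>t x v. t \<in> {0..T} \<Longrightarrow> x \<in> {a+\<eta>..b-\<eta>} \<Longrightarrow> v \<in> {-1..1} \<Longrightarrow> \<bar>residual \<epsilon> T \<sigma> h t x v\<bar> \<le> \<eta>"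
  shows "loss_GE \<epsilon> T {a<..<b} \<sigma> h \<le> ennreal ((2 * \<eta>\<^sup>2 * (b - a) + 4 * M\<^sup>2 * \<eta>) * T)"
proof -
  let ?N = "{a..a+\<eta>} \<union> {b-\<eta>..b}"
  define V where "V t x = (\<integral>\<^sup>+v\<in>{-1..1}. ennreal (\<bar>residual \<epsilon> T \<sigma> h t x v\<bar>\<^sup>2) \<partial>lborel)" for t x
  have V_le: "V t x \<le> ennreal (2 * r\<^sup>2)" if "\<And>v. v \<in> {-1..1} \<Longrightarrow> \<bar>residual \<epsilon> T \<sigma> h t x v\<bar> \<le> r" for t x r
  proof -
    have "V t x \<le> ennreal (r\<^sup>2) * ennreal (1 - (-1))"
      unfolding V_def by (rule set_nn_integral_le) (intro ennreal_square_le that, auto)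
    also have "\<dots> = ennreal (2 * r\<^sup>2)"
      by (simp add: ennreal_mult' mult.commute flip: ennreal_numeral)
    finally show ?thesis .
  qed
  have "(\<integral>\<^sup>+x\<in>{a<..<b}. V t x \<partial>lborel) \<le> ennreal (2 * \<eta>\<^sup>2 * (b - a) + 4 * M\<^sup>2 * \<eta>)" if t: "t \<in> {0..T}" for t
  proof -
    have "V t x * indicator {a<..<b} x
        \<le> ennreal (2 * \<eta>\<^sup>2) * indicator {a..b} x + ennreal (2 * M\<^sup>2) * indicator ?N x" for x
    proof (cases "x \<in> {a<..<b}")
      case True
      show ?thesis
      proof (cases "x \<in> {a+\<eta>..b-\<eta>}")
        case inner: True
        then have "V t x \<le> ennreal (2 * \<eta>\<^sup>2)" using t small by (intro V_le)
        then show ?thesis using True by (auto simp: indicator_def intro: add_increasing2)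
      next
        case False
        have "V t x \<le> ennreal (2 * M\<^sup>2)" using t True bound by (intro V_le)
        moreover have "x \<in> ?N" using True False by auto
        ultimately show ?thesis using True by (simp add: indicator_def add_increasing)
      qed
    qed simp
    then have "(\<integral>\<^sup>+x\<in>{a<..<b}. V t x \<partial>lborel)
        \<le> (\<integral>\<^sup>+x. ennreal (2 * \<eta>\<^sup>2) * indicator {a..b} x + ennreal (2 * M\<^sup>2) * indicator ?N x \<partial>lborel)"
      by (intro nn_integral_mono)
    also have "\<dots> = ennreal (2 * \<eta>\<^sup>2) * emeasure lborel {a..b} + ennreal (2 * M\<^sup>2) * emeasure lborel ?N"
      by (simp add: nn_integral_add nn_integral_cmult_indicator)
    also have "\<dots> \<le> ennreal (2 * \<eta>\<^sup>2) * ennreal (b - a) + ennreal (2 * M\<^sup>2) * ennreal (2 * \<eta>)"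
    proof -
      have "emeasure lborel ?N \<le> emeasure lborel {a..a+\<eta>} + emeasure lborel {b-\<eta>..b}"
        by (intro emeasure_subadditive) auto
      also have "\<dots> = ennreal (2 * \<eta>)" using \<eta> by (simp flip: ennreal_plus)
      finally show ?thesis using ab by (intro add_mono mult_left_mono) auto
    qed
    also have "\<dots> = ennreal (2 * \<eta>\<^sup>2 * (b - a) + 2 * M\<^sup>2 * (2 * \<eta>))"
      using \<eta> ab by (simp flip: ennreal_mult ennreal_plus)
    finally show ?thesis by (simp add: mult_ac)
  qed
  then have "(\<integral>\<^sup>+t\<in>{0..T}. (\<integral>\<^sup>+x\<in>{a<..<b}. V t x \<partial>lborel) \<partial>lborel)
      \<le> ennreal (2 * \<eta>\<^sup>2 * (b - a) + 4 * M\<^sup>2 * \<eta>) * ennreal (T - 0)"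
    using T by (intro set_nn_integral_le[of "{0..T}" _ _ 0 T]) auto
  also have "\<dots> = ennreal ((2 * \<eta>\<^sup>2 * (b - a) + 4 * M\<^sup>2 * \<eta>) * T)"
    using T by (simp add: ennreal_mult'')
  finally show ?thesis
    unfolding loss_GE_def V_def residual_def .
qed

lemma loss_IC_le:
  assumes ab: "a < b" and near: "\<And>x v. x \<in> {a<..<b} \<Longrightarrow> v \<in> {-1..1} \<Longrightarrow> \<bar>h 0 x v - f0 x v\<bar> \<le> \<eta>"
  shows "loss_IC {a<..<b} f0 h \<le> ennreal (2 * \<eta>\<^sup>2 * (b - a))"
proof -
  have "(\<integral>\<^sup>+v\<in>{-1..1}. ennreal (\<bar>h 0 x v - f0 x v\<bar>\<^sup>2) \<partial>lborel) \<le> ennreal (\<eta>\<^sup>2) * ennreal (1 - (-1))"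
    if "x \<in> {a<..<b}" for x
    by (rule set_nn_integral_le) (intro ennreal_square_le near[OF that], auto)
  then have "loss_IC {a<..<b} f0 h \<le> (ennreal (\<eta>\<^sup>2) * ennreal (1 - (-1))) * ennreal (b - a)"
    unfolding loss_IC_def using ab by (intro set_nn_integral_le[of "{a<..<b}" _ _ a b]) auto
  also have "\<dots> = ennreal (2 * \<eta>\<^sup>2 * (b - a))"
    using ab by (simp add: ennreal_mult' mult_ac flip: ennreal_numeral)
  finally show ?thesis .
qed

text \<open>The constant 4 is the number of end points times the length 2 of the full velocity
  interval, which contains the inflow velocities.\<close>

lemma loss_BC_le:
  assumes T: "0 < T" and ab: "a < b"
    and near: "\<And>t x v. t \<in> {0..T} \<Longrightarrow> (x, v) \<in> inflow_boundary {a<..<b} \<Longrightarrow> \<bar>h t x v - g t x v\<bar> \<le> \<eta>"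
  shows "loss_BC T {a<..<b} g h \<le> ennreal (4 * \<eta>\<^sup>2 * T)"
proof -
  have fr: "frontier {a<..<b} = {a, b}" using ab by (rule frontier_open_interval)
  have side: "(\<integral>\<^sup>+t\<in>{0..T}. (\<integral>\<^sup>+v\<in>{v \<in> {-1..1}. outward_normal {a<..<b} x * v < 0}.
      ennreal (\<bar>h t x v - g t x v\<bar>\<^sup>2) \<partial>lborel) \<partial>lborel) \<le> ennreal (2 * \<eta>\<^sup>2 * T)" if x: "x \<in> {a, b}" for x
  proof -
    have "(\<integral>\<^sup>+v\<in>{v \<in> {-1..1}. outward_normal {a<..<b} x * v < 0}. ennreal (\<bar>h t x v - g t x v\<bar>\<^sup>2) \<partial>lborel)
        \<le> ennreal (\<eta>\<^sup>2) * ennreal (1 - (-1))" if "t \<in> {0..T}" for t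
    proof (rule set_nn_integral_le)
      fix v assume "v \<in> {v \<in> {-1..1}. outward_normal {a<..<b} x * v < 0}"
      then have "(x, v) \<in> inflow_boundary {a<..<b}" using x by (simp add: inflow_boundary_def fr)
      then show "ennreal (\<bar>h t x v - g t x v\<bar>\<^sup>2) \<le> ennreal (\<eta>\<^sup>2)"
        using near[OF that] by (intro ennreal_square_le)
    qed auto
    then have "(\<integral>\<^sup>+t\<in>{0..T}. (\<integral>\<^sup>+v\<in>{v \<in> {-1..1}. outward_normal {a<..<b} x * v < 0}.
      ennreal (\<bar>h t x v - g t x v\<bar>\<^sup>2) \<partial>lborel) \<partial>lborel) \<le> (ennreal (\<eta>\<^sup>2) * ennreal (1 - (-1))) * ennreal (T - 0)"
      using T by (intro set_nn_integral_le[of "{0..T}" _ _ 0 T]) auto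
    also have "\<dots> = ennreal (2 * \<eta>\<^sup>2 * T)"
      using T by (simp add: ennreal_mult' mult_ac flip: ennreal_numeral)
    finally show ?thesis .
  qed
  have "loss_BC T {a<..<b} g h \<le> ennreal (2 * \<eta>\<^sup>2 * T) + ennreal (2 * \<eta>\<^sup>2 * T)"
    unfolding loss_BC_def fr using ab side by (simp add: add_mono)
  also have "\<dots> = ennreal (4 * \<eta>\<^sup>2 * T)"
    using T by (simp flip: ennreal_plus)
  finally show ?thesis .
qed

lemma open_connected_bounded_real:
  fixes \<Omega> :: "real set"
  assumes "open \<Omega>" "connected \<Omega>" "bounded \<Omega>" "\<Omega> \<noteq> {}"
  obtains a b where "a < b" "\<Omega> = {a<..<b}"
proof -
  have bdd: "bdd_above \<Omega>" "bdd_below \<Omega>"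
    using assms(3) by (auto intro: bounded_imp_bdd_above bounded_imp_bdd_below)
  have eq: "\<Omega> = {Inf \<Omega><..<Sup \<Omega>}"
  proof (intro set_eqI iffI)
    fix x assume x: "x \<in> \<Omega>"
    then obtain e where e: "e > 0" "ball x e \<subseteq> \<Omega>" using assms(1) open_contains_ball by blast
    then have "x - e / 2 \<in> \<Omega>" "x + e / 2 \<in> \<Omega>" by (auto simp: dist_real_def subset_iff)
    then show "x \<in> {Inf \<Omega><..<Sup \<Omega>}"
      using cInf_lower[OF _ bdd(2)] cSup_upper[OF _ bdd(1)] e(1) by fastforce
  next
    fix x assume "x \<in> {Inf \<Omega><..<Sup \<Omega>}"
    then obtain y z where "y \<in> \<Omega>" "y < x" "z \<in> \<Omega>" "x < z"
      using assms(4) bdd by (auto simp: cInf_less_iff less_cSup_iff)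
    then show "x \<in> \<Omega>" using assms(2) unfolding connected_iff_interval by (meson less_imp_le)
  qed
  moreover have "Inf \<Omega> < Sup \<Omega>" using eq assms(4) by fastforce
  ultimately show ?thesis using that by blast
qed

theorem theorem4p1:
  fixes T \<epsilon> lam_g lam_i lam_b :: real and \<Omega> :: "real set" and \<sigma> :: "real \<Rightarrow> real"
    and f0 :: "real \<Rightarrow> real \<Rightarrow> real" and g f :: "real \<Rightarrow> real \<Rightarrow> real \<Rightarrow> real"
    and L :: nat and act :: "nat \<Rightarrow> real \<Rightarrow> real"
  assumes "0 < T" and "0 < \<epsilon>"
    and "open \<Omega>" and "connected \<Omega>" and "bounded \<Omega>" and "\<Omega> \<noteq> {}"
    and "set_borel_measurable borel \<Omega> \<sigma>" and "bounded (\<sigma> ` \<Omega>)"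
    and "0 \<le> lam_g" and "0 \<le> lam_i" and "0 \<le> lam_b"
    and "2 \<le> L" and "\<forall>l\<in>{1..<L}. admissible_activation (act l)"
    and "C1_time_phase T \<Omega> f"
    and "solves_transport \<epsilon> T \<Omega> \<sigma> f0 g f"
  shows "\<exists>(m :: nat \<Rightarrow> nat \<Rightarrow> nat) (w :: nat \<Rightarrow> nat \<Rightarrow> nat \<Rightarrow> nat \<Rightarrow> real) (b :: nat \<Rightarrow> nat \<Rightarrow> nat \<Rightarrow> real).
           (\<forall>j. admissible_widths L (m j)) \<and>
           (\<lambda>j. loss_total lam_g lam_i lam_b \<epsilon> T \<Omega> \<sigma> f0 g (network L act (m j) (w j) (b j))) \<longlonglongrightarrow> 0"
proof -
  obtain a b where ab: "a < b" and \<Omega>: "\<Omega> = {a<..<b}"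
    using open_connected_bounded_real[OF assms(3-6)] by blast
  obtain S where "\<forall>x\<in>{a<..<b}. \<bar>\<sigma> x\<bar> \<le> S"
    using assms(8) unfolding bounded_iff \<Omega> by auto
  then have S: "\<And>x. x \<in> {a<..<b} \<Longrightarrow> \<bar>\<sigma> x\<bar> \<le> S" by blast
  have sol: "solves_transport \<epsilon> T {a<..<b} \<sigma> f0 g f" using assms(15) by (simp add: \<Omega>)
  obtain M where M: "M \<ge> 0" and approx: "\<And>\<eta>. \<eta> > 0 \<Longrightarrow> \<exists>h\<in>networks L act.
    (\<forall>t\<in>{0..T}. \<forall>x\<in>{a..b}. \<forall>v\<in>{-1..1}. \<bar>h t x v - f t x v\<bar> \<le> \<eta>) \<and>
    (\<forall>t\<in>{0..T}. \<forall>x\<in>{a<..<b}. \<forall>v\<in>{-1..1}. \<bar>residual \<epsilon> T \<sigma> h t x v\<bar> \<le> M) \<and>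
    (\<forall>t\<in>{0..T}. \<forall>x\<in>{a+\<eta>..b-\<eta>}. \<forall>v\<in>{-1..1}. \<bar>residual \<epsilon> T \<sigma> h t x v\<bar> \<le> \<eta>)"
    using network_residual_small[OF assms(1,2) ab S assms(12,13) assms(14)[unfolded \<Omega>] sol] by blast
  \<comment> \<open>\<open>M\<close> does not depend on \<open>\<eta>\<close>, so the strip term,
    linear in \<open>\<eta>\<close>, vanishes in the limit like the quadratic ones.\<close>
  define bnd where "bnd \<eta> = lam_g * ((2 * \<eta>\<^sup>2 * (b - a) + 4 * M\<^sup>2 * \<eta>) * T) + lam_i * (2 * \<eta>\<^sup>2 * (b - a))
      + lam_b * (4 * \<eta>\<^sup>2 * T)" for \<eta>
  have "\<exists>m w c. admissible_widths L m \<and>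
      loss_total lam_g lam_i lam_b \<epsilon> T \<Omega> \<sigma> f0 g (network L act m w c) \<le> ennreal (bnd \<eta>)" if \<eta>: "\<eta> > 0" for \<eta>
  proof -
    obtain h where h: "h \<in> networks L act"
      and near: "\<And>t x v. t \<in> {0..T} \<Longrightarrow> x \<in> {a..b} \<Longrightarrow> v \<in> {-1..1} \<Longrightarrow> \<bar>h t x v - f t x v\<bar> \<le> \<eta>"
      and bound: "\<And>t x v. t \<in> {0..T} \<Longrightarrow> x \<in> {a<..<b} \<Longrightarrow> v \<in> {-1..1} \<Longrightarrow> \<bar>residual \<epsilon> T \<sigma> h t x v\<bar> \<le> M"
      and small: "\<And>t x v. t \<in> {0..T} \<Longrightarrow> x \<in> {a+\<eta>..b-\<eta>} \<Longrightarrow> v \<in> {-1..1} \<Longrightarrow> \<bar>residual \<epsilon> T \<sigma> h t x v\<bar> \<le> \<eta>"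
      using approx[OF \<eta>] by blast
    have "loss_GE \<epsilon> T \<Omega> \<sigma> h \<le> ennreal ((2 * \<eta>\<^sup>2 * (b - a) + 4 * M\<^sup>2 * \<eta>) * T)"
      unfolding \<Omega> by (rule loss_GE_le[OF assms(1) \<eta> ab M bound small])
    moreover have "loss_IC \<Omega> f0 h \<le> ennreal (2 * \<eta>\<^sup>2 * (b - a))"
      unfolding \<Omega>
    proof (rule loss_IC_le[OF ab])
      fix x v :: real assume "x \<in> {a<..<b}" "v \<in> {-1..1}"
      then show "\<bar>h 0 x v - f0 x v\<bar> \<le> \<eta>"
        using near[of 0 x v] sol assms(1) by (auto simp: solves_transport_def)
    qed
    moreover have "loss_BC T \<Omega> g h \<le> ennreal (4 * \<eta>\<^sup>2 * T)"
      unfolding \<Omega>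
    proof (rule loss_BC_le[OF assms(1) ab])
      fix t x v assume t: "t \<in> {0..T}" and xv: "(x, v) \<in> inflow_boundary {a<..<b}"
      then have "f t x v = g t x v" using sol by (auto simp: solves_transport_def)
      moreover have "x \<in> {a..b}" "v \<in> {-1..1}"
        using xv ab by (auto simp: inflow_boundary_def frontier_open_interval)
      ultimately show "\<bar>h t x v - g t x v\<bar> \<le> \<eta>" using near[OF t, of x v] by simp
    qed
    ultimately have "loss_total lam_g lam_i lam_b \<epsilon> T \<Omega> \<sigma> f0 g h \<le>
        ennreal lam_g * ennreal ((2 * \<eta>\<^sup>2 * (b - a) + 4 * M\<^sup>2 * \<eta>) * T) + ennreal lam_i * ennreal (2 * \<eta>\<^sup>2 * (b - a))
        + ennreal lam_b * ennreal (4 * \<eta>\<^sup>2 * T)"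
      unfolding loss_total_def by (intro add_mono mult_left_mono) auto
    also have "\<dots> = ennreal (bnd \<eta>)"
      using \<eta> ab assms(1,9-11) by (simp add: bnd_def ennreal_mult' ennreal_plus)
    finally show ?thesis using h unfolding networks_def by blast
  qed
  then have "\<forall>j. \<exists>m w c. admissible_widths L m \<and>
      loss_total lam_g lam_i lam_b \<epsilon> T \<Omega> \<sigma> f0 g (network L act m w c) \<le> ennreal (bnd (1 / Suc j))"
    by simp
  then obtain m w c where mwc: "\<And>j. admissible_widths L (m j)"
    "\<And>j. loss_total lam_g lam_i lam_b \<epsilon> T \<Omega> \<sigma> f0 g (network L act (m j) (w j) (c j)) \<le> ennreal (bnd (1 / Suc j))"
    by metis
  have "(\<lambda>j. 1 / real (Suc j)) \<longlonglongrightarrow> 0"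
    using LIMSEQ_inverse_real_of_nat by (simp add: inverse_eq_divide)
  then have "(\<lambda>j. bnd (1 / real (Suc j))) \<longlonglongrightarrow> bnd 0"
    unfolding bnd_def by (intro tendsto_intros)
  then have "(\<lambda>j. ennreal (bnd (1 / real (Suc j)))) \<longlonglongrightarrow> 0"
    using tendsto_ennrealI by (fastforce simp: bnd_def)
  then have "(\<lambda>j. loss_total lam_g lam_i lam_b \<epsilon> T \<Omega> \<sigma> f0 g (network L act (m j) (w j) (c j))) \<longlonglongrightarrow> 0"
    by (rule tendsto_sandwich[OF always_eventually always_eventually tendsto_const, rotated 2])
      (intro allI zero_le mwc(2))+
  with mwc(1) show ?thesis by blast
qed

end
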